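(* Let $C_*=1.2\cdot 10^5$ and $M(\alpha,\beta)=\max\{1,(\alpha+\beta+1)^{1/4}\}$. For all integers $n\ge 0$, all real $\alpha,\beta\ge-1/2$ and all $x\in[-1,1]$, $$F_{n,\alpha,\beta}(x)\le C_*\,M(\alpha,\beta).$$ Consequently the Erdélyi–Magnus–Nevai conjecture holds: there is an absolute constant $C$ such that for all integers $n\ge0$ and all real $\alpha,\beta\ge-1/2$, $$\max_{-1\le x\le1}F_{n,\alpha,\beta}(x)^2\le C\,\max\{1,(\alpha^2+\beta^2)^{1/4}\}.$$
   Context: For real $\alpha,\beta\ge-1/2$ put $w_{\alpha,\beta}(x)=(1-x)^\alpha(1+x)^\beta$, $-1<x<1$. For an integer $n\ge0$, $p_n^{(\alpha,\beta)}$ denotes the (Jacobi) polynomial of degree $n$ orthonormal in $L^2([-1,1],w_{\alpha,\beta}\,dx)$ (unique up to sign). Define, for $-1<x<1$, $$F_{n,\alpha,\beta}(x)=(1-x^2)^{1/4}\,w_{\alpha,\beta}(x)^{1/2}\,|p_n^{(\alpha,\beta)}(x)|,$$ so that $F_{n,\alpha,\beta}(x)^2=(1-x)^{\alpha+1/2}(1+x)^{\beta+1/2}|p_n^{(\alpha,\beta)}(x)|^2$. Values at $x=\pm1$ are understood as one-sided limits from $(-1,1)$ (these exist and are finite). *)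

theory Defs
  imports "HOL-Analysis.Analysis" "HOL-Computational_Algebra.Polynomial"
begin

definition jacobi_weight :: "real \<Rightarrow> real \<Rightarrow> real \<Rightarrow> real" where
  "jacobi_weight \<alpha> \<beta> x = (1 - x) powr \<alpha> * (1 + x) powr \<beta>"

definition jacobi_inner :: "real \<Rightarrow> real \<Rightarrow> real poly \<Rightarrow> real poly \<Rightarrow> real" where
  "jacobi_inner \<alpha> \<beta> p q =
     (LINT x:{-1..1}|lborel. poly p x * poly q x * jacobi_weight \<alpha> \<beta> x)"

text \<open>The \<open>n\<close>-th orthonormal polynomial is determined only up to its sign, so we speak of
  any sequence of orthonormal polynomials instead of choosing one.\<close>

definition orthonormal_jacobi :: "real \<Rightarrow> real \<Rightarrow> (nat \<Rightarrow> real poly) \<Rightarrow> bool" where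
  "orthonormal_jacobi \<alpha> \<beta> p \<longleftrightarrow>
     (\<forall>n. degree (p n) = n) \<and>
     (\<forall>m n. jacobi_inner \<alpha> \<beta> (p m) (p n) = (if m = n then 1 else 0))"

definition jacobi_F_open :: "real \<Rightarrow> real \<Rightarrow> real poly \<Rightarrow> real \<Rightarrow> real" where
  "jacobi_F_open \<alpha> \<beta> p x =
     (1 - x\<^sup>2) powr (1/4) * jacobi_weight \<alpha> \<beta> x powr (1/2) * \<bar>poly p x\<bar>"

text \<open>At \<open>\<plusminus>1\<close> the formula above evaluates to \<open>0\<close> by the convention \<open>0 powr a = 0\<close>, whereas
  its one-sided limits are positive when the exponent there is \<open>-1/2\<close>.  Hence the explicit limits;
  lemma \<open>jacobi_F_tendsto\<close> below shows that they exist.\<close>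

definition jacobi_F :: "real \<Rightarrow> real \<Rightarrow> real poly \<Rightarrow> real \<Rightarrow> real" where
  "jacobi_F \<alpha> \<beta> p x =
     (if x = 1 then Lim (at_left 1) (jacobi_F_open \<alpha> \<beta> p)
      else if x = -1 then Lim (at_right (-1)) (jacobi_F_open \<alpha> \<beta> p)
      else jacobi_F_open \<alpha> \<beta> p x)"

definition jacobi_M :: "real \<Rightarrow> real \<Rightarrow> real" where
  "jacobi_M \<alpha> \<beta> = max 1 ((\<alpha> + \<beta> + 1) powr (1/4))"

lemma jacobi_F_open_eq:
  assumes "-1 < x" "x < 1"
  shows "jacobi_F_open \<alpha> \<beta> p x =
    (1 - x) powr (\<alpha>/2 + 1/4) * (1 + x) powr (\<beta>/2 + 1/4) * \<bar>poly p x\<bar>"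
proof -
  have "1 - x\<^sup>2 = (1 - x) * (1 + x)" by (simp add: power2_eq_square algebra_simps)
  then show ?thesis
    using assms
    by (simp add: jacobi_F_open_def jacobi_weight_def powr_mult powr_powr powr_add)
qed

lemma powr_nonneg_exp_tendsto:
  fixes f :: "real \<Rightarrow> real"
  assumes "(f \<longlongrightarrow> 0) F" "eventually (\<lambda>x. f x > 0) F" "e \<ge> 0"
  shows "((\<lambda>x. f x powr e) \<longlongrightarrow> (if e = 0 then 1 else 0)) F"
proof (cases "e = 0")
  case True
  have "eventually (\<lambda>x. 1 = f x powr e) F"
    using assms(2) by eventually_elim (simp add: True)
  then show ?thesis using True by (auto intro: Lim_transform_eventually[OF tendsto_const])
next
  case False
  have "eventually (\<lambda>x. f x \<ge> 0) F"
    using assms(2) by eventually_elim simp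
  then show ?thesis using False assms tendsto_powr2[OF assms(1) tendsto_const[of e]] by simp
qed

lemma jacobi_F_tendsto:
  assumes "\<alpha> \<ge> -1/2" "\<beta> \<ge> -1/2"
  shows "(jacobi_F_open \<alpha> \<beta> p \<longlongrightarrow> jacobi_F \<alpha> \<beta> p 1) (at_left 1)"
    and "(jacobi_F_open \<alpha> \<beta> p \<longlongrightarrow> jacobi_F \<alpha> \<beta> p (-1)) (at_right (-1))"
proof -
  have ev: "eventually (\<lambda>x::real. -1 < x \<and> x < 1) (at_left 1)"
    using eventually_at_left_real[of "-1" "1::real"] by simp
  have "((\<lambda>x. (1 - x) powr (\<alpha>/2 + 1/4)) \<longlongrightarrow> (if \<alpha>/2 + 1/4 = 0 then 1 else 0)) (at_left 1)"
    using assms ev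
    by (intro powr_nonneg_exp_tendsto) (auto intro!: tendsto_eq_intros elim: eventually_mono)
  moreover have "((\<lambda>x. (1 + x) powr (\<beta>/2 + 1/4) * \<bar>poly p x\<bar>)
      \<longlongrightarrow> (1 + 1) powr (\<beta>/2 + 1/4) * \<bar>poly p 1\<bar>) (at_left 1)"
    by (intro tendsto_intros) auto
  ultimately have "((\<lambda>x. (1 - x) powr (\<alpha>/2 + 1/4) * ((1 + x) powr (\<beta>/2 + 1/4) * \<bar>poly p x\<bar>))
      \<longlongrightarrow> (if \<alpha>/2 + 1/4 = 0 then 1 else 0) * ((1 + 1) powr (\<beta>/2 + 1/4) * \<bar>poly p 1\<bar>)) (at_left 1)"
    by (rule tendsto_mult)
  moreover have "eventually (\<lambda>x. (1 - x) powr (\<alpha>/2 + 1/4) * ((1 + x) powr (\<beta>/2 + 1/4) * \<bar>poly p x\<bar>)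
      = jacobi_F_open \<alpha> \<beta> p x) (at_left 1)"
    using ev by eventually_elim (simp add: jacobi_F_open_eq)
  ultimately obtain l where "(jacobi_F_open \<alpha> \<beta> p \<longlongrightarrow> l) (at_left 1)"
    using Lim_transform_eventually by blast
  then show "(jacobi_F_open \<alpha> \<beta> p \<longlongrightarrow> jacobi_F \<alpha> \<beta> p 1) (at_left 1)"
    by (simp add: jacobi_F_def tendsto_Lim)
next
  have ev: "eventually (\<lambda>x::real. -1 < x \<and> x < 1) (at_right (-1))"
    using eventually_at_right_real[of "-1" "1::real"] by simp
  have "((\<lambda>x. (1 + x) powr (\<beta>/2 + 1/4)) \<longlongrightarrow> (if \<beta>/2 + 1/4 = 0 then 1 else 0)) (at_right (-1))"
    using assms ev
    by (intro powr_nonneg_exp_tendsto) (auto intro!: tendsto_eq_intros elim: eventually_mono)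
  moreover have "((\<lambda>x. (1 - x) powr (\<alpha>/2 + 1/4) * \<bar>poly p x\<bar>)
      \<longlongrightarrow> (1 - (-1)) powr (\<alpha>/2 + 1/4) * \<bar>poly p (-1)\<bar>) (at_right (-1))"
    by (intro tendsto_intros) auto
  ultimately have "((\<lambda>x. (1 + x) powr (\<beta>/2 + 1/4) * ((1 - x) powr (\<alpha>/2 + 1/4) * \<bar>poly p x\<bar>))
      \<longlongrightarrow> (if \<beta>/2 + 1/4 = 0 then 1 else 0) * ((1 - (-1)) powr (\<alpha>/2 + 1/4) * \<bar>poly p (-1)\<bar>)) (at_right (-1))"
    by (rule tendsto_mult)
  moreover have "eventually (\<lambda>x. (1 + x) powr (\<beta>/2 + 1/4) * ((1 - x) powr (\<alpha>/2 + 1/4) * \<bar>poly p x\<bar>)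
      = jacobi_F_open \<alpha> \<beta> p x) (at_right (-1))"
    using ev by eventually_elim (simp add: jacobi_F_open_eq)
  ultimately obtain l where "(jacobi_F_open \<alpha> \<beta> p \<longlongrightarrow> l) (at_right (-1))"
    using Lim_transform_eventually by blast
  then show "(jacobi_F_open \<alpha> \<beta> p \<longlongrightarrow> jacobi_F \<alpha> \<beta> p (-1)) (at_right (-1))"
    by (simp add: jacobi_F_def tendsto_Lim)
qed

lemma jacobi_weight_integrable:
  assumes "\<alpha> > -1" "\<beta> > -1"
  shows "set_integrable lborel {-1..1} (jacobi_weight \<alpha> \<beta>)"
proof -
  have "set_integrable lborel {0..1} (\<lambda>t. t powr \<beta> * (1 - t) powr \<alpha>)"
    using integrable_Beta[of "\<beta> + 1" "\<alpha> + 1"] assms by simp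
  from lborel_integrable_real_affine[OF this[unfolded set_integrable_def], of "1/2" "1/2"]
  have "integrable lborel (\<lambda>x. 2 powr (\<alpha> + \<beta>) * (indicator {0..1} ((1 + x) / 2) *
      (((1 + x) / 2) powr \<beta> * ((1 - x) / 2) powr \<alpha>)))" (is "integrable _ ?f")
    by (simp add: field_simps)
  also have "?f = (\<lambda>x. indicator {-1..1} x *\<^sub>R jacobi_weight \<alpha> \<beta> x)"
    by (auto simp: fun_eq_iff jacobi_weight_def powr_divide powr_add split: split_indicator)
  finally show ?thesis by (simp add: set_integrable_def)
qed

lemma jacobi_inner_integrable:
  assumes "\<alpha> > -1" "\<beta> > -1"
  shows "set_integrable lborel {-1..1} (\<lambda>x. poly p x * poly q x * jacobi_weight \<alpha> \<beta> x)"
proof -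
  have "compact ((\<lambda>x. poly p x * poly q x) ` {-1..1})"
    by (intro compact_continuous_image continuous_intros) auto
  then obtain B where "\<forall>x\<in>{-1..1}. \<bar>poly p x * poly q x\<bar> \<le> B"
    by (auto dest!: compact_imp_bounded simp: bounded_iff)
  then have B: "\<And>x. x \<in> {-1..1} \<Longrightarrow> \<bar>poly p x * poly q x\<bar> \<le> B" by blast
  have [measurable]: "(poly r :: real \<Rightarrow> real) \<in> borel_measurable borel" for r
    by (intro borel_measurable_continuous_onI continuous_intros)
  have "integrable lborel (\<lambda>x. B * (indicator {-1..1} x *\<^sub>R jacobi_weight \<alpha> \<beta> x))"
    using jacobi_weight_integrable[OF assms] by (auto simp: set_integrable_def)
  then show ?thesis
    unfolding set_integrable_def
  proof (rule Bochner_Integration.integrable_bound)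
    show "(\<lambda>x. indicator {-1..1} x *\<^sub>R (poly p x * poly q x * jacobi_weight \<alpha> \<beta> x))
        \<in> borel_measurable lborel"
      unfolding jacobi_weight_def by measurable
    have "norm (indicator {-1..1} x *\<^sub>R (poly p x * poly q x * jacobi_weight \<alpha> \<beta> x))
        \<le> norm (B * (indicator {-1..1} x *\<^sub>R jacobi_weight \<alpha> \<beta> x))" for x
    proof (cases "x \<in> {-1..1}")
      case True
      have "\<bar>poly p x * poly q x\<bar> \<le> \<bar>B\<bar>" using B[OF True] by linarith
      with True show ?thesis by (auto simp: abs_mult intro!: mult_right_mono)
    qed auto
    then show "AE x in lborel. norm (indicator {-1..1} x *\<^sub>R (poly p x * poly q x * jacobi_weight \<alpha> \<beta> x))
        \<le> norm (B * (indicator {-1..1} x *\<^sub>R jacobi_weight \<alpha> \<beta> x))" by simp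
  qed
qed

lemma jacobi_inner_commute: "jacobi_inner \<alpha> \<beta> p q = jacobi_inner \<alpha> \<beta> q p"
  by (simp add: jacobi_inner_def mult_ac)

lemma jacobi_inner_smult: "jacobi_inner \<alpha> \<beta> (smult c p) q = c * jacobi_inner \<alpha> \<beta> p q"
  by (simp add: jacobi_inner_def mult.assoc)

lemma jacobi_inner_diff:
  assumes "\<alpha> > -1" "\<beta> > -1"
  shows "jacobi_inner \<alpha> \<beta> (p - r) q = jacobi_inner \<alpha> \<beta> p q - jacobi_inner \<alpha> \<beta> r q"
  using set_integral_diff(2)[OF jacobi_inner_integrable jacobi_inner_integrable, OF assms assms, of p q r q]
  by (simp add: jacobi_inner_def algebra_simps)

lemma jacobi_inner_add:
  assumes "\<alpha> > -1" "\<beta> > -1"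
  shows "jacobi_inner \<alpha> \<beta> (p + r) q = jacobi_inner \<alpha> \<beta> p q + jacobi_inner \<alpha> \<beta> r q"
  using set_integral_add(2)[OF jacobi_inner_integrable jacobi_inner_integrable, OF assms assms, of p q r q]
  by (simp add: jacobi_inner_def algebra_simps)

lemma jacobi_inner_sum:
  assumes "\<alpha> > -1" "\<beta> > -1"
  shows "jacobi_inner \<alpha> \<beta> (\<Sum>i\<in>A. f i) q = (\<Sum>i\<in>A. jacobi_inner \<alpha> \<beta> (f i) q)"
proof -
  have "jacobi_inner \<alpha> \<beta> 0 q = 0" by (simp add: jacobi_inner_def)
  then show ?thesis
    by (induction A rule: infinite_finite_induct) (auto simp: jacobi_inner_add[OF assms])
qed

lemma jacobi_inner_pos:
  assumes "\<alpha> > -1" "\<beta> > -1" "p \<noteq> 0"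
  shows "jacobi_inner \<alpha> \<beta> p p > 0"
proof -
  let ?f = "\<lambda>x. indicator {-1..1} x *\<^sub>R (poly p x * poly p x * jacobi_weight \<alpha> \<beta> x)"
  have nonneg: "?f x \<ge> 0" for x by (auto simp: jacobi_weight_def split: split_indicator)
  have "jacobi_inner \<alpha> \<beta> p p \<noteq> 0"
  proof
    assume "jacobi_inner \<alpha> \<beta> p p = 0"
    then have "AE x in lborel. ?f x = 0"
      using integral_nonneg_eq_0_iff_AE[of lborel ?f] nonneg
        jacobi_inner_integrable[OF assms(1,2), of p p]
      by (simp add: jacobi_inner_def set_lebesgue_integral_def set_integrable_def)
    moreover have "AE x in lborel. x \<notin> {x. poly p x = 0}"
      using poly_roots_finite[OF assms(3)]
      by (intro AE_not_in finite_imp_null_set_lborel)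
    ultimately have "AE x in lborel. x \<notin> {-1<..<(1::real)}"
      by eventually_elim (auto simp: jacobi_weight_def)
    then have "emeasure lborel {-1<..<(1::real)} = 0"
      by (subst (asm) AE_iff_measurable[where N = "{-1<..<1}"]) auto
    then show False by simp
  qed
  moreover have "jacobi_inner \<alpha> \<beta> p p \<ge> 0"
    unfolding jacobi_inner_def set_lebesgue_integral_def using nonneg by (intro integral_nonneg_AE) auto
  ultimately show ?thesis by linarith
qed

lemma orthonormal_jacobi_exists:
  assumes "\<alpha> > -1" "\<beta> > -1"
  shows "\<exists>p. orthonormal_jacobi \<alpha> \<beta> p"
proof -
  let ?I = "jacobi_inner \<alpha> \<beta>"
  let ?P = "\<lambda>f n r. degree r = n \<and> ?I r r = 1 \<and> (\<forall>m<n. ?I r (f m) = 0)"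
  have "\<exists>f. \<forall>n. ?P f n (f n)"
  proof (rule dependent_wellorder_choice)
    fix n and f :: "nat \<Rightarrow> real poly"
    assume f: "\<And>m. m < n \<Longrightarrow> ?P f m (f m)"
    have ortho: "?I (f i) (f j) = (if i = j then 1 else 0)" if "i < n" "j < n" for i j
      using f[OF that(1)] f[OF that(2)] jacobi_inner_commute[of \<alpha> \<beta> "f i" "f j"]
      by (cases i j rule: linorder_cases) auto
    define s where "s = (\<Sum>i<n. smult (?I (monom 1 n) (f i)) (f i))"
    define q where "q = monom 1 n - s"
    have "coeff s k = 0" if "k \<ge> n" for k
      using f that by (auto simp: s_def coeff_sum intro!: sum.neutral coeff_eq_0)
    then have "coeff q n = 1" "\<And>k. k > n \<Longrightarrow> coeff q k = 0"
      by (auto simp: q_def)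
    then have "degree q \<le> n" "n \<le> degree q" and q0: "q \<noteq> 0"
      by (simp_all add: degree_le le_degree) auto
    then have q: "degree q = n" "q \<noteq> 0" by simp_all
    have qf: "?I q (f m) = 0" if "m < n" for m
    proof -
      have "?I s (f m) = (\<Sum>i<n. if i = m then ?I (monom 1 n) (f i) else 0)"
        unfolding s_def jacobi_inner_sum[OF assms] jacobi_inner_smult
        using that by (intro sum.cong) (auto simp: ortho)
      then show ?thesis using that by (simp add: q_def jacobi_inner_diff[OF assms])
    qed
    have pos: "?I q q > 0" using jacobi_inner_pos[OF assms q(2)] .
    define c where "c = 1 / sqrt (?I q q)"
    have "c \<noteq> 0" "c * (c * ?I q q) = 1"
      using pos by (auto simp: c_def field_simps simp flip: power2_eq_square)
    then have "?P f n (smult c q)"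
      using q qf jacobi_inner_commute[of \<alpha> \<beta> q "smult c q"] by (simp add: jacobi_inner_smult)
    then show "\<exists>r. ?P f n r" by blast
  qed auto
  then obtain p where p: "\<And>n. ?P p n (p n)" by blast
  have "?I (p m) (p n) = (if m = n then 1 else 0)" for m n
    using p[of m] p[of n] jacobi_inner_commute[of \<alpha> \<beta> "p m" "p n"]
    by (cases m n rule: linorder_cases) auto
  with p show ?thesis unfolding orthonormal_jacobi_def by blast
qed

end

theory Submission
  imports Defs
begin

text \<open>All estimates must be uniform in n, \<alpha> and \<beta> at once, so the analysis is
  reduced to inequalities between N, r, m and s = max 1 (\<alpha> + \<beta> + 1), the fourth power
  of M. The factor \<open>sqrt s\<close> has its source at the centre m: the ratio of 1 - m^2 to r^2
  may be of order s, for instance for fixed n and large \<alpha> = \<beta>. Degrees from 7 on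
  guarantee N r >= 6, which keeps the error term of the virial identity below the main term and
  controls the turning point. For them only x >= m is treated, since x -> -x exchanges \<alpha> and
  \<beta>. The bound obtained is F^2 <= 4320 sqrt s, with 4320 = 36 * 120 and 120 = 6 * 4 * 5: 6 is
  the loss in the adiabatic invariant, 4 the energy constant at m, 5 an upper bound of sqrt 24 from
  the comparison of N^2 / cosh^2 t with D, and 36 the loss past the WKB region. Since sqrt 4320 <
  66, this is far within the constant 1.2 * 10^5.\<close>

text \<open>With \<open>x = tanh t\<close>, the function \<open>v = (1 - x)\<^sup>\<alpha>\<^sup>/\<^sup>2 (1 + x)\<^sup>\<beta>\<^sup>/\<^sup>2 p\<^sub>n(x)\<close> satisfies \<open>v'' = - D v\<close>, where
  \<open>D = N\<^sup>2 (r\<^sup>2 - (x - m)\<^sup>2)\<close> is a quadratic polynomial in \<open>x\<close>, and \<open>F\<^sup>2 = v\<^sup>2 / cosh t\<close>.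
  The energy \<open>v'\<^sup>2 + D v\<^sup>2\<close> is largest at \<open>x = m\<close>. There it equals an integral of \<open>x - m\<close> against
  \<open>p\<^sub>n\<^sup>2 w\<close>, and a virial identity bounds the variance of \<open>x\<close> under this probability density by about
  \<open>r\<^sup>2\<close>; so the energy at \<open>m\<close> is at most \<open>4 N\<^sup>2 r\<close>. The WKB amplitude
  \<open>\<surd>D v\<^sup>2 + v'\<^sup>2 / \<surd>D\<close> is an adiabatic invariant up to a bounded factor as long as
  \<open>|D'| \<le> 2 D\<^sup>3\<^sup>/\<^sup>2\<close>, and on this region \<open>N\<^sup>2 / cosh\<^sup>2 t\<close> is at most a multiple of
  \<open>max 1 (\<alpha> + \<beta> + 1) D\<close>, which gives the bound. Past this region only a bounded part of an oscillation
  remains before \<open>v\<close> decays. If the potential has no turning point at an end because the exponent there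
  is at most \<open>1/2\<close> in modulus, Sonin's function takes over.
  For \<open>n \<le> 6\<close> the bound follows from \<open>\<integral> (1 - x\<^sup>2) p\<^sub>n'\<^sup>2 w = n (n + \<alpha> + \<beta> + 1)\<close> alone.\<close>


section \<open>The Jacobi differential equation\<close>

text \<open>With w the weight, this is the divergence ((1 - x^2) w q)' / w. Every integral identity
  below integrates such an expression for a suitable q.\<close>

definition jacobi_div :: "real \<Rightarrow> real \<Rightarrow> real poly \<Rightarrow> real poly" where
  "jacobi_div \<alpha> \<beta> q = [:1, 0, -1:] * pderiv q + [:\<beta> - \<alpha>, - (\<alpha> + \<beta> + 2):] * q"

lemma poly_jacobi_div:
  "poly (jacobi_div \<alpha> \<beta> q) x =
     (1 - x\<^sup>2) * poly (pderiv q) x + (\<beta> - \<alpha> - (\<alpha> + \<beta> + 2) * x) * poly q x"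
  by (simp add: jacobi_div_def power2_eq_square algebra_simps)

text \<open>The primitive (1 - x^2) w q has positive exponents at both ends, so it is continuous up
  to the ends and vanishes there, even where w is unbounded. The lower limit c is -1 for global
  identities and m for the energy.\<close>

lemma jacobi_div_has_integral:
  assumes "\<alpha> > -1" "\<beta> > -1" "-1 \<le> c" "c \<le> 1"
  shows "((\<lambda>x. poly (jacobi_div \<alpha> \<beta> q) x * jacobi_weight \<alpha> \<beta> x) has_integral
           - ((1 - c\<^sup>2) * jacobi_weight \<alpha> \<beta> c * poly q c)) {c..1}"
proof -
  let ?F = "\<lambda>x. (1 - x) powr (\<alpha> + 1) * (1 + x) powr (\<beta> + 1) * poly q x"
  have "((\<lambda>x. poly (jacobi_div \<alpha> \<beta> q) x * jacobi_weight \<alpha> \<beta> x) has_integral ?F 1 - ?F c) {c..1}"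
  proof (rule fundamental_theorem_of_calculus_interior)
    show "continuous_on {c..1} ?F"
      using assms by (intro continuous_intros continuous_on_powr') auto
    fix x assume x: "x \<in> {c<..<1}"
    then have p: "1 - x > 0" "1 + x > 0" using assms by auto
    have "(1 - x) powr (\<alpha> + 1) = (1 - x) * (1 - x) powr \<alpha>"
         "(1 + x) powr (\<beta> + 1) = (1 + x) * (1 + x) powr \<beta>"
      using p by (simp_all add: powr_add)
    note pw = this
    have "((\<lambda>x. (1 - x) powr (\<alpha> + 1)) has_real_derivative - ((\<alpha> + 1) * (1 - x) powr \<alpha>)) (at x)"
         "((\<lambda>x. (1 + x) powr (\<beta> + 1)) has_real_derivative (\<beta> + 1) * (1 + x) powr \<beta>) (at x)"
      using p by (auto intro!: derivative_eq_intros)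
    from DERIV_mult[OF DERIV_mult[OF this] poly_DERIV[of q x]]
    have "(?F has_real_derivative poly (jacobi_div \<alpha> \<beta> q) x * jacobi_weight \<alpha> \<beta> x) (at x)"
      unfolding poly_jacobi_div jacobi_weight_def pw
      by (rule DERIV_cong) (simp add: power2_eq_square algebra_simps)
    then show "(?F has_vector_derivative poly (jacobi_div \<alpha> \<beta> q) x * jacobi_weight \<alpha> \<beta> x) (at x)"
      by (simp add: has_real_derivative_iff_has_vector_derivative)
  qed (use assms in auto)
  moreover have "?F c = (1 - c\<^sup>2) * jacobi_weight \<alpha> \<beta> c * poly q c"
  proof (cases "c = 1 \<or> c = -1")
    case False
    then have pw: "(1 - c) powr (\<alpha> + 1) = (1 - c) * (1 - c) powr \<alpha>"
         "(1 + c) powr (\<beta> + 1) = (1 + c) * (1 + c) powr \<beta>"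
      using assms by (simp_all add: powr_add)
    show ?thesis unfolding pw jacobi_weight_def by (simp add: power2_eq_square algebra_simps)
  qed (use assms in auto)
  ultimately show ?thesis by simp
qed

lemma jacobi_inner_has_integral:
  assumes "\<alpha> > -1" "\<beta> > -1"
  shows "((\<lambda>x. poly p x * poly q x * jacobi_weight \<alpha> \<beta> x) has_integral jacobi_inner \<alpha> \<beta> p q) {-1..1}"
  using set_borel_integral_eq_integral[OF jacobi_inner_integrable[OF assms, of p q]]
  by (simp add: jacobi_inner_def has_integral_integrable_integral)

definition jacobi_op :: "real \<Rightarrow> real \<Rightarrow> real poly \<Rightarrow> real poly" where
  "jacobi_op \<alpha> \<beta> p = jacobi_div \<alpha> \<beta> (pderiv p)"

text \<open>Lagrange's identity: the difference of the two integrands is the divergence of the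
  Wronskian p' q - p q'.\<close>

lemma jacobi_op_symmetric:
  assumes "\<alpha> > -1" "\<beta> > -1"
  shows "jacobi_inner \<alpha> \<beta> (jacobi_op \<alpha> \<beta> p) q = jacobi_inner \<alpha> \<beta> p (jacobi_op \<alpha> \<beta> q)"
proof -
  let ?r = "pderiv p * q - p * pderiv q"
  have "((\<lambda>x. poly (jacobi_div \<alpha> \<beta> ?r) x * jacobi_weight \<alpha> \<beta> x) has_integral 0) {-1..1}"
    using jacobi_div_has_integral[OF assms, of "-1" ?r] by simp
  moreover have "poly (jacobi_div \<alpha> \<beta> ?r) x * jacobi_weight \<alpha> \<beta> x =
      poly (jacobi_op \<alpha> \<beta> p) x * poly q x * jacobi_weight \<alpha> \<beta> x
      - poly p x * poly (jacobi_op \<alpha> \<beta> q) x * jacobi_weight \<alpha> \<beta> x" for x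
    unfolding jacobi_op_def poly_jacobi_div
    by (simp add: pderiv_mult pderiv_diff algebra_simps)
  ultimately have "((\<lambda>x. poly (jacobi_op \<alpha> \<beta> p) x * poly q x * jacobi_weight \<alpha> \<beta> x
      - poly p x * poly (jacobi_op \<alpha> \<beta> q) x * jacobi_weight \<alpha> \<beta> x) has_integral 0) {-1..1}"
    by simp
  moreover have "((\<lambda>x. poly (jacobi_op \<alpha> \<beta> p) x * poly q x * jacobi_weight \<alpha> \<beta> x
      - poly p x * poly (jacobi_op \<alpha> \<beta> q) x * jacobi_weight \<alpha> \<beta> x) has_integral
      jacobi_inner \<alpha> \<beta> (jacobi_op \<alpha> \<beta> p) q - jacobi_inner \<alpha> \<beta> p (jacobi_op \<alpha> \<beta> q)) {-1..1}"
    by (rule has_integral_diff[OF jacobi_inner_has_integral[OF assms] jacobi_inner_has_integral[OF assms]])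
  ultimately have "0 = jacobi_inner \<alpha> \<beta> (jacobi_op \<alpha> \<beta> p) q - jacobi_inner \<alpha> \<beta> p (jacobi_op \<alpha> \<beta> q)"
    by (rule has_integral_unique)
  then show ?thesis by simp
qed

text \<open>The first n polynomials of the sequence span all polynomials of degree below n:
  subtracting a multiple of \<open>p (degree q)\<close> removes the leading term of q.\<close>

lemma orthonormal_jacobi_orthogonal:
  assumes "\<alpha> > -1" "\<beta> > -1" "orthonormal_jacobi \<alpha> \<beta> p" "degree q < n"
  shows "jacobi_inner \<alpha> \<beta> q (p n) = 0"
  using assms(4)
proof (induction "degree q" arbitrary: q rule: less_induct)
  case less
  let ?d = "degree q"
  have deg: "degree (p k) = k" and orth: "jacobi_inner \<alpha> \<beta> (p k) (p l) = (if k = l then 1 else 0)" for k l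
    using assms(3) by (auto simp: orthonormal_jacobi_def)
  have "p ?d \<noteq> 0" using orth[of ?d ?d] by (auto simp: jacobi_inner_def)
  then have lc: "coeff (p ?d) ?d \<noteq> 0" using deg[of ?d] leading_coeff_0_iff[of "p ?d"] by simp
  define c where "c = coeff q ?d / coeff (p ?d) ?d"
  define q' where "q' = q - smult c (p ?d)"
  have q: "q = q' + smult c (p ?d)" by (simp add: q'_def)
  have c0: "coeff q' ?d = 0" using lc by (simp add: q'_def c_def)
  have le: "degree q' \<le> ?d" unfolding q'_def by (intro degree_diff_le) (auto simp: deg)
  have "jacobi_inner \<alpha> \<beta> q' (p n) = 0"
  \<comment> \<open>The zero polynomial has degree 0, so for constant q the degree does not drop and
    the induction hypothesis does not apply.\<close>
  proof (cases "q' = 0")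
    case True then show ?thesis by (simp add: jacobi_inner_def)
  next
    case False
    then have "degree q' \<noteq> ?d" using c0 leading_coeff_0_iff[of q'] by metis
    with le less show ?thesis by simp
  qed
  moreover have "jacobi_inner \<alpha> \<beta> (smult c (p ?d)) (p n) = 0"
    using less(2) by (simp add: jacobi_inner_smult orth)
  ultimately show ?case by (subst q, subst jacobi_inner_add) (use assms in auto)
qed

lemma degree_jacobi_op_le: "degree (jacobi_op \<alpha> \<beta> q) \<le> degree q"
proof (cases "degree q = 0")
  case True
  then have "pderiv q = 0" by (simp add: pderiv_eq_0_iff)
  then show ?thesis by (simp add: jacobi_div_def jacobi_op_def)
next
  case False
  then have d: "degree (pderiv q) = degree q - 1" by (simp add: degree_pderiv)
  have "degree ([:1, 0, -1:] * pderiv (pderiv q)) \<le> degree q"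
  proof (cases "degree q = 1")
    case True
    with d have "degree (pderiv q) = 0" by simp
    then have "pderiv (pderiv q) = 0" by (simp add: pderiv_eq_0_iff)
    then show ?thesis by simp
  next
    case n1: False
    have "degree (pderiv (pderiv q)) = degree q - 2" using d by (simp add: degree_pderiv)
    with degree_mult_le[of "[:1,0,-1:]" "pderiv (pderiv q)"] False n1 show ?thesis by simp
  qed
  moreover have "degree ([:\<beta> - \<alpha>, - (\<alpha> + \<beta> + 2):] * pderiv q) \<le> degree q"
    using degree_mult_le[of "[:\<beta> - \<alpha>, - (\<alpha> + \<beta> + 2):]" "pderiv q"] d False
    by (simp split: if_splits)
  ultimately show ?thesis by (auto simp: jacobi_op_def jacobi_div_def intro!: degree_add_le)
qed

lemma coeff_jacobi_op:
  assumes "degree q \<le> n"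
  shows "coeff (jacobi_op \<alpha> \<beta> q) n = - (n * (n + \<alpha> + \<beta> + 1)) * coeff q n"
proof -
  have [simp]: "coeff q (Suc n) = 0" "coeff q (Suc (Suc n)) = 0"
    using assms by (auto intro!: coeff_eq_0)
  show ?thesis
  proof (cases n)
    case 0
    then show ?thesis using assms \<open>coeff q (Suc n) = 0\<close> \<open>coeff q (Suc (Suc n)) = 0\<close>
      by (auto simp: jacobi_op_def jacobi_div_def coeff_pderiv)
  next
    case (Suc k)
    have "coeff q (Suc (Suc k)) = 0" "coeff q (Suc (Suc (Suc k))) = 0"
      using Suc assms by (auto intro!: coeff_eq_0)
    then show ?thesis using Suc
      by (cases k) (simp_all add: jacobi_op_def jacobi_div_def coeff_pderiv algebra_simps)
  qed
qed

text \<open>The multiple of \<open>p n\<close> is chosen to cancel the leading coefficient, so the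
  difference q has degree below n. By symmetry q is then orthogonal to both of its terms, hence to
  itself.\<close>

lemma orthonormal_jacobi_ode:
  assumes "\<alpha> > -1" "\<beta> > -1" "orthonormal_jacobi \<alpha> \<beta> p"
  shows "jacobi_op \<alpha> \<beta> (p n) = smult (- (n * (n + \<alpha> + \<beta> + 1))) (p n)"
proof -
  define c where "c = - (n * (n + \<alpha> + \<beta> + 1))"
  define q where "q = jacobi_op \<alpha> \<beta> (p n) - smult c (p n)"
  have deg: "degree (p n) = n" using assms(3) by (auto simp: orthonormal_jacobi_def)
  have le: "degree q \<le> n"
    unfolding q_def using degree_jacobi_op_le[of \<alpha> \<beta> "p n"] deg by (intro degree_diff_le) auto
  have c0: "coeff q n = 0" using coeff_jacobi_op[of "p n" n \<alpha> \<beta>] deg by (simp add: q_def c_def)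
  have "q = 0"
  proof (rule ccontr)
    assume q: "q \<noteq> 0"
    then have lt: "degree q < n" using le c0 leading_coeff_0_iff[of q] by (metis le_neq_implies_less)
    have "jacobi_inner \<alpha> \<beta> (jacobi_op \<alpha> \<beta> (p n)) q = jacobi_inner \<alpha> \<beta> (jacobi_op \<alpha> \<beta> q) (p n)"
      using jacobi_op_symmetric[of \<alpha> \<beta> "p n" q] assms jacobi_inner_commute by metis
    also have "\<dots> = 0"
      using degree_jacobi_op_le[of \<alpha> \<beta> q] lt assms by (intro orthonormal_jacobi_orthogonal) auto
    finally have 1: "jacobi_inner \<alpha> \<beta> (jacobi_op \<alpha> \<beta> (p n)) q = 0" .
    have "jacobi_inner \<alpha> \<beta> (smult c (p n)) q = 0"
      using orthonormal_jacobi_orthogonal[OF assms lt] jacobi_inner_commute[of \<alpha> \<beta> "p n" q]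
      by (simp add: jacobi_inner_smult)
    with 1 have "jacobi_inner \<alpha> \<beta> q q = 0"
      unfolding q_def using assms by (subst jacobi_inner_diff) auto
    with jacobi_inner_pos[OF assms(1,2) q] show False by simp
  qed
  then show ?thesis by (simp add: q_def c_def)
qed

section \<open>Energy identities\<close>

text \<open>Only the equation and the norm of a single polynomial are kept, because these carry over
  to p(-x) with \<alpha> and \<beta> exchanged.\<close>

locale jacobi_eigenpoly =
  fixes \<alpha> \<beta> :: real and n :: nat and p :: "real poly"
  assumes alpha_ge: "\<alpha> \<ge> -1/2" and beta_ge: "\<beta> \<ge> -1/2"
    and eigen: "jacobi_op \<alpha> \<beta> p = smult (- (n * (n + \<alpha> + \<beta> + 1))) p"
    and normalized: "jacobi_inner \<alpha> \<beta> p p = 1"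
begin

lemma alpha_gt: "\<alpha> > -1" and beta_gt: "\<beta> > -1"
  using alpha_ge beta_ge by auto

text \<open>Completing the square turns the potential into N^2 (r^2 - (x - m)^2), so m - r and m + r
  are the turning points.\<close>

definition \<nu> where "\<nu> = (n + (\<alpha> + \<beta> + 1) / 2)\<^sup>2 - 1 / 4"
definition N where "N = sqrt \<nu>"
definition m where "m = (\<beta>\<^sup>2 - \<alpha>\<^sup>2) / (4 * \<nu>)"
definition r where "r = sqrt (1 - (\<alpha>\<^sup>2 + \<beta>\<^sup>2) / (2 * \<nu>) + m\<^sup>2)"
definition s where "s = max 1 (\<alpha> + \<beta> + 1)"

text \<open>With \<open>v\<close> and \<open>t\<close> as above, \<open>v'' = - D(x) v\<close>, and \<open>v'\<close> is \<open>v\<close> with \<open>K\<close> in place of \<open>p\<close>.\<close>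

definition D where "D x = \<nu> * (1 - x\<^sup>2) - (\<alpha>\<^sup>2 + \<beta>\<^sup>2) / 2 + (\<beta>\<^sup>2 - \<alpha>\<^sup>2) * x / 2"
definition K where "K = [:1, 0, -1:] * pderiv p + smult (1/2) ([:\<beta> - \<alpha>, - (\<alpha> + \<beta>):] * p)"
text \<open>The energy v'^2 + D v^2 equals (1 - x^2) w H (see \<open>energy_eq\<close>). With the
  factor 1 - x^2 taken out, H can be inserted into \<open>jacobi_div\<close>.\<close>

definition H where "H = [:1, 0, -1:] * (pderiv p)\<^sup>2 + [:\<beta> - \<alpha>, - (\<alpha> + \<beta>):] * p * pderiv p
  + smult (\<nu> - (\<alpha> + \<beta>)\<^sup>2 / 4) (p\<^sup>2)"

lemma poly_K: "poly K x = (1 - x\<^sup>2) * poly (pderiv p) x + (\<beta> - \<alpha> - (\<alpha> + \<beta>) * x) / 2 * poly p x"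
  by (simp add: K_def power2_eq_square field_simps)

lemma eigen_poly:
  "(1 - x\<^sup>2) * poly (pderiv (pderiv p)) x + (\<beta> - \<alpha> - (\<alpha> + \<beta> + 2) * x) * poly (pderiv p) x
     = - (n * (n + \<alpha> + \<beta> + 1)) * poly p x"
  using arg_cong[OF eigen, of "\<lambda>q. poly q x"] by (simp add: jacobi_op_def poly_jacobi_div)

lemma lambda_eq: "n * (n + \<alpha> + \<beta> + 1) = \<nu> + 1 / 4 - (\<alpha> + \<beta> + 1)\<^sup>2 / 4"
  by (simp add: \<nu>_def power2_eq_square field_simps)

text \<open>This is v'' = - D v on the level of polynomials: the left-hand side is what d/dt makes
  of K, see \<open>deriv_\<rho>_poly\<close>.\<close>

lemma poly_pderiv_K:
  "(1 - x\<^sup>2) * poly (pderiv K) x + (\<beta> - \<alpha> - (\<alpha> + \<beta>) * x) / 2 * poly K x = - D x * poly p x"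
proof -
  define P0 where "P0 = poly p x"
  define P1 where "P1 = poly (pderiv p) x"
  define P2 where "P2 = poly (pderiv (pderiv p)) x"
  have ode: "(1 - x\<^sup>2) * P2 = - (\<nu> + 1 / 4 - (\<alpha> + \<beta> + 1)\<^sup>2 / 4) * P0 - (\<beta> - \<alpha> - (\<alpha> + \<beta> + 2) * x) * P1"
    using eigen_poly[of x] unfolding lambda_eq P0_def P1_def P2_def by simp
  have K': "poly (pderiv K) x = (1 - x\<^sup>2) * P2 - 2 * x * P1 + (\<beta> - \<alpha> - (\<alpha> + \<beta>) * x) / 2 * P1 - (\<alpha> + \<beta>) / 2 * P0"
    by (simp add: K_def P0_def P1_def P2_def pderiv_mult pderiv_add pderiv_smult pderiv_pCons pderiv_minus power2_eq_square field_simps)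
  show ?thesis
    unfolding K' poly_K ode D_def P0_def[symmetric] P1_def[symmetric]
    by (simp add: power2_eq_square field_simps)
qed

lemma energy_eq: "(1 - x\<^sup>2) * poly H x = (poly K x)\<^sup>2 + D x * (poly p x)\<^sup>2"
  unfolding poly_K D_def H_def by (simp add: power2_eq_square field_simps)

text \<open>Energy balance: the x-derivative of v'^2 + D v^2 is D'(x) v^2, since only the explicit
  dependence of D on x contributes.\<close>

lemma jacobi_div_H: "poly (jacobi_div \<alpha> \<beta> H) x = - (2 * \<nu> * x - (\<beta>\<^sup>2 - \<alpha>\<^sup>2) / 2) * (poly p x)\<^sup>2"
proof -
  define P0 where "P0 = poly p x"
  define P1 where "P1 = poly (pderiv p) x"
  define P2 where "P2 = poly (pderiv (pderiv p)) x"
  have ode: "(1 - x\<^sup>2) * P2 = - (\<nu> + 1 / 4 - (\<alpha> + \<beta> + 1)\<^sup>2 / 4) * P0 - (\<beta> - \<alpha> - (\<alpha> + \<beta> + 2) * x) * P1"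
    using eigen_poly[of x] unfolding lambda_eq P0_def P1_def P2_def by simp
  have H': "(1 - x\<^sup>2) * poly (pderiv H) x = (1 - x\<^sup>2) * (- 2 * x * P1\<^sup>2 - (\<alpha> + \<beta>) * P0 * P1
       + (\<beta> - \<alpha> - (\<alpha> + \<beta>) * x) * P1\<^sup>2 + 2 * (\<nu> - (\<alpha> + \<beta>)\<^sup>2 / 4) * P0 * P1)
       + ((1 - x\<^sup>2) * P2) * (2 * (1 - x\<^sup>2) * P1 + (\<beta> - \<alpha> - (\<alpha> + \<beta>) * x) * P0)"
    by (simp add: H_def P0_def P1_def P2_def power2_eq_square pderiv_mult pderiv_add pderiv_smult pderiv_pCons pderiv_minus field_simps)
  have H0: "poly H x = (1 - x\<^sup>2) * P1\<^sup>2 + (\<beta> - \<alpha> - (\<alpha> + \<beta>) * x) * P0 * P1 + (\<nu> - (\<alpha> + \<beta>)\<^sup>2 / 4) * P0\<^sup>2"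
    by (simp add: H_def P0_def P1_def power2_eq_square field_simps)
  show ?thesis
    unfolding poly_jacobi_div H' H0 ode P0_def[symmetric]
    by (simp add: power2_eq_square field_simps)
qed

text \<open>Virial identity: the x-derivative of (1 - x^2) v v', where v v' has t-derivative v'^2 -
  D v^2.\<close>

lemma jacobi_div_pK:
  "poly (jacobi_div \<alpha> \<beta> (p * K)) x = (poly K x)\<^sup>2 - 2 * x * poly p x * poly K x - D x * (poly p x)\<^sup>2"
proof -
  have "poly (jacobi_div \<alpha> \<beta> (p * K)) x =
     poly K x * ((1 - x\<^sup>2) * poly (pderiv p) x + (\<beta> - \<alpha> - (\<alpha> + \<beta>) * x) / 2 * poly p x)
     + poly p x * ((1 - x\<^sup>2) * poly (pderiv K) x + (\<beta> - \<alpha> - (\<alpha> + \<beta>) * x) / 2 * poly K x)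
     - 2 * x * poly p x * poly K x"
    by (simp add: poly_jacobi_div pderiv_mult field_simps)
  then show ?thesis unfolding poly_pderiv_K poly_K[symmetric]
    by (simp add: power2_eq_square field_simps)
qed

lemma jacobi_div_pp':
  "poly (jacobi_div \<alpha> \<beta> (p * pderiv p)) x =
     (1 - x\<^sup>2) * (poly (pderiv p) x)\<^sup>2 - n * (n + \<alpha> + \<beta> + 1) * (poly p x)\<^sup>2"
proof -
  have "poly (jacobi_div \<alpha> \<beta> (p * pderiv p)) x = (1 - x\<^sup>2) * (poly (pderiv p) x)\<^sup>2 + poly p x *
    ((1 - x\<^sup>2) * poly (pderiv (pderiv p)) x + (\<beta> - \<alpha> - (\<alpha> + \<beta> + 2) * x) * poly (pderiv p) x)"
    by (simp add: poly_jacobi_div pderiv_mult power2_eq_square field_simps)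
  then show ?thesis unfolding eigen_poly by (simp add: power2_eq_square field_simps)
qed

lemma norm_has_integral: "((\<lambda>x. (poly p x)\<^sup>2 * jacobi_weight \<alpha> \<beta> x) has_integral 1) {-1..1}"
  using jacobi_inner_has_integral[OF alpha_gt beta_gt, of p p] normalized
  by (simp add: power2_eq_square)

lemma poly_sq_weight_integrable:
  "(\<lambda>x. poly q x * (poly p x)\<^sup>2 * jacobi_weight \<alpha> \<beta> x) integrable_on {-1..1}"
  using jacobi_inner_has_integral[OF alpha_gt beta_gt, of "q * p" p]
  by (auto simp: integrable_on_def power2_eq_square mult.assoc)

lemma jacobi_weight_nonneg: "jacobi_weight \<alpha> \<beta> x \<ge> 0"
  by (simp add: jacobi_weight_def)

lemma deriv_has_integral:
  "((\<lambda>x. (1 - x\<^sup>2) * (poly (pderiv p) x)\<^sup>2 * jacobi_weight \<alpha> \<beta> x) has_integral n * (n + \<alpha> + \<beta> + 1)) {-1..1}"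
proof -
  have "((\<lambda>x. poly (jacobi_div \<alpha> \<beta> (p * pderiv p)) x * jacobi_weight \<alpha> \<beta> x) has_integral 0) {-1..1}"
    using jacobi_div_has_integral[OF alpha_gt beta_gt, of "-1" "p * pderiv p"] by simp
  from has_integral_add[OF this has_integral_mult_right[OF norm_has_integral, of "n * (n + \<alpha> + \<beta> + 1)"]]
  show ?thesis by (simp add: jacobi_div_pp' algebra_simps)
qed

end

section \<open>Large degree: turning-point parameters and the energy at the centre\<close>

locale jacobi_eigenpoly_large = jacobi_eigenpoly +
  assumes n_ge: "n \<ge> 7"
begin

lemma s_ge: "s \<ge> 1" "\<alpha> + \<beta> + 1 \<le> s" "s > 0"
  by (auto simp: s_def)

lemma abs_le: "\<bar>\<alpha>\<bar> + \<bar>\<beta>\<bar> \<le> 2 * s"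
  using alpha_ge beta_ge s_ge by linarith

lemma N_ge_aux: "N \<ge> n + (\<alpha> + \<beta>) / 2"
proof -
  have "(n + (\<alpha> + \<beta>) / 2)\<^sup>2 \<le> \<nu>"
    using n_ge alpha_ge beta_ge by (simp add: \<nu>_def power2_eq_square field_simps)
  then show ?thesis unfolding N_def by (rule real_le_rsqrt)
qed

lemma N_ge: "N \<ge> 6"
  using N_ge_aux n_ge alpha_ge beta_ge by (simp add: field_simps)

lemma \<nu>_eq: "\<nu> = N\<^sup>2"
  using N_ge unfolding N_def by (smt (verit) real_sqrt_le_0_iff real_sqrt_pow2)

lemma N2_m: "N\<^sup>2 * m = (\<beta>\<^sup>2 - \<alpha>\<^sup>2) / 4"
  using N_ge by (simp add: m_def \<nu>_eq)

text \<open>Each negative exponent costs at most 1/2 here, which turns n >= 7 into 6.\<close>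

lemma gap: "N - (\<bar>\<alpha>\<bar> + \<bar>\<beta>\<bar>) / 2 \<ge> 6"
  using N_ge_aux n_ge alpha_ge beta_ge by (simp add: field_simps abs_if)

text \<open>With a, b = (|\<alpha>| +- |\<beta>|) / (2 N) one has m = - a b and r^2 = (1 - a^2) (1 -
  b^2). Then \<open>gap\<close> becomes N (1 - a) >= 6, and r <= 1 - |m| expresses that \<alpha>^2
  and \<beta>^2, the values of - D at the ends, are nonnegative.\<close>

lemma r_parameters:
  shows r2: "r\<^sup>2 = 1 - (\<alpha>\<^sup>2 + \<beta>\<^sup>2) / (2 * N\<^sup>2) + m\<^sup>2"
    and r_pos: "r > 0" and r_le: "r \<le> 1 - \<bar>m\<bar>" and Nr: "N * r \<ge> 6"
    and m2_le: "1 - m\<^sup>2 \<le> 4 * s * r\<^sup>2"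
    and N_cases: "N \<le> 2 * s \<or> r \<ge> 1 / 2"
    and edge: "N\<^sup>2 * ((1 - m)\<^sup>2 - r\<^sup>2) = \<alpha>\<^sup>2"
proof -
  define a where "a = (\<bar>\<alpha>\<bar> + \<bar>\<beta>\<bar>) / (2 * N)"
  define b where "b = (\<bar>\<alpha>\<bar> - \<bar>\<beta>\<bar>) / (2 * N)"
  have N0: "N > 0" using N_ge by simp
  have a0: "a \<ge> 0" using N0 by (simp add: a_def)
  have "N * a = (\<bar>\<alpha>\<bar> + \<bar>\<beta>\<bar>) / 2" using N0 by (simp add: a_def)
  then have "N * a \<le> N - 6" using gap by linarith
  then have Na: "N * (1 - a) \<ge> 6" by (simp add: algebra_simps)
  then have a1: "a < 1" using N0 by (smt (verit) mult_nonneg_nonpos)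
  have ba: "\<bar>b\<bar> \<le> a" using N0 by (auto simp: a_def b_def divide_right_mono)
  have "m = - (a * b)" using N0 by (simp add: m_def \<nu>_eq a_def b_def power2_eq_square field_simps)
  then have m2: "m\<^sup>2 = a\<^sup>2 * b\<^sup>2" by (simp add: power_mult_distrib)
  have ab: "(\<alpha>\<^sup>2 + \<beta>\<^sup>2) / (2 * N\<^sup>2) = a\<^sup>2 + b\<^sup>2"
    using N0 by (simp add: a_def b_def power2_eq_square field_simps)
  have a2: "a\<^sup>2 < 1" using a0 a1 by (simp add: abs_square_less_1)
  have b2: "b\<^sup>2 \<le> a\<^sup>2" using ba a0 by (simp add: abs_le_square_iff[symmetric])
  have r2': "1 - (\<alpha>\<^sup>2 + \<beta>\<^sup>2) / (2 * N\<^sup>2) + m\<^sup>2 = (1 - a\<^sup>2) * (1 - b\<^sup>2)"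
    unfolding ab m2 by (simp add: algebra_simps)
  have pos: "(1 - a\<^sup>2) * (1 - b\<^sup>2) > 0" using a2 b2 by simp
  show r2: "r\<^sup>2 = 1 - (\<alpha>\<^sup>2 + \<beta>\<^sup>2) / (2 * N\<^sup>2) + m\<^sup>2"
    using pos unfolding r_def \<nu>_eq r2' by simp
  show r0: "r > 0" using pos unfolding r_def \<nu>_eq r2' by simp
  have rr: "r\<^sup>2 = (1 - a\<^sup>2) * (1 - b\<^sup>2)" using r2 r2' by simp
  have bb: "\<beta>\<^sup>2 = \<alpha>\<^sup>2 + 4 * N\<^sup>2 * m" using N2_m by simp
  show edge: "N\<^sup>2 * ((1 - m)\<^sup>2 - r\<^sup>2) = \<alpha>\<^sup>2"
    using N0 unfolding r2 bb by (simp add: power2_eq_square field_simps)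
  have "N\<^sup>2 * ((1 + m)\<^sup>2 - r\<^sup>2) = \<beta>\<^sup>2"
    using N0 unfolding r2 bb by (simp add: power2_eq_square field_simps)
  with edge N0 have sq: "r\<^sup>2 \<le> (1 - m)\<^sup>2" "r\<^sup>2 \<le> (1 + m)\<^sup>2"
    by (smt (verit) zero_le_power2 zero_less_power2 mult_pos_neg)+
  have "\<bar>m\<bar> < 1"
  proof -
    have "a\<^sup>2 * b\<^sup>2 < 1" using a2 b2 by (smt (verit) mult_left_le zero_le_power2)
    then show ?thesis using m2 abs_square_less_1 by metis
  qed
  then have "r \<le> 1 - m" "r \<le> 1 + m"
    using power2_le_imp_le[OF sq(1)] power2_le_imp_le[OF sq(2)] by auto
  then show rm: "r \<le> 1 - \<bar>m\<bar>" by (simp add: abs_if)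
  have r_a: "r \<ge> 1 - a\<^sup>2"
  proof (rule power2_le_imp_le)
    show "(1 - a\<^sup>2)\<^sup>2 \<le> r\<^sup>2" unfolding rr using a2 b2 by (simp add: power2_eq_square mult_left_mono)
  qed (use r0 in simp)
  moreover have "1 - a\<^sup>2 \<ge> 1 - a" using a0 a1 by (simp add: power2_eq_square mult_left_le)
  ultimately show "N * r \<ge> 6" using Na N0 by (smt (verit) mult_left_mono)
  \<comment> \<open>For Y = N a <= s: N^2 / (N^2 - Y^2) = 1 + Y^2 / (N^2 - Y^2), and Y^2 <= s (N +
    Y) <= s (N - Y) (N + Y) because N - Y >= 6.\<close>
  have inv: "1 / (1 - a\<^sup>2) \<le> 2 * s"
  proof -
    define Y where "Y = N * a"
    have Y: "0 \<le> Y" "Y \<le> s" using a0 N0 abs_le by (auto simp: Y_def a_def)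
    have NY: "N - Y \<ge> 6" using Na by (simp add: Y_def algebra_simps)
    have "N\<^sup>2 \<le> 2 * s * (N\<^sup>2 - Y\<^sup>2)"
    proof -
      have "Y\<^sup>2 \<le> s * Y" using Y by (simp add: power2_eq_square mult_right_mono)
      also have "\<dots> \<le> s * (N + Y)" using s_ge N0 by simp
      also have "\<dots> \<le> s * ((N - Y) * (N + Y))"
        using NY Y N0 s_ge by (intro mult_left_mono) auto
      also have "\<dots> = s * (N\<^sup>2 - Y\<^sup>2)" by (simp add: power2_eq_square algebra_simps)
      finally have 1: "Y\<^sup>2 \<le> s * (N\<^sup>2 - Y\<^sup>2)" .
      have "N\<^sup>2 - Y\<^sup>2 \<ge> 0" using NY Y by (simp add: power2_le_iff_abs_le)
      then have "N\<^sup>2 - Y\<^sup>2 \<le> s * (N\<^sup>2 - Y\<^sup>2)" using s_ge by (simp add: mult_le_cancel_right1)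
      with 1 show ?thesis by linarith
    qed
    moreover have "N\<^sup>2 - Y\<^sup>2 = N\<^sup>2 * (1 - a\<^sup>2)" by (simp add: Y_def power_mult_distrib algebra_simps)
    ultimately have "N\<^sup>2 * 1 \<le> N\<^sup>2 * (2 * s * (1 - a\<^sup>2))" by (simp add: algebra_simps)
    then have "1 \<le> 2 * s * (1 - a\<^sup>2)" using N0 by (simp only: mult_le_cancel_left) simp
    then show ?thesis using a2 by (simp add: field_simps)
  qed
  show "1 - m\<^sup>2 \<le> 4 * s * r\<^sup>2"
  proof -
    have "1 \<le> 2 * s * (1 - a\<^sup>2)" using inv a2 by (simp add: field_simps)
    then have "2 * (1 - b\<^sup>2) \<le> 2 * (1 - b\<^sup>2) * (2 * s * (1 - a\<^sup>2))" 
      using a2 b2 by (smt (verit) mult_left_le mult_le_cancel_left1)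
    moreover have "1 - m\<^sup>2 \<le> 2 * (1 - b\<^sup>2)"
    proof -
      have "0 \<le> (1 - a\<^sup>2) * (1 - b\<^sup>2)" using pos by simp
      then show ?thesis unfolding m2 using b2 by (simp add: algebra_simps)
    qed
    ultimately show ?thesis unfolding rr by (simp add: algebra_simps)
  qed
  show "N \<le> 2 * s \<or> r \<ge> 1 / 2"
  proof (cases "N \<le> 2 * s")
    case False
    then have "N * a \<le> N * (1 / 2)" using abs_le N0 by (simp add: a_def)
    then have "a \<le> 1 / 2" using N0 by (simp only: mult_le_cancel_left_pos)
    then have "a\<^sup>2 \<le> (1 / 2)\<^sup>2" using a0 by (intro power_mono) auto
    then show ?thesis using r_a by (simp add: power2_eq_square)
  qed simp
qed

lemma D_eq: "D x = N\<^sup>2 * (r\<^sup>2 - (x - m)\<^sup>2)"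
proof -
  have "\<beta>\<^sup>2 = \<alpha>\<^sup>2 + 4 * N\<^sup>2 * m" using N2_m by simp
  then show ?thesis using N_ge unfolding D_def r2 \<nu>_eq by (simp add: power2_eq_square field_simps)
qed

text \<open>The virial expression integrates to 0. Completing the square in K gives K^2 - 2 x p K >=
  - p^2 on [-1, 1], so the mean of D under p^2 w is at least -1.\<close>

lemma variance_le:
  "integral {-1..1} (\<lambda>x. (x - m)\<^sup>2 * (poly p x)\<^sup>2 * jacobi_weight \<alpha> \<beta> x) \<le> r\<^sup>2 + 1 / N\<^sup>2"
proof -
  let ?w = "jacobi_weight \<alpha> \<beta>"
  let ?I = "integral {-1..1} (\<lambda>x. (x - m)\<^sup>2 * (poly p x)\<^sup>2 * ?w x)"
  have i: "((\<lambda>x. (x - m)\<^sup>2 * (poly p x)\<^sup>2 * ?w x) has_integral ?I) {-1..1}"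
    using poly_sq_weight_integrable[of "[:-m, 1:]\<^sup>2"]
    by (simp add: has_integral_integral[symmetric] algebra_simps power2_eq_square)
  have "((\<lambda>x. N\<^sup>2 * ((x - m)\<^sup>2 * (poly p x)\<^sup>2 * ?w x) - (N\<^sup>2 * r\<^sup>2 + 1) * ((poly p x)\<^sup>2 * ?w x))
      has_integral N\<^sup>2 * ?I - (N\<^sup>2 * r\<^sup>2 + 1) * 1) {-1..1}"
    by (intro has_integral_diff has_integral_mult_right i norm_has_integral)
  moreover have "((\<lambda>x. poly (jacobi_div \<alpha> \<beta> (p * K)) x * ?w x) has_integral 0) {-1..1}"
    using jacobi_div_has_integral[OF alpha_gt beta_gt, of "-1" "p * K"] by simp
  moreover have "N\<^sup>2 * ((x - m)\<^sup>2 * (poly p x)\<^sup>2 * ?w x) - (N\<^sup>2 * r\<^sup>2 + 1) * ((poly p x)\<^sup>2 * ?w x)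
      \<le> poly (jacobi_div \<alpha> \<beta> (p * K)) x * ?w x" if "x \<in> {-1..1}" for x
  proof -
    have "x\<^sup>2 \<le> 1" using that by (auto simp: abs_square_le_1)
    then have "(poly K x)\<^sup>2 - 2 * x * poly p x * poly K x \<ge> - (poly p x)\<^sup>2"
      using zero_le_power2[of "poly K x - x * poly p x"] mult_right_mono[of "x\<^sup>2" 1 "(poly p x)\<^sup>2"]
      by (simp add: power2_eq_square algebra_simps)
    then have "(N\<^sup>2 * (x - m)\<^sup>2 - (N\<^sup>2 * r\<^sup>2 + 1)) * (poly p x)\<^sup>2 \<le> poly (jacobi_div \<alpha> \<beta> (p * K)) x"
      unfolding jacobi_div_pK D_eq by (simp add: algebra_simps)
    from mult_right_mono[OF this jacobi_weight_nonneg[of x]] show ?thesis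
      by (simp add: algebra_simps)
  qed
  ultimately have "N\<^sup>2 * ?I - (N\<^sup>2 * r\<^sup>2 + 1) * 1 \<le> 0" by (rule has_integral_le)
  then show ?thesis using N_ge by (simp add: field_simps)
qed

text \<open>By energy balance the energy at m is the integral of 2 N^2 (x - m) p^2 w over [m, 1].
  The bound 2 (x - m) <= (x - m)^2 / r + r reduces it to the variance and yields 2 N^2 r + 1 / r,
  whose second term is absorbed since N r >= 1.\<close>

lemma energy_at_m: "((poly K m)\<^sup>2 + (N * r)\<^sup>2 * (poly p m)\<^sup>2) * jacobi_weight \<alpha> \<beta> m \<le> 4 * N\<^sup>2 * r"
proof -
  let ?w = "jacobi_weight \<alpha> \<beta>"
  have m1: "-1 \<le> m" "m \<le> 1" using r_pos r_le by auto
  have "((\<lambda>x. poly (jacobi_div \<alpha> \<beta> H) x * ?w x) has_integral - ((1 - m\<^sup>2) * ?w m * poly H m)) {m..1}"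
    using jacobi_div_has_integral[OF alpha_gt beta_gt m1] .
  moreover have "2 * N\<^sup>2 * x - (\<beta>\<^sup>2 - \<alpha>\<^sup>2) / 2 = 2 * N\<^sup>2 * (x - m)" for x
    using N2_m by (simp add: algebra_simps)
  ultimately have "((\<lambda>x. - (2 * N\<^sup>2 * (x - m)) * (poly p x)\<^sup>2 * ?w x)
      has_integral - ((1 - m\<^sup>2) * ?w m * poly H m)) {m..1}"
    by (simp only: jacobi_div_H \<nu>_eq)
  from has_integral_neg[OF this]
  have i: "((\<lambda>x. 2 * N\<^sup>2 * (x - m) * (poly p x)\<^sup>2 * ?w x)
      has_integral (1 - m\<^sup>2) * poly H m * ?w m) {m..1}"
    by (simp add: mult_ac)
  let ?f = "\<lambda>x. N\<^sup>2 * ((1 / r) * ((x - m)\<^sup>2 * (poly p x)\<^sup>2 * ?w x) + r * ((poly p x)\<^sup>2 * ?w x))"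
  let ?I = "integral {-1..1} (\<lambda>x. (x - m)\<^sup>2 * (poly p x)\<^sup>2 * ?w x)"
  have "((\<lambda>x. (x - m)\<^sup>2 * (poly p x)\<^sup>2 * ?w x) has_integral ?I) {-1..1}"
    using poly_sq_weight_integrable[of "[:-m, 1:]\<^sup>2"]
    by (simp add: has_integral_integral[symmetric] algebra_simps power2_eq_square)
  then have f: "(?f has_integral N\<^sup>2 * ((1 / r) * ?I + r * 1)) {-1..1}"
    by (intro has_integral_mult_right has_integral_add norm_has_integral)
  have f0: "?f x \<ge> 0" for x using r_pos jacobi_weight_nonneg[of x] by simp
  have fi: "?f integrable_on {m..1}"
    by (rule integrable_on_subinterval[OF has_integral_integrable[OF f]]) (use m1 in auto)
  have "(1 - m\<^sup>2) * poly H m * ?w m \<le> integral {m..1} ?f"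
  proof (rule has_integral_le[OF i integrable_integral[OF fi]])
    fix x
    have "2 * (x - m) \<le> 1 / r * (x - m)\<^sup>2 + r"
      using zero_le_power2[of "x - m - r"] r_pos by (simp add: field_simps power2_eq_square)
    from mult_right_mono[OF this, of "N\<^sup>2 * (poly p x)\<^sup>2 * ?w x"] jacobi_weight_nonneg[of x]
    show "2 * N\<^sup>2 * (x - m) * (poly p x)\<^sup>2 * ?w x \<le> ?f x" by (simp add: algebra_simps)
  qed
  also have "\<dots> \<le> integral {-1..1} ?f"
    by (rule integral_subset_le[OF _ fi has_integral_integrable[OF f]]) (use m1 f0 in auto)
  also have "\<dots> = N\<^sup>2 * ((1 / r) * ?I + r * 1)" using f by (rule integral_unique)
  also have "\<dots> \<le> N\<^sup>2 * ((1 / r) * (r\<^sup>2 + 1 / N\<^sup>2) + r * 1)"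
    using variance_le r_pos by (intro mult_left_mono add_right_mono) auto
  also have "\<dots> = 2 * N\<^sup>2 * r + 1 / r"
    using r_pos N_ge by (simp add: field_simps power2_eq_square)
  also have "1 / r \<le> 2 * N\<^sup>2 * r"
  proof -
    have "1\<^sup>2 \<le> (N * r)\<^sup>2" using Nr by (intro power_mono) auto
    then show ?thesis using r_pos by (simp add: field_simps power2_eq_square)
  qed
  finally show ?thesis unfolding energy_eq D_eq by (simp add: algebra_simps power_mult_distrib)
qed

end

section \<open>Adiabatic invariants and Sonin functions\<close>

lemma nonincreasing_on:
  fixes f f' :: "real \<Rightarrow> real"
  assumes "a \<le> b" "\<And>t. a \<le> t \<Longrightarrow> t \<le> b \<Longrightarrow> (f has_real_derivative f' t) (at t)"
    "\<And>t. a \<le> t \<Longrightarrow> t \<le> b \<Longrightarrow> f' t \<le> 0"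
  shows "f b \<le> f a"
  by (rule DERIV_nonpos_imp_nonincreasing[OF assms(1)]) (use assms in blast)

lemma gronwall:
  fixes f f' :: "real \<Rightarrow> real"
  assumes "a \<le> b" "\<And>t. a \<le> t \<Longrightarrow> t \<le> b \<Longrightarrow> (f has_real_derivative f' t) (at t)"
    "\<And>t. a \<le> t \<Longrightarrow> t \<le> b \<Longrightarrow> f' t \<le> c * f t"
  shows "f b \<le> f a * exp (c * (b - a))"
proof -
  have "f b * exp (- c * b) \<le> f a * exp (- c * a)"
  proof (rule nonincreasing_on[OF assms(1)])
    fix t assume t: "a \<le> t" "t \<le> b"
    show "((\<lambda>t. f t * exp (- c * t)) has_real_derivative (f' t - c * f t) * exp (- c * t)) (at t)"
      using assms(2)[OF t] by (auto intro!: derivative_eq_intros simp: algebra_simps)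
    show "(f' t - c * f t) * exp (- c * t) \<le> 0"
      using assms(3)[OF t] by (simp add: mult_nonpos_nonneg)
  qed
  then have "f b * exp (- c * b) * exp (c * b) \<le> f a * exp (- c * a) * exp (c * b)"
    by (rule mult_right_mono) simp
  then show ?thesis by (simp add: mult.assoc exp_add[symmetric] algebra_simps)
qed

text \<open>Once \<open>E\<close> is positive, \<open>f\<close> would increase from there on, which is incompatible with its decay.\<close>

lemma decay_nonincreasing:
  fixes f \<kappa> E :: "real \<Rightarrow> real"
  assumes f: "\<And>t. T \<le> t \<Longrightarrow> (f has_real_derivative \<kappa> t * E t) (at t)"
    and \<kappa>: "\<And>t. T \<le> t \<Longrightarrow> \<kappa> t > 0"
    and E: "\<And>t. T \<le> t \<Longrightarrow> (E has_real_derivative E' t) (at t)" "\<And>t. T \<le> t \<Longrightarrow> E' t \<ge> 0"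
    and f0: "\<And>t. T \<le> t \<Longrightarrow> f t \<ge> 0" and lim: "(f \<longlongrightarrow> 0) at_top"
    and ab: "T \<le> a" "a \<le> b"
  shows "f b \<le> f a"
proof -
  have mono: "E t \<le> E u" if "T \<le> t" "t \<le> u" for t u
    by (rule DERIV_nonneg_imp_nondecreasing[OF that(2)]) (use E that in \<open>meson order_trans\<close>)
  have "E t \<le> 0" if t: "T \<le> t" for t
  proof (rule ccontr)
    assume "\<not> E t \<le> 0"
    then have pos: "E u > 0" if "t \<le> u" for u using mono[OF t that] by simp
    have inc: "f u \<le> f u'" if "t \<le> u" "u \<le> u'" for u u'
      by (rule DERIV_nonneg_imp_nondecreasing[OF that(2)])
        (use f \<kappa> pos that t in \<open>metis less_eq_real_def mult_pos_pos order_trans\<close>)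
    \<comment> \<open>\<open>f t\<close> itself may be 0; one strict step supplies a positive value
      that later values cannot fall below.\<close>
    have "f t < f (t + 1)"
      by (rule DERIV_pos_imp_increasing) (use f \<kappa> pos t in \<open>simp, metis mult_pos_pos order_trans\<close>)
    then have "f (t + 1) > 0" using f0[OF t] by simp
    with lim have "eventually (\<lambda>u. f u < f (t + 1)) at_top" by (simp add: order_tendstoD)
    then obtain u where "u \<ge> t + 1" "f u < f (t + 1)"
      unfolding eventually_at_top_linorder by (meson linear order_trans order_refl)
    with inc[of "t + 1" u] show False by simp
  qed
  then show ?thesis
    by (intro nonincreasing_on[OF ab(2) f]) (use ab \<kappa> in \<open>simp_all add: mult_nonneg_nonpos less_imp_le\<close>)
qed

text \<open>WKB approximation without special functions: while \<open>g = D' / (2 D\<^sup>3\<^sup>/\<^sup>2)\<close> is monotone and at most \<open>1\<close> in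
  modulus, the corrected adiabatic invariant \<open>\<surd>D v\<^sup>2 + v'\<^sup>2 / \<surd>D + g v v'\<close> has derivative \<open>g' v v'\<close> and
  so it changes by a bounded factor only.\<close>

lemma adiabatic_invariant_le:
  fixes v w D D1 D2 :: "real \<Rightarrow> real"
  assumes ab: "a \<le> b"
    and v: "\<And>t. (v has_real_derivative w t) (at t)"
    and w: "\<And>t. (w has_real_derivative - D t * v t) (at t)"
    and D: "\<And>t. (D has_real_derivative D1 t) (at t)"
    and D1: "\<And>t. (D1 has_real_derivative D2 t) (at t)"
    and pos: "\<And>t. a \<le> t \<Longrightarrow> t \<le> b \<Longrightarrow> D t > 0"
    and small: "\<And>t. a \<le> t \<Longrightarrow> t \<le> b \<Longrightarrow> (D1 t)\<^sup>2 \<le> 4 * (D t) ^ 3"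
    and mono: "\<And>t. a \<le> t \<Longrightarrow> t \<le> b \<Longrightarrow> 2 * D t * D2 t \<le> 3 * (D1 t)\<^sup>2"
    and init: "D1 a = 0"
  shows "sqrt (D b) * (v b)\<^sup>2 + (w b)\<^sup>2 / sqrt (D b) \<le> 6 * (sqrt (D a) * (v a)\<^sup>2 + (w a)\<^sup>2 / sqrt (D a))"
proof -
  define S where "S t = sqrt (D t)" for t
  define g where "g t = D1 t / (2 * S t ^ 3)" for t
  define g' where "g' t = D2 t / (2 * S t ^ 3) - 3 * (D1 t)\<^sup>2 / (4 * S t ^ 5)" for t
  define W where "W t = S t * (v t)\<^sup>2 + (w t)\<^sup>2 / S t" for t
  \<comment> \<open>The derivative g' v v' has no sign. The factor exp g turns it into g' (W + (1 +
    g) v v'), whose bracket is nonnegative because |1 + g| <= 2 and 2 |v v'| <= W.\<close>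
  define F where "F t = (W t + g t * v t * w t) * exp (g t)" for t
  have S: "S t > 0" "D t = (S t)\<^sup>2" if "a \<le> t" "t \<le> b" for t
    using pos[OF that] by (auto simp: S_def)
  have vw: "2 * \<bar>v t * w t\<bar> \<le> W t" if "a \<le> t" "t \<le> b" for t
  proof -
    have "0 \<le> (S t * \<bar>v t\<bar> - \<bar>w t\<bar>)\<^sup>2 / S t" using S(1)[OF that] by simp
    also have "\<dots> = W t - 2 * \<bar>v t * w t\<bar>"
      using S(1)[OF that] by (simp add: W_def power2_eq_square abs_mult field_simps)
    finally show ?thesis by simp
  qed
  have g1: "\<bar>g t\<bar> \<le> 1" if "a \<le> t" "t \<le> b" for t
  proof -
    have "\<bar>D1 t\<bar>\<^sup>2 \<le> (2 * S t ^ 3)\<^sup>2"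
      using small[OF that] unfolding S(2)[OF that] by (simp add: power_mult_distrib power_mult[symmetric])
    then have "\<bar>D1 t\<bar> \<le> 2 * S t ^ 3"
      by (rule power2_le_imp_le) (use S(1)[OF that] in simp)
    then show ?thesis using S(1)[OF that] by (simp add: g_def)
  qed
  have g'0: "g' t \<le> 0" if "a \<le> t" "t \<le> b" for t
  proof -
    have "g' t = (2 * D t * D2 t - 3 * (D1 t)\<^sup>2) / (4 * S t ^ 5)"
      using S(1)[OF that] unfolding S(2)[OF that] g'_def
      by (simp add: field_simps power2_eq_square eval_nat_numeral)
    with mono[OF that] S(1)[OF that] show ?thesis by (simp add: divide_nonpos_pos)
  qed
  have "F b \<le> F a"
  proof (rule nonincreasing_on[OF ab])
    fix t assume t: "a \<le> t" "t \<le> b"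
    note S0 = S(1)[OF t]
    have dS: "(S has_real_derivative D1 t / (2 * S t)) (at t)"
      unfolding S_def[abs_def] using pos[OF t] D[of t]
      by (auto intro!: derivative_eq_intros simp: field_simps)
    have dg: "(g has_real_derivative g' t) (at t)"
      unfolding g_def[abs_def] g'_def using S0
      by (auto intro!: derivative_eq_intros dS D1 simp: field_simps power2_eq_square eval_nat_numeral)
    have "((\<lambda>t. W t + g t * v t * w t) has_real_derivative
        D1 t / (2 * S t) * (v t)\<^sup>2 + S t * (2 * v t * w t) +
        (2 * w t * (- D t * v t) * S t - (w t)\<^sup>2 * (D1 t / (2 * S t))) / (S t)\<^sup>2
        + (g' t * v t * w t + g t * (w t * w t + v t * (- D t * v t)))) (at t)"
      unfolding W_def[abs_def] using S0
      by (auto intro!: derivative_eq_intros dS dg v w simp: power2_eq_square algebra_simps)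
    also have "D1 t / (2 * S t) * (v t)\<^sup>2 + S t * (2 * v t * w t) +
        (2 * w t * (- D t * v t) * S t - (w t)\<^sup>2 * (D1 t / (2 * S t))) / (S t)\<^sup>2
        + (g' t * v t * w t + g t * (w t * w t + v t * (- D t * v t))) = g' t * v t * w t"
      using S0 unfolding S(2)[OF t] g_def by (simp add: power2_eq_square eval_nat_numeral field_simps)
    finally have dW: "((\<lambda>t. W t + g t * v t * w t) has_real_derivative g' t * v t * w t) (at t)" .
    show "(F has_real_derivative g' t * (v t * w t + (W t + g t * v t * w t)) * exp (g t)) (at t)"
      unfolding F_def[abs_def] using DERIV_mult[OF dW DERIV_fun_exp[OF dg]]
      by (rule DERIV_cong) (simp add: algebra_simps)
    have "\<bar>(1 + g t) * (v t * w t)\<bar> \<le> 2 * \<bar>v t * w t\<bar>"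
      unfolding abs_mult[of "1 + g t"] using g1[OF t] by (intro mult_right_mono) auto
    then have "0 \<le> v t * w t + (W t + g t * v t * w t)"
      using vw[OF t] by (simp add: algebra_simps abs_le_iff)
    then show "g' t * (v t * w t + (W t + g t * v t * w t)) * exp (g t) \<le> 0"
      using g'0[OF t] by (simp add: mult_nonpos_nonneg)
  qed
  moreover have "F a = W a" using init by (simp add: F_def g_def)
  \<comment> \<open>6 = 2 * 3: the correction g v v' takes at most half of W, and exp g >= exp (-1)
    >= 1 / 3.\<close>
  moreover have "W b \<le> 6 * F b"
  proof -
    have b: "a \<le> b" "b \<le> b" using ab by auto
    have "\<bar>g b * (v b * w b)\<bar> \<le> 1 * \<bar>v b * w b\<bar>"
      unfolding abs_mult[of "g b"] using g1[OF b] by (intro mult_right_mono) auto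
    then have 1: "W b \<le> 2 * (W b + g b * v b * w b)" using vw[OF b] by (simp add: algebra_simps abs_le_iff)
    have "exp (g b) * 3 \<ge> exp (-1) * exp 1"
      using g1[OF b] exp_le by (intro mult_mono) auto
    then have e: "1 \<le> 3 * exp (g b)" by (simp add: exp_add[symmetric])
    have "0 \<le> W b" using vw[OF b] by linarith
    then have "0 \<le> 2 * (W b + g b * v b * w b)" using 1 by (rule order_trans)
    then have "0 \<le> W b + g b * v b * w b" by (simp only: zero_le_mult_iff) simp
    from mult_left_mono[OF e this] 1 show ?thesis by (simp add: F_def algebra_simps)
  qed
  ultimately have "W b \<le> 6 * W a" by simp
  then show ?thesis by (simp add: W_def S_def)
qed

text \<open>Sonin's function \<open>f\<^sup>2 + k\<^sup>2 / Q\<close>, with a factor \<open>R\<close> that absorbs the decreasing part of \<open>Q\<close>.\<close>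

lemma sonin_le:
  fixes f k Q Q1 R R1 c :: "real \<Rightarrow> real"
  assumes ab: "a \<le> b"
    and f: "\<And>t. (f has_real_derivative k t / c t) (at t)"
    and k: "\<And>t. (k has_real_derivative - (Q t / c t) * f t) (at t)"
    and Q: "\<And>t. (Q has_real_derivative Q1 t) (at t)"
    and R: "\<And>t. (R has_real_derivative R1 t) (at t)"
    and pos: "\<And>t. a \<le> t \<Longrightarrow> t \<le> b \<Longrightarrow> Q t > 0" "\<And>t. R t \<ge> 0"
    and R1: "\<And>t. R1 t \<le> 0" "\<And>t. R1 t \<le> Q1 t" "\<And>t. a \<le> t \<Longrightarrow> t \<le> b \<Longrightarrow> R1 t = 0 \<or> R t \<le> Q t"
  shows "((f b)\<^sup>2 + (k b)\<^sup>2 / Q b) * R b \<le> ((f a)\<^sup>2 + (k a)\<^sup>2 / Q a) * R a"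
proof (rule nonincreasing_on[OF ab])
  fix t assume t: "a \<le> t" "t \<le> b"
  note Q0 = pos(1)[OF t]
  have "((\<lambda>t. (f t)\<^sup>2 + (k t)\<^sup>2 / Q t) has_real_derivative
      2 * f t * (k t / c t) + (2 * k t * (- (Q t / c t) * f t) * Q t - (k t)\<^sup>2 * Q1 t) / (Q t)\<^sup>2) (at t)"
    using Q0 by (auto intro!: derivative_eq_intros f k Q simp: power2_eq_square mult_ac)
  also have "2 * f t * (k t / c t) + (2 * k t * (- (Q t / c t) * f t) * Q t - (k t)\<^sup>2 * Q1 t) / (Q t)\<^sup>2
     = - ((k t)\<^sup>2 * Q1 t / (Q t)\<^sup>2)"
  proof -
    have "(2 * k t * (- (Q t / c t) * f t) * Q t - (k t)\<^sup>2 * Q1 t) / (Q t)\<^sup>2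
        = (2 * k t * (- (Q t / c t) * f t)) / Q t - (k t)\<^sup>2 * Q1 t / (Q t)\<^sup>2"
      using Q0 by (simp add: power2_eq_square diff_divide_distrib)
    then show ?thesis using Q0 by simp
  qed
  finally have dS: "((\<lambda>t. (f t)\<^sup>2 + (k t)\<^sup>2 / Q t) has_real_derivative - ((k t)\<^sup>2 * Q1 t / (Q t)\<^sup>2)) (at t)" .
  show "((\<lambda>t. ((f t)\<^sup>2 + (k t)\<^sup>2 / Q t) * R t) has_real_derivative
      - ((k t)\<^sup>2 * Q1 t / (Q t)\<^sup>2) * R t + ((f t)\<^sup>2 + (k t)\<^sup>2 / Q t) * R1 t) (at t)"
    using DERIV_mult[OF dS R[of t]] by (rule DERIV_cong) simp
  \<comment> \<open>First Q' is replaced by the smaller R', then R by Q, using - R' >= 0. The result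
    cancels the term k^2 R' / Q, and f^2 R' <= 0 remains.\<close>
  have "- ((k t)\<^sup>2 * Q1 t / (Q t)\<^sup>2) * R t \<le> - ((k t)\<^sup>2 * R1 t / (Q t)\<^sup>2) * R t"
    using R1(2)[of t] pos(2)[of t] by (intro mult_right_mono) (auto simp: divide_right_mono mult_left_mono)
  also have "\<dots> \<le> - ((k t)\<^sup>2 * R1 t / Q t)"
    using R1(3)[OF t]
  proof
    assume "R t \<le> Q t"
    then have "(- R1 t) * (k t)\<^sup>2 * R t \<le> (- R1 t) * (k t)\<^sup>2 * Q t"
      using R1(1)[of t] by (intro mult_left_mono mult_nonneg_nonneg) auto
    then show ?thesis using Q0 by (simp add: field_simps power2_eq_square)
  qed simp
  finally show "- ((k t)\<^sup>2 * Q1 t / (Q t)\<^sup>2) * R t + ((f t)\<^sup>2 + (k t)\<^sup>2 / Q t) * R1 t \<le> 0"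
    using R1(1)[of t] mult_nonneg_nonpos[of "(f t)\<^sup>2" "R1 t"] by (simp add: algebra_simps)
qed

section \<open>The oscillator with a \<open>tanh\<close> potential\<close>

text \<open>\<open>a\<close> is the exponent at the right end: by \<open>edge\<close>, the potential
  tends to - a^2 as t tends to infinity. The point \<open>t0\<close> is the maximum of the
  potential, where the energy is known.\<close>

locale tanh_oscillator =
  fixes N r m s a t0 :: real and v w :: "real \<Rightarrow> real"
  assumes N_pos: "N > 0" and r_pos: "r > 0" and r_le: "r \<le> 1 - \<bar>m\<bar>" and Nr: "N * r \<ge> 6"
    and s_ge: "s \<ge> 1" and m2_le: "1 - m\<^sup>2 \<le> 4 * s * r\<^sup>2" and N_cases: "N \<le> 2 * s \<or> r \<ge> 1 / 2"
    and edge: "N\<^sup>2 * ((1 - m)\<^sup>2 - r\<^sup>2) = a\<^sup>2" and a_le: "\<bar>a\<bar> \<le> 2 * s"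
    and tanh_t0: "tanh t0 = m"
    and v: "\<And>t. (v has_real_derivative w t) (at t)"
    and w: "\<And>t. (w has_real_derivative - (N\<^sup>2 * (r\<^sup>2 - (tanh t - m)\<^sup>2)) * v t) (at t)"
    and energy_t0: "(w t0)\<^sup>2 + (N * r)\<^sup>2 * (v t0)\<^sup>2 \<le> 4 * N\<^sup>2 * r"
begin

definition D where "D t = N\<^sup>2 * (r\<^sup>2 - (tanh t - m)\<^sup>2)"
definition z :: "real \<Rightarrow> real" where "z t = 1 - (tanh t)\<^sup>2"
definition D1 where "D1 t = - (2 * N\<^sup>2 * (tanh t - m) * z t)"
definition D2 where "D2 t = - (2 * N\<^sup>2 * z t * (z t - 2 * tanh t * (tanh t - m)))"

lemma z_pos: "z t > 0" and z_le: "z t \<le> 1"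
  using tanh_real_bounds[of t] by (auto simp: z_def abs_square_less_1)

lemma z_eq: "z t = 1 / (cosh t)\<^sup>2"
proof -
  have "z t = ((cosh t)\<^sup>2 - (sinh t)\<^sup>2) / (cosh t)\<^sup>2" by (simp add: z_def tanh_def diff_divide_distrib power_divide)
  then show ?thesis by (simp only: hyperbolic_pythagoras)
qed

lemma sqrt_z: "sqrt (z t) = 1 / cosh t"
  by (simp add: z_eq real_sqrt_divide)

lemma dz: "(z has_real_derivative - (2 * tanh t * z t)) (at t)"
  unfolding z_def[abs_def] by (auto intro!: derivative_eq_intros simp: algebra_simps power2_eq_square)

lemma dD: "(D has_real_derivative D1 t) (at t)"
  unfolding D_def[abs_def] D1_def z_def by (auto intro!: derivative_eq_intros simp: algebra_simps)

lemma dD1: "(D1 has_real_derivative D2 t) (at t)"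
  unfolding D1_def[abs_def] D2_def
  by (auto intro!: derivative_eq_intros dz simp: algebra_simps) (simp add: z_def algebra_simps power2_eq_square)

lemma w': "(w has_real_derivative - D t * v t) (at t)"
  using w by (simp add: D_def)

lemmas isCont_intros = dD[THEN DERIV_isCont] dD1[THEN DERIV_isCont]

lemma tanh_ge: "t0 \<le> t \<Longrightarrow> tanh t \<ge> m"
  using tanh_t0 by (metis tanh_real_le_iff)

lemma D1_nonpos: "t0 \<le> t \<Longrightarrow> D1 t \<le> 0"
  using tanh_ge[of t] z_pos[of t] by (simp add: D1_def)

lemma D_antimono: "t0 \<le> t \<Longrightarrow> t \<le> u \<Longrightarrow> D u \<le> D t"
  by (rule nonincreasing_on[OF _ dD]) (use D1_nonpos in auto)

lemma D_lower: "t0 \<le> t \<Longrightarrow> D t \<ge> - a\<^sup>2"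
proof -
  assume "t0 \<le> t"
  then have "(tanh t - m)\<^sup>2 \<le> (1 - m)\<^sup>2"
    using tanh_ge[of t] tanh_real_lt_1[of t] by (intro power_mono) auto
  then have "N\<^sup>2 * (r\<^sup>2 - (tanh t - m)\<^sup>2) \<ge> N\<^sup>2 * (r\<^sup>2 - (1 - m)\<^sup>2)" by (intro mult_left_mono) auto
  then show ?thesis using edge by (simp add: D_def algebra_simps)
qed

text \<open>The logarithmic derivative of \<open>D1\<^sup>2 / D\<^sup>3\<close> has the sign of the difference of both sides.\<close>

lemma D_log_convex:
  assumes "t0 \<le> t" "D t \<ge> 0"
  shows "2 * D t * D2 t \<le> 3 * (D1 t)\<^sup>2"
proof -
  define x where "x = tanh t"
  define X where "X = x - m"
  have X: "X \<ge> 0" using tanh_ge[OF assms(1)] by (simp add: X_def x_def)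
  have "X\<^sup>2 \<le> r\<^sup>2" using assms(2) N_pos by (simp add: D_def X_def x_def zero_le_mult_iff)
  then have Xr: "X \<le> r" by (rule power2_le_imp_le) (use r_pos in simp)
  have x1: "-1 < x" "x < 1" using tanh_real_bounds[of t] by (auto simp: x_def)
  have key: "(r\<^sup>2 - X\<^sup>2) * (2 * x * X) \<le> (r\<^sup>2 + 2 * X\<^sup>2) * z t"
  proof (cases "x \<le> 0")
    case True
    have "2 * x * X \<le> 0" using X True mult_nonpos_nonneg[of "2 * x" X] by simp
    then have "(r\<^sup>2 - X\<^sup>2) * (2 * x * X) \<le> 0"
      using \<open>X\<^sup>2 \<le> r\<^sup>2\<close> mult_nonneg_nonpos[of "r\<^sup>2 - X\<^sup>2" "2 * x * X"] by simp
    moreover have "(r\<^sup>2 + 2 * X\<^sup>2) * z t \<ge> 0" using z_pos[of t] by simp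
    ultimately show ?thesis by linarith
  next
    case False
    \<comment> \<open>Factorwise: r - X <= 1 - m - X = 1 - x and 2 x <= 1 + x.\<close>
    have "(r - X) * (2 * x) \<le> (1 - x) * (1 + x)"
      using r_le Xr False x1 by (intro mult_mono) (auto simp: X_def)
    then have "(r\<^sup>2 + 2 * X\<^sup>2) * ((r - X) * (2 * x)) \<le> (r\<^sup>2 + 2 * X\<^sup>2) * z t"
      by (intro mult_left_mono) (auto simp: z_def x_def power2_eq_square algebra_simps)
    moreover have "(r + X) * X \<le> r\<^sup>2 + 2 * X\<^sup>2"
    proof -
      have "r\<^sup>2 + 2 * X\<^sup>2 - (r + X) * X = (r - X)\<^sup>2 + r * X"
        by (simp add: power2_eq_square algebra_simps)
      also have "\<dots> \<ge> 0" using X r_pos by (intro add_nonneg_nonneg mult_nonneg_nonneg) auto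
      finally show ?thesis by simp
    qed
    then have "(r + X) * X * ((r - X) * (2 * x)) \<le> (r\<^sup>2 + 2 * X\<^sup>2) * ((r - X) * (2 * x))"
      using Xr False by (intro mult_right_mono) auto
    ultimately show ?thesis by (simp add: power2_eq_square algebra_simps)
  qed
  have "3 * (D1 t)\<^sup>2 - 2 * D t * D2 t =
      4 * (N\<^sup>2)\<^sup>2 * z t * ((r\<^sup>2 + 2 * X\<^sup>2) * z t - (r\<^sup>2 - X\<^sup>2) * (2 * x * X))"
    unfolding D_def D1_def D2_def x_def[symmetric] X_def[symmetric]
    by (simp add: power2_eq_square algebra_simps)
  also have "\<dots> \<ge> 0" using key z_pos[of t] by (intro mult_nonneg_nonneg) auto
  finally show ?thesis by simp
qed

text \<open>Moving from m to the right by X <= 1 - |m| increases 1 - x^2 by a factor of at most 3,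
  because m X >= - (1 - m^2); then \<open>m2_le\<close> contributes 4 s.\<close>

lemma z_le_r2: 
  assumes "0 \<le> tanh t - m" "tanh t - m \<le> r"
  shows "z t \<le> 12 * s * r\<^sup>2"
proof -
  define X where "X = tanh t - m"
  have X: "0 \<le> X" "X \<le> 1 - \<bar>m\<bar>" using assms r_le by (auto simp: X_def)
  have "m * X \<ge> - (1 - m\<^sup>2)"
  proof -
    have "\<bar>m\<bar> * X \<le> \<bar>m\<bar> * (1 - \<bar>m\<bar>)" using X by (intro mult_left_mono) auto
    also have "\<dots> \<le> (1 + \<bar>m\<bar>) * (1 - \<bar>m\<bar>)" using X by (intro mult_right_mono) auto
    also have "\<dots> = 1 - m\<^sup>2" by (simp add: algebra_simps power2_eq_square)
    finally have "\<bar>m\<bar> * X \<le> 1 - m\<^sup>2" .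
    moreover have "- \<bar>m\<bar> * X \<le> m * X" using X by (intro mult_right_mono) auto
    ultimately show ?thesis by simp
  qed
  moreover have "z t = 1 - m\<^sup>2 - 2 * (m * X) - X\<^sup>2"
    by (simp add: z_def X_def power2_eq_square algebra_simps)
  ultimately have "z t \<le> 3 * (1 - m\<^sup>2)" using zero_le_power2[of X] by argo
  with m2_le show ?thesis by argo
qed

text \<open>Write d = D, X = x - m and Z = N^2 z, so that the smallness condition reads X^2 Z^2 <=
  d^3. If X^2 <= r^2 / 2, then d >= N^2 r^2 / 2 and \<open>z_le_r2\<close> suffices. Otherwise r^2
  Z^2 <= 2 d^3, and it remains to bound Z / r^2 by a multiple of s^3 (if N <= 2 s), or else Z by a
  multiple of s^3 or of d (if r >= 1 / 2).\<close>

lemma z_le_D: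
  assumes t: "t0 \<le> t" and pos: "D t > 0" and small: "(D1 t)\<^sup>2 \<le> 4 * D t ^ 3"
  shows "N\<^sup>2 * z t \<le> 24 * s * D t"
proof -
  define X where "X = tanh t - m"
  define Z where "Z = N\<^sup>2 * z t"
  define d where "d = D t"
  have X: "X \<ge> 0" using tanh_ge[OF t] by (simp add: X_def)
  have d: "d = N\<^sup>2 * (r\<^sup>2 - X\<^sup>2)" "d > 0" using pos by (auto simp: d_def D_def X_def)
  have "X\<^sup>2 < r\<^sup>2" using d N_pos by (simp add: zero_less_mult_iff)
  then have Xr: "X < r" by (rule power_less_imp_less_base) (use r_pos in simp)
  have zr: "z t \<le> 12 * s * r\<^sup>2" using z_le_r2[of t] X Xr by (simp add: X_def)
  have Z0: "Z > 0" using z_pos[of t] N_pos by (simp add: Z_def)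
  have XZ: "X\<^sup>2 * Z\<^sup>2 \<le> d ^ 3"
    using small by (simp add: D1_def X_def Z_def d_def power_mult_distrib mult_ac)
  have "Z \<le> 24 * s * d"
  proof (cases "X\<^sup>2 \<le> r\<^sup>2 / 2")
    case True
    then have "N\<^sup>2 * (r\<^sup>2 / 2) \<le> d" unfolding d(1) by (intro mult_left_mono) auto
    then have "24 * s * (N\<^sup>2 * (r\<^sup>2 / 2)) \<le> 24 * s * d" using s_ge by (intro mult_left_mono) auto
    moreover have "Z \<le> N\<^sup>2 * (12 * s * r\<^sup>2)" unfolding Z_def using zr by (intro mult_left_mono) auto
    ultimately show ?thesis by (simp add: algebra_simps)
  next
    case False
    then have "r\<^sup>2 / 2 * Z\<^sup>2 \<le> X\<^sup>2 * Z\<^sup>2" by (intro mult_right_mono) auto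
    with XZ have rZ: "r\<^sup>2 * Z\<^sup>2 \<le> 2 * d ^ 3" by simp
    show ?thesis
    proof (cases "N \<le> 2 * s")
      case True
      then have "N\<^sup>2 \<le> (2 * s)\<^sup>2" using N_pos by (intro power_mono) auto
      then have "Z \<le> (2 * s)\<^sup>2 * (12 * s * r\<^sup>2)"
        unfolding Z_def using zr z_pos[of t] by (intro mult_mono) auto
      then have "Z * Z\<^sup>2 \<le> (2 * s)\<^sup>2 * (12 * s * r\<^sup>2) * Z\<^sup>2" by (intro mult_right_mono) auto
      also have "\<dots> = 48 * s ^ 3 * (r\<^sup>2 * Z\<^sup>2)" by (simp add: power2_eq_square power3_eq_cube)
      also have "\<dots> \<le> 48 * s ^ 3 * (2 * d ^ 3)" using rZ s_ge by (intro mult_left_mono) auto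
      also have "\<dots> \<le> 24 ^ 3 * (s ^ 3 * d ^ 3)" using d(2) s_ge by simp
      also have "\<dots> = (24 * s * d) ^ 3" by (simp add: power_mult_distrib)
      finally have "Z ^ 3 \<le> (24 * s * d) ^ 3" by (simp add: power3_eq_cube power2_eq_square mult_ac)
      then show ?thesis using d(2) s_ge Z0 by (subst (asm) power_mono_iff) auto
    next
      case False
      with N_cases have r: "r \<ge> 1 / 2" by simp
      then have "(1 / 2)\<^sup>2 \<le> r\<^sup>2" by (intro power_mono) auto
      then have "(1 / 2)\<^sup>2 * Z\<^sup>2 \<le> r\<^sup>2 * Z\<^sup>2" by (intro mult_right_mono) auto
      with rZ have Z2: "Z\<^sup>2 \<le> 8 * d ^ 3" by (simp add: power2_eq_square)
      \<comment> \<open>1 - x is the sum of 1 - m - r, which \<open>edge\<close> controls by a^2 /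
        N^2, and r - X, which is controlled by d / N^2.\<close>
      have "z t \<le> 2 * (1 - m - X)"
        using zero_le_power2[of "1 - tanh t"] by (simp add: z_def X_def power2_eq_square algebra_simps)
      then have "Z \<le> N\<^sup>2 * (2 * (1 - m - X))" unfolding Z_def by (intro mult_left_mono) auto
      also have "\<dots> \<le> N\<^sup>2 * (2 * (((1 - m)\<^sup>2 - r\<^sup>2) + 2 * (r\<^sup>2 - X\<^sup>2)))"
      proof -
        have "(1 - m) + r \<ge> 1" using r r_le by linarith
        then have "((1 - m) - r) * 1 \<le> ((1 - m) - r) * ((1 - m) + r)" using r_le by (intro mult_left_mono) auto
        moreover have "(r - X) * 1 \<le> (r - X) * (2 * (r + X))" using Xr r X by (intro mult_left_mono) auto
        ultimately show ?thesis by (intro mult_left_mono) (auto simp: power2_eq_square algebra_simps)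
      qed
      also have "\<dots> = 2 * a\<^sup>2 + 4 * d" using edge by (simp add: d algebra_simps)
      also have "a\<^sup>2 \<le> (2 * s)\<^sup>2" using a_le s_ge by (metis abs_ge_zero power2_abs power_mono)
      finally have Zle: "Z \<le> 8 * s\<^sup>2 + 4 * d" by (simp add: power_mult_distrib)
      show ?thesis
      proof (cases "d \<le> s ^ 3")
        case True
        have "Z ^ 3 = Z * Z\<^sup>2" by (simp add: power3_eq_cube power2_eq_square)
        also have "\<dots> \<le> (8 * s\<^sup>2 + 4 * d) * (8 * d ^ 3)" using Zle Z2 Z0 d(2) by (intro mult_mono) auto
        also have "\<dots> \<le> (8 * s ^ 3 + 4 * s ^ 3) * (8 * d ^ 3)"
          using True d(2) power_increasing[of 2 3 s] s_ge by (intro mult_right_mono) auto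
        also have "\<dots> \<le> 24 ^ 3 * (s ^ 3 * d ^ 3)" using d(2) s_ge by simp
        also have "\<dots> = (24 * s * d) ^ 3" by (simp add: power_mult_distrib)
        finally show ?thesis using d(2) s_ge Z0 by (subst (asm) power_mono_iff) auto
      next
        case False
        then have "8 * s\<^sup>2 \<le> 8 * d" using power_increasing[of 2 3 s] s_ge by linarith
        with Zle have "Z \<le> 12 * d" by simp
        also have "\<dots> \<le> 24 * s * d" using s_ge d(2) by simp
        finally show ?thesis .
      qed
    qed
  qed
  then show ?thesis by (simp add: Z_def d_def)
qed

text \<open>At \<open>t0\<close> the amplitude is at most 4 N^2 r / (N r) = 4 N, hence at most 24 N
  at T. The bound keeps v' as well as v, since both are the initial data for the motion past
  T.\<close>

lemma energy_weight_le:
  assumes T: "t0 \<le> T"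
    and pos: "\<And>t. t0 \<le> t \<Longrightarrow> t \<le> T \<Longrightarrow> D t > 0"
    and small: "\<And>t. t0 \<le> t \<Longrightarrow> t \<le> T \<Longrightarrow> (D1 t)\<^sup>2 \<le> 4 * D t ^ 3"
  shows "((w T)\<^sup>2 + D T * (v T)\<^sup>2) / cosh T \<le> 120 * sqrt s * D T"
proof -
  let ?S = "sqrt (D T)"
  have d: "D T > 0" using pos T by simp
  have "sqrt (D T) * (v T)\<^sup>2 + (w T)\<^sup>2 / sqrt (D T) \<le> 6 * (sqrt (D t0) * (v t0)\<^sup>2 + (w t0)\<^sup>2 / sqrt (D t0))"
    by (rule adiabatic_invariant_le[OF T v w' dD dD1 pos small])
      (use D_log_convex pos in \<open>auto simp: D1_def tanh_t0 less_imp_le\<close>)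
  also have "sqrt (D t0) = N * r"
    using N_pos r_pos by (simp add: D_def tanh_t0 real_sqrt_mult)
  also have "N * r * (v t0)\<^sup>2 + (w t0)\<^sup>2 / (N * r) = ((w t0)\<^sup>2 + (N * r)\<^sup>2 * (v t0)\<^sup>2) / (N * r)"
    using N_pos r_pos by (simp add: field_simps power2_eq_square)
  also have "\<dots> \<le> 4 * N\<^sup>2 * r / (N * r)"
    using energy_t0 N_pos r_pos by (intro divide_right_mono) auto
  also have "\<dots> = 4 * N" using N_pos r_pos by (simp add: power2_eq_square)
  also have "?S * (v T)\<^sup>2 + (w T)\<^sup>2 / ?S = ((w T)\<^sup>2 + D T * (v T)\<^sup>2) / ?S"
    using d by (simp add: field_simps)
  finally have W: "((w T)\<^sup>2 + D T * (v T)\<^sup>2) / ?S \<le> 24 * N" by simp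
  have "N * sqrt (z T) = sqrt (N\<^sup>2 * z T)" using N_pos by (simp add: real_sqrt_mult)
  \<comment> \<open>The constant 24 of \<open>z_le_D\<close> is rounded up to a perfect
    square.\<close>
  also have "\<dots> \<le> sqrt (5\<^sup>2 * s * D T)"
    using z_le_D[OF T d small] T s_ge d by (intro real_sqrt_le_mono) (simp add: mult_right_mono order_trans)
  also have "\<dots> = 5 * sqrt s * ?S" by (simp add: real_sqrt_mult)
  finally have z: "N / cosh T \<le> 5 * sqrt s * ?S" by (simp add: sqrt_z)
  have "((w T)\<^sup>2 + D T * (v T)\<^sup>2) / cosh T = ((w T)\<^sup>2 + D T * (v T)\<^sup>2) / ?S * (?S / cosh T)"
    using d by simp
  also have "\<dots> \<le> 24 * N * (?S / cosh T)" using W d by (intro mult_right_mono) auto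
  also have "\<dots> = 24 * ?S * (N / cosh T)" by simp
  also have "\<dots> \<le> 24 * ?S * (5 * sqrt s * ?S)" using z d by (intro mult_left_mono) auto
  also have "\<dots> = 120 * sqrt s * D T" using d by (simp add: algebra_simps)
  finally show ?thesis .
qed

lemma v_weight_le:
  assumes T: "t0 \<le> T"
    and pos: "\<And>t. t0 \<le> t \<Longrightarrow> t \<le> T \<Longrightarrow> D t > 0"
    and small: "\<And>t. t0 \<le> t \<Longrightarrow> t \<le> T \<Longrightarrow> (D1 t)\<^sup>2 \<le> 4 * D t ^ 3"
  shows "(v T)\<^sup>2 / cosh T \<le> 120 * sqrt s"
proof -
  have d: "D T > 0" using pos T by simp
  have "D T * ((v T)\<^sup>2 / cosh T) \<le> ((w T)\<^sup>2 + D T * (v T)\<^sup>2) / cosh T"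
    by (simp add: divide_right_mono)
  also have "\<dots> \<le> 120 * sqrt s * D T" by (rule energy_weight_le[OF assms])
  finally have "D T * ((v T)\<^sup>2 / cosh T) \<le> D T * (120 * sqrt s)" by (simp only: mult_ac)
  then show ?thesis using d by (simp only: mult_le_cancel_left_pos)
qed

end

lemma tanh_surj_on_unit:
  fixes x :: real
  assumes "-1 < x" "x < 1"
  obtains t where "tanh t = x"
proof
  define q where "q = (1 + x) / (1 - x)"
  have q: "q > 0" using assms by (simp add: q_def)
  have "tanh (ln (sqrt q)) = (q - 1) / (q + 1)" using q by (simp add: tanh_ln_real)
  also have "\<dots> = x" using assms by (simp add: q_def field_simps)
  finally show "tanh (ln (sqrt q)) = x" .
qed

lemma cosh_growth:
  fixes t u :: real
  assumes "t \<le> u"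
  shows "cosh u \<le> exp (u - t) * cosh t" "cosh t \<le> exp (u - t) * cosh u"
    "0 \<le> t \<Longrightarrow> exp (u - t) * cosh t \<le> 2 * cosh u"
proof -
  have e: "exp (u - t) * (exp t + exp (- t)) = exp u + exp (u - 2 * t)"
    "exp (u - t) * (exp u + exp (- u)) = exp (2 * u - t) + exp (- t)"
    by (simp_all add: distrib_left exp_add[symmetric])
  have "exp (- u) \<le> exp (u - 2 * t)" "exp t \<le> exp (2 * u - t)" using assms by auto
  with e show "cosh u \<le> exp (u - t) * cosh t" "cosh t \<le> exp (u - t) * cosh u"
    by (simp_all add: cosh_def)
  assume "0 \<le> t"
  then have "exp (u - 2 * t) \<le> exp u" by simp
  moreover have "exp (- u) \<ge> 0" by simp
  moreover have "exp (u - t) * cosh t = (exp u + exp (u - 2 * t)) / 2" "2 * cosh u = exp u + exp (- u)"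
    using e(1) by (simp_all add: cosh_def)
  ultimately show "exp (u - t) * cosh t \<le> 2 * cosh u" by argo
qed

section \<open>Past the WKB region: turning point, decay, and Sonin's function at a soft end\<close>

context tanh_oscillator
begin

text \<open>For a nonzero a the turning point m + r lies below 1 and is reached at a finite time.
  There D vanishes but D' does not, while D' = 0 at \<open>t0\<close>, so D'^2 = 4 D^3 happens in
  between. As D'^2 / D^3 is nondecreasing by \<open>D_log_convex\<close>, the inequality holds up to
  that time.\<close>

lemma transition_point:
  assumes "a \<noteq> 0"
  obtains T where "t0 \<le> T" "D1 T = - 2 * sqrt (D T) ^ 3"
    "\<And>t. t0 \<le> t \<Longrightarrow> t \<le> T \<Longrightarrow> D t > 0"
    "\<And>t. t0 \<le> t \<Longrightarrow> t \<le> T \<Longrightarrow> (D1 t)\<^sup>2 \<le> 4 * D t ^ 3"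
proof -
  have "r \<noteq> 1 - m" using edge assms by auto
  then have "m + r < 1" "-1 < m + r" using r_le r_pos by auto
  then obtain tz where tz: "tanh tz = m + r" using tanh_surj_on_unit by blast
  have t0z: "t0 < tz" using tanh_t0 tz r_pos by (metis less_add_same_cancel1 tanh_real_less_iff)
  have Dpos: "D t > 0" if "t0 \<le> t" "t < tz" for t
  proof -
    have "0 \<le> tanh t - m" "tanh t - m < r"
      using tanh_ge[OF that(1)] that(2) tz by (auto simp: algebra_simps simp flip: tz)
    then have "(tanh t - m)\<^sup>2 < r\<^sup>2" by (intro power_strict_mono) auto
    then show ?thesis using N_pos by (simp add: D_def)
  qed
  define \<phi> where "\<phi> t = (D1 t)\<^sup>2 - 4 * D t ^ 3" for t
  have "\<phi> t0 \<le> 0" using Dpos[of t0] t0z by (simp add: \<phi>_def D1_def tanh_t0)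
  moreover have Dz: "D tz = 0" by (simp add: D_def tz)
  have D1z: "D1 tz \<noteq> 0" using N_pos r_pos z_pos[of tz] by (simp add: D1_def tz)
  have "0 \<le> \<phi> tz" by (simp add: \<phi>_def Dz)
  moreover have "\<forall>x. t0 \<le> x \<and> x \<le> tz \<longrightarrow> isCont \<phi> x"
    unfolding \<phi>_def[abs_def] by (auto intro!: continuous_intros isCont_intros)
  ultimately obtain T where T: "t0 \<le> T" "T \<le> tz" "\<phi> T = 0" using IVT[of \<phi> t0 0 tz] t0z by auto
  have "T \<noteq> tz" using T(3) Dz D1z by (auto simp: \<phi>_def)
  then have Tz: "T < tz" using T by simp
  have pos: "D t > 0" if "t0 \<le> t" "t \<le> T" for t using Dpos that Tz by simp
  define h where "h t = (D1 t)\<^sup>2 / D t ^ 3" for t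
  have le: "h t \<le> h T" if t: "t0 \<le> t" "t \<le> T" for t
  proof (rule DERIV_nonneg_imp_nondecreasing[OF t(2)])
    fix u assume u: "t \<le> u" "u \<le> T"
    then have u0: "t0 \<le> u" and du: "D u > 0" using t pos by auto
    have "(h has_real_derivative (2 * D1 u * D2 u * D u ^ 3 - (D1 u)\<^sup>2 * (3 * D u ^ 2 * D1 u)) / (D u ^ 3)\<^sup>2) (at u)"
      unfolding h_def[abs_def] using du
      by (auto intro!: derivative_eq_intros dD dD1 simp: power2_eq_square eval_nat_numeral algebra_simps)
    moreover have "2 * D1 u * D2 u * D u ^ 3 - (D1 u)\<^sup>2 * (3 * D u ^ 2 * D1 u)
        = (- D1 u) * (D u)\<^sup>2 * (3 * (D1 u)\<^sup>2 - 2 * D u * D2 u)"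
      by (simp add: power2_eq_square power3_eq_cube algebra_simps)
    moreover have "\<dots> \<ge> 0" using D1_nonpos[OF u0] D_log_convex[OF u0] du
      by (intro mult_nonneg_nonneg) auto
    ultimately show "\<exists>y. (h has_real_derivative y) (at u) \<and> 0 \<le> y" by (metis divide_nonneg_nonneg zero_le_power2)
  qed
  have hT: "h T = 4" using T(3) pos[OF T(1)] by (simp add: h_def \<phi>_def)
  show thesis
  proof (rule that[OF T(1) _ pos])
    have "(D1 T)\<^sup>2 = (2 * sqrt (D T) ^ 3)\<^sup>2"
    proof -
      have "(2 * sqrt (D T) ^ 3)\<^sup>2 = 4 * ((sqrt (D T))\<^sup>2) ^ 3"
        by (simp add: power_mult_distrib flip: power_mult)
      also have "(sqrt (D T))\<^sup>2 = D T" using pos[OF T(1)] by simp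
      finally show ?thesis using T(3) by (simp add: \<phi>_def)
    qed
    then have "D1 T = 2 * sqrt (D T) ^ 3 \<or> D1 T = - (2 * sqrt (D T) ^ 3)" by (simp only: power2_eq_iff)
    moreover have "sqrt (D T) ^ 3 > 0" using pos[OF T(1)] by simp
    ultimately show "D1 T = - 2 * sqrt (D T) ^ 3" using D1_nonpos[OF T(1)] by auto
    fix t assume t: "t0 \<le> t" "t \<le> T"
    show "(D1 t)\<^sup>2 \<le> 4 * D t ^ 3"
      using le[OF t] pos[OF t] unfolding hT by (simp add: h_def divide_le_eq)
  qed
qed

text \<open>The function E = v v' - v^2 tanh t / 2 has derivative a square plus v^2 (- D - 1/4 -
  z/4). As z <= 1, the threshold -1/2 makes this nonnegative.\<close>

lemma v_weight_antimono:
  assumes lim: "(v \<longlongrightarrow> 0) at_top" and T: "t0 \<le> T" "D T \<le> - 1 / 2" and t: "T \<le> t" "t \<le> u"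
  shows "(v u)\<^sup>2 / cosh u \<le> (v t)\<^sup>2 / cosh t"
proof (rule decay_nonincreasing[OF _ _ _ _ _ _ t])
  fix t assume "T \<le> t"
  then have D: "D t \<le> - 1 / 2" using D_antimono[of T t] T by simp
  show "((\<lambda>t. (v t)\<^sup>2 / cosh t) has_real_derivative 2 / cosh t * (v t * w t - (v t)\<^sup>2 * tanh t / 2)) (at t)"
    by (auto intro!: derivative_eq_intros v simp: tanh_def field_simps power2_eq_square)
  show "2 / cosh t > 0" by simp
  show "((\<lambda>t. v t * w t - (v t)\<^sup>2 * tanh t / 2) has_real_derivative
      (w t - v t * tanh t / 2)\<^sup>2 + (v t)\<^sup>2 * (- D t - 1 / 4 - z t / 4)) (at t)"
    by (auto intro!: derivative_eq_intros v w' simp: z_def field_simps power2_eq_square)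
  have "- D t - 1 / 4 - z t / 4 \<ge> 0" using D z_le[of t] by simp
  then show "(w t - v t * tanh t / 2)\<^sup>2 + (v t)\<^sup>2 * (- D t - 1 / 4 - z t / 4) \<ge> 0"
    by (intro add_nonneg_nonneg mult_nonneg_nonneg) auto
  show "(v t)\<^sup>2 / cosh t \<ge> 0" by simp
next
  show "((\<lambda>t. (v t)\<^sup>2 / cosh t) \<longlongrightarrow> 0) at_top"
  proof (rule Lim_null_comparison)
    show "((\<lambda>t. (v t)\<^sup>2) \<longlongrightarrow> 0) at_top" using tendsto_power[OF lim, of 2] by simp
    show "eventually (\<lambda>t. norm ((v t)\<^sup>2 / cosh t) \<le> (v t)\<^sup>2) at_top"
      using cosh_real_ge_1 by (intro always_eventually allI) (simp add: divide_le_eq mult_le_cancel_left1)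
  qed
qed

text \<open>Beyond the turning point v^2 is convex and tends to 0. Unlike
  \<open>v_weight_antimono\<close> this starts at D = 0, but leaves the factor 1 / cosh t to be
  treated separately.\<close>

lemma v_antimono:
  assumes lim: "(v \<longlongrightarrow> 0) at_top" and T: "t0 \<le> T" "D T \<le> 0" and t: "T \<le> t" "t \<le> u"
  shows "(v u)\<^sup>2 \<le> (v t)\<^sup>2"
proof (rule decay_nonincreasing[OF _ _ _ _ _ _ t])
  fix t assume "T \<le> t"
  then have D: "D t \<le> 0" using D_antimono[of T t] T by simp
  show "((\<lambda>t. (v t)\<^sup>2) has_real_derivative 2 * (v t * w t)) (at t)"
    by (auto intro!: derivative_eq_intros v)
  show "((\<lambda>t. v t * w t) has_real_derivative (w t)\<^sup>2 + (v t)\<^sup>2 * (- D t)) (at t)"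
    by (auto intro!: derivative_eq_intros v w' simp: algebra_simps power2_eq_square)
  show "(w t)\<^sup>2 + (v t)\<^sup>2 * (- D t) \<ge> 0"
    using D by (intro add_nonneg_nonneg mult_nonneg_nonneg) auto
  show "(2::real) > 0" "(v t)\<^sup>2 \<ge> 0" by auto
next
  show "((\<lambda>t. (v t)\<^sup>2) \<longlongrightarrow> 0) at_top" using tendsto_power[OF lim, of 2] by simp
qed

text \<open>With q = sqrt (D T) >= 3 the slope - 2 q^3 takes D below -1/2 within time 1/q. Meanwhile
  v'^2 + q^2 v^2 grows by at most exp 2 <= 9 and 1 / cosh by at most exp 1 <= 3, which makes 27;
  afterwards \<open>v_weight_antimono\<close> applies.\<close>

lemma sharp_turning_point:
  assumes lim: "(v \<longlongrightarrow> 0) at_top" and T: "t0 \<le> T" "D1 T = - 2 * sqrt (D T) ^ 3" and D9: "D T \<ge> 9"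
    and energy: "((w T)\<^sup>2 + D T * (v T)\<^sup>2) / cosh T \<le> B * D T" and t: "T \<le> t"
  shows "(v t)\<^sup>2 / cosh t \<le> 27 * B"
proof -
  define q where "q = sqrt (D T)"
  have "sqrt (3\<^sup>2) \<le> q" unfolding q_def using D9 by (intro real_sqrt_le_mono) simp
  then have q3: "q \<ge> 3" by simp
  have q2: "D T = q\<^sup>2" using D9 by (simp add: q_def)
  define T2 where "T2 = T + 1 / q"
  have T2: "T \<le> T2" using q3 by (simp add: T2_def)
  have "D T2 \<le> - 1 / 2"
  proof -
    \<comment> \<open>The slope stays below - 2 q^3 exp (- 2 (t - T)): tanh t - m increases and z
      decays at rate at most 2.\<close>
    let ?\<psi> = "\<lambda>t. D t - q ^ 3 * exp (- 2 * (t - T))"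
    have "?\<psi> T2 \<le> ?\<psi> T"
    proof (rule nonincreasing_on[OF T2])
      fix t assume t: "T \<le> t" "t \<le> T2"
      show "(?\<psi> has_real_derivative D1 t + 2 * q ^ 3 * exp (- 2 * (t - T))) (at t)"
        by (auto intro!: derivative_eq_intros dD)
      have zt: "z t \<ge> exp (- 2 * (t - T)) * z T"
      proof -
        have "(cosh t)\<^sup>2 \<le> (exp (t - T) * cosh T)\<^sup>2" using cosh_growth(1)[OF t(1)] by (intro power_mono) auto
        then have "1 / (exp (t - T) * cosh T)\<^sup>2 \<le> 1 / (cosh t)\<^sup>2" by (intro divide_left_mono) auto
        moreover have "1 / (exp (t - T))\<^sup>2 = exp (- 2 * (t - T))"
          by (simp add: exp_double[symmetric] exp_minus[symmetric] inverse_eq_divide[symmetric] algebra_simps)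
        ultimately show ?thesis by (simp add: z_eq power_mult_distrib divide_divide_eq_left[symmetric])
      qed
      have mT: "0 \<le> tanh T - m" "tanh T - m \<le> tanh t - m" "0 \<le> tanh t - m"
        using tanh_ge[OF T(1)] tanh_ge[of t] T(1) t by auto
      have "q ^ 3 * exp (- 2 * (t - T)) = N\<^sup>2 * ((tanh T - m) * (exp (- 2 * (t - T)) * z T))"
        using T(2) by (simp add: D1_def q_def[symmetric])
      also have "\<dots> \<le> N\<^sup>2 * ((tanh t - m) * z t)"
        using mT zt z_pos[of T] by (intro mult_left_mono mult_mono) auto
      finally show "D1 t + 2 * q ^ 3 * exp (- 2 * (t - T)) \<le> 0" by (simp add: D1_def)
    qed
    then have 1: "D T2 \<le> q\<^sup>2 - q ^ 3 * (1 - exp (- (2 / q)))"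
      by (simp add: q2 T2_def algebra_simps)
    have "1 + 2 / q + (2 / q)\<^sup>2 / 2 \<le> exp (2 / q)" using q3 by (intro exp_lower_Taylor_quadratic) simp
    then have "exp (- (2 / q)) \<le> 1 / (1 + 2 / q + (2 / q)\<^sup>2 / 2)"
      using q3 by (simp add: exp_minus inverse_eq_divide) (intro divide_left_mono mult_pos_pos add_pos_nonneg, auto)
    also have "\<dots> = q\<^sup>2 / (q\<^sup>2 + 2 * q + 2)" using q3 by (simp add: field_simps power2_eq_square)
    finally have "q ^ 3 * (1 - q\<^sup>2 / (q\<^sup>2 + 2 * q + 2)) \<le> q ^ 3 * (1 - exp (- (2 / q)))"
      using q3 by (intro mult_left_mono) auto
    with 1 have "D T2 \<le> q\<^sup>2 - q ^ 3 * (1 - q\<^sup>2 / (q\<^sup>2 + 2 * q + 2))" by simp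
    also have "\<dots> = - (q\<^sup>2 * (q\<^sup>2 - 2)) / (q\<^sup>2 + 2 * q + 2)"
    proof -
      have "q\<^sup>2 + 2 * q + 2 > 0" using q3 by (simp add: add_pos_pos)
      then show ?thesis by (simp add: field_simps power2_eq_square power3_eq_cube)
    qed
    also have "\<dots> \<le> - 1 / 2"
    proof -
      have p: "q\<^sup>2 + 2 * q + 2 > 0" using q3 by (simp add: add_pos_pos)
      have q9: "q\<^sup>2 \<ge> 3 * q" using q3 by (simp add: power2_eq_square)
      have "q\<^sup>2 * 7 \<le> q\<^sup>2 * (q\<^sup>2 - 2)" using q9 q3 by (intro mult_left_mono) auto
      then have "q\<^sup>2 + 2 * q + 2 \<le> 2 * (q\<^sup>2 * (q\<^sup>2 - 2))" using q9 q3 by argo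
      then show ?thesis using p by (simp add: divide_le_eq)
    qed
    finally show ?thesis .
  qed
  then obtain T1 where T1: "T \<le> T1" "T1 \<le> T2" "D T1 = - 1 / 2"
    using IVT2[of D T2 "- 1 / 2" T] T2 D9 isCont_intros(1) by auto
  have near: "(v u)\<^sup>2 / cosh u \<le> 27 * B" if u: "T \<le> u" "u \<le> T1" for u
  proof -
    have uT: "u - T \<le> 1 / q" using u T1 by (simp add: T2_def)
    \<comment> \<open>D changes sign on this interval, so it is frozen at q^2. Since q^2 - D <= q^2
      + 1/2 <= 2 q^2 and 2 q |v v'| <= Y, the growth rate is 2 q.\<close>
    let ?Y = "\<lambda>t. (w t)\<^sup>2 + q\<^sup>2 * (v t)\<^sup>2"
    have "?Y u \<le> ?Y T * exp (2 * q * (u - T))"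
    proof (rule gronwall[OF u(1)])
      fix t assume t: "T \<le> t" "t \<le> u"
      show "(?Y has_real_derivative 2 * ((q\<^sup>2 - D t) * (v t * w t))) (at t)"
        by (auto intro!: derivative_eq_intros v w' simp: algebra_simps)
      have Dt: "D t \<le> q\<^sup>2" "- 1 / 2 \<le> D t"
        using D_antimono[of T t] D_antimono[of t T1] T t u T1 q2 by auto
      have "q * (2 * \<bar>v t * w t\<bar>) \<le> ?Y t"
        using zero_le_power2[of "\<bar>w t\<bar> - q * \<bar>v t\<bar>"] by (simp add: power2_eq_square abs_mult algebra_simps)
      have "2 * ((q\<^sup>2 - D t) * (v t * w t)) \<le> 2 * ((q\<^sup>2 - D t) * \<bar>v t * w t\<bar>)"
        using Dt by (intro mult_left_mono) auto
      also have "\<dots> \<le> 2 * ((q * (2 * q)) * \<bar>v t * w t\<bar>)"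
      proof -
        have "9 \<le> q\<^sup>2" using q2 D9 by simp
        then have "q\<^sup>2 - D t \<le> q * (2 * q)" using Dt unfolding power2_eq_square by argo
        then show ?thesis by (intro mult_left_mono mult_right_mono) auto
      qed
      also have "\<dots> = 2 * q * (q * (2 * \<bar>v t * w t\<bar>))" by simp
      also have "\<dots> \<le> 2 * q * ?Y t" using \<open>q * (2 * \<bar>v t * w t\<bar>) \<le> ?Y t\<close> q3 by (intro mult_left_mono) auto
      finally show "2 * ((q\<^sup>2 - D t) * (v t * w t)) \<le> 2 * q * ?Y t" .
    qed
    also have "\<dots> \<le> ?Y T * 9"
    proof (rule mult_left_mono)
      have "2 * q * (u - T) \<le> 2 * q * (1 / q)" using uT q3 by (intro mult_left_mono) auto
      then have "2 * q * (u - T) \<le> 1 + 1" using q3 by simp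
      then have "exp (2 * q * (u - T)) \<le> exp 1 * exp 1" by (simp add: exp_add[symmetric])
      also have "\<dots> \<le> 3 * 3" using exp_le by (intro mult_mono) auto
      finally show "exp (2 * q * (u - T)) \<le> 9" by simp
    qed simp
    finally have "q\<^sup>2 * (v u)\<^sup>2 \<le> 9 * ?Y T" using zero_le_power2[of "w u"] by argo
    moreover have "1 / cosh u \<le> 3 / cosh T"
    proof -
      have "1 / q \<le> 1" using q3 by simp
      with uT have "exp (u - T) \<le> exp 1" by simp
      then have "exp (u - T) \<le> 3" using exp_le by linarith
      then have "exp (u - T) * cosh u \<le> 3 * cosh u" by (intro mult_right_mono) auto
      with cosh_growth(2)[OF u(1)] have "cosh T \<le> 3 * cosh u" by linarith
      then show ?thesis by (simp add: field_simps)
    qed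
    ultimately have "q\<^sup>2 * (v u)\<^sup>2 * (1 / cosh u) \<le> 9 * ?Y T * (3 / cosh T)"
      by (rule mult_mono) auto
    also have "\<dots> = 27 * (?Y T / cosh T)" by simp
    also have "\<dots> \<le> 27 * (B * q\<^sup>2)" by (rule mult_left_mono[OF energy[unfolded q2]]) simp
    finally have "q\<^sup>2 * ((v u)\<^sup>2 / cosh u) \<le> q\<^sup>2 * (27 * B)" by (simp add: mult_ac)
    then show ?thesis using q3 by (subst (asm) mult_le_cancel_left_pos) auto
  qed
  show ?thesis
  proof (cases "t \<le> T1")
    case True then show ?thesis using near t by simp
  next
    case False
    then have "(v t)\<^sup>2 / cosh t \<le> (v T1)\<^sup>2 / cosh T1"
      using v_weight_antimono[OF lim _ _ order_refl, of T1 t] T T1 by simp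
    with near[of T1] T1 show ?thesis by simp
  qed
qed

text \<open>Needed so that cosh increases after T. If T < 0, then z >= 1 - m^2 >= r at T, so N^2 X z
  = D^(3/2) < 27 bounds (N X)^2 (N r)^2 by 27^2 = 729. But (N X)^2 = (N r)^2 - D >= 36 - 9, and 27 *
  36 > 729.\<close>

lemma transition_beyond_zero:
  assumes T: "t0 \<le> T" "D1 T = - 2 * sqrt (D T) ^ 3" and D0: "0 < D T" and D9: "D T < 9"
  shows "0 \<le> T"
proof (rule ccontr)
  assume "\<not> 0 \<le> T"
  define X where "X = tanh T - m"
  have x0: "tanh T < 0" using \<open>\<not> 0 \<le> T\<close> by simp
  have X: "0 \<le> X" using tanh_ge[OF T(1)] by (simp add: X_def)
  have "(tanh T)\<^sup>2 \<le> m\<^sup>2" using x0 tanh_ge[OF T(1)] by (simp add: abs_le_square_iff[symmetric])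
  moreover have "1 - m\<^sup>2 \<ge> r"
  proof -
    have "\<bar>m\<bar> * \<bar>m\<bar> \<le> \<bar>m\<bar> * 1" using r_le r_pos by (intro mult_left_mono) auto
    then show ?thesis using r_le by (simp add: power2_eq_square)
  qed
  ultimately have zr: "z T \<ge> r" by (simp add: z_def)
  have "N\<^sup>2 * X * z T = sqrt (D T) ^ 3" using T(2) by (simp add: D1_def X_def)
  then have "(N\<^sup>2 * X * z T)\<^sup>2 = ((sqrt (D T))\<^sup>2) ^ 3" by (simp flip: power_mult)
  also have "(sqrt (D T))\<^sup>2 = D T" using D0 by simp
  also have "D T ^ 3 < 9 ^ 3" using D9 D0 by (intro power_strict_mono) auto
  finally have 1: "(N\<^sup>2 * X * z T)\<^sup>2 < 729" by simp
  have "N\<^sup>2 * X * r \<le> N\<^sup>2 * X * z T" using zr X by (intro mult_left_mono) auto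
  then have "(N\<^sup>2 * X * r)\<^sup>2 \<le> (N\<^sup>2 * X * z T)\<^sup>2" using X r_pos by (intro power_mono) auto
  moreover have "(N\<^sup>2 * X * r)\<^sup>2 = (N * X)\<^sup>2 * (N * r)\<^sup>2" by (simp add: power2_eq_square)
  moreover have Nr2: "36 \<le> (N * r)\<^sup>2" using power_mono[OF Nr, of 2] by simp
  moreover have "27 \<le> (N * X)\<^sup>2"
    using D9 Nr2 by (simp add: D_def X_def[symmetric] power_mult_distrib right_diff_distrib)
  then have "27 * 36 \<le> (N * X)\<^sup>2 * (N * r)\<^sup>2" using Nr2 by (intro mult_mono) auto
  ultimately show False using 1 by simp
qed

text \<open>While D >= 0 the energy does not increase, so |v'| is bounded and v grows at most
  linearly, which cosh outweighs. After the zero of D, v^2 decreases and cosh increases.\<close>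

lemma gentle_turning_point:
  assumes lim: "(v \<longlongrightarrow> 0) at_top" and a: "a \<noteq> 0"
    and T: "t0 \<le> T" "0 \<le> T" and D0: "0 < D T" and D9: "D T < 9"
    and energy: "((w T)\<^sup>2 + D T * (v T)\<^sup>2) / cosh T \<le> B * D T" and t: "T \<le> t"
  shows "(v t)\<^sup>2 / cosh t \<le> 36 * B"
proof -
  define q where "q = sqrt (D T)"
  have q: "q > 0" "D T = q\<^sup>2" using D0 by (auto simp: q_def)
  have "q \<le> sqrt (3\<^sup>2)" unfolding q_def using D9 by (intro real_sqrt_le_mono) simp
  then have q3: "q \<le> 3" by simp
  let ?E = "\<lambda>t. (w t)\<^sup>2 + D t * (v t)\<^sup>2"
  define e where "e = sqrt (?E T)"
  have E0: "?E T \<ge> 0" using D0 by simp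
  have e0: "e \<ge> 0" "e\<^sup>2 = ?E T" using E0 by (auto simp: e_def)
  have near: "(v u)\<^sup>2 / cosh u \<le> 36 * B" if u: "T \<le> u" "D u \<ge> 0" for u
  proof -
    have wle: "\<bar>w x\<bar> \<le> e" if x: "T \<le> x" "x \<le> u" for x
    proof -
      have "?E x \<le> ?E T"
      proof (rule nonincreasing_on[OF x(1)])
        fix y assume y: "T \<le> y" "y \<le> x"
        show "(?E has_real_derivative D1 y * (v y)\<^sup>2) (at y)"
          by (auto intro!: derivative_eq_intros v w' dD simp: algebra_simps)
        show "D1 y * (v y)\<^sup>2 \<le> 0" using D1_nonpos[of y] T y by (simp add: mult_nonpos_nonneg)
      qed
      moreover have "D x \<ge> 0" using D_antimono[of x u] T x u by simp
      then have "D x * (v x)\<^sup>2 \<ge> 0" by simp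
      ultimately have "\<bar>w x\<bar>\<^sup>2 \<le> e\<^sup>2" using e0 by simp
      then show ?thesis by (rule power2_le_imp_le) (use e0 in simp)
    qed
    have "v u - e * u \<le> v T - e * T"
      by (rule nonincreasing_on[OF u(1), of "\<lambda>x. v x - e * x" "\<lambda>x. w x - e"])
        (use wle in \<open>auto intro!: derivative_eq_intros v simp: abs_le_iff\<close>)
    moreover have "- v u - e * u \<le> - v T - e * T"
      by (rule nonincreasing_on[OF u(1), of "\<lambda>x. - v x - e * x" "\<lambda>x. - w x - e"])
        (use wle in \<open>auto intro!: derivative_eq_intros v simp: abs_le_iff\<close>)
    ultimately have "\<bar>v u\<bar> \<le> \<bar>v T\<bar> + (e * u - e * T)" by (smt (verit))
    then have "\<bar>v u\<bar> \<le> \<bar>v T\<bar> + e * (u - T)" by (simp add: right_diff_distrib)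
    moreover have "q * \<bar>v T\<bar> \<le> e"
    proof (rule power2_le_imp_le)
      show "(q * \<bar>v T\<bar>)\<^sup>2 \<le> e\<^sup>2" unfolding e0(2) q(2) by (simp add: power_mult_distrib)
    qed (use e0 in simp)
    moreover have "q * (e * (u - T)) \<le> 3 * (e * (u - T))" using q3 e0 u by (intro mult_right_mono) auto
    ultimately have "q * \<bar>v u\<bar> \<le> e * (1 + 3 * (u - T))"
      using mult_left_mono[of "\<bar>v u\<bar>" "\<bar>v T\<bar> + e * (u - T)" q] q(1)
      by (simp add: algebra_simps)
    then have "(q * \<bar>v u\<bar>)\<^sup>2 \<le> (e * (1 + 3 * (u - T)))\<^sup>2" using q by (intro power_mono) auto
    then have vu: "q\<^sup>2 * (v u)\<^sup>2 \<le> ?E T * (1 + 3 * (u - T))\<^sup>2" by (simp add: power_mult_distrib e0(2))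
    have "(1 + 3 * (u - T))\<^sup>2 \<le> 18 * (1 + (u - T) + (u - T)\<^sup>2 / 2)"
    \<comment> \<open>18 is twice the coefficient 9 of d^2 on the left, to match d^2 / 2. Together
      with the factor 2 of \<open>cosh_growth(3)\<close> it gives 36.\<close>
    proof -
      have "18 * (1 + d + d\<^sup>2 / 2) = (1 + 3 * d)\<^sup>2 + (17 + 12 * d)" for d :: real
        by (simp add: power2_eq_square field_simps)
      from this[of "u - T"] show ?thesis using u by argo
    qed
    also have "\<dots> \<le> 18 * exp (u - T)" using exp_lower_Taylor_quadratic[of "u - T"] u by simp
    finally have "(1 + 3 * (u - T))\<^sup>2 \<le> 18 * exp (u - T)" .
    then have "(1 + 3 * (u - T))\<^sup>2 * cosh T \<le> 18 * exp (u - T) * cosh T" by (intro mult_right_mono) auto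
    also have "\<dots> = 18 * (exp (u - T) * cosh T)" by simp
    also have "\<dots> \<le> 18 * (2 * cosh u)" using cosh_growth(3)[OF u(1) T(2)] by (intro mult_left_mono) auto
    finally have "(1 + 3 * (u - T))\<^sup>2 / cosh u \<le> 36 / cosh T" by (simp add: field_simps)
    then have "?E T * ((1 + 3 * (u - T))\<^sup>2 / cosh u) \<le> ?E T * (36 / cosh T)"
      using E0 by (rule mult_left_mono)
    moreover have "q\<^sup>2 * (v u)\<^sup>2 / cosh u \<le> ?E T * (1 + 3 * (u - T))\<^sup>2 / cosh u"
      using vu by (intro divide_right_mono) auto
    moreover have "36 * (?E T / cosh T) \<le> 36 * (B * q\<^sup>2)"
      unfolding q(2)[symmetric] by (intro mult_left_mono energy) simp
    ultimately have "q\<^sup>2 * ((v u)\<^sup>2 / cosh u) \<le> q\<^sup>2 * (36 * B)" by (simp add: mult_ac)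
    then show ?thesis using q(1) by (subst (asm) mult_le_cancel_left_pos) auto
  qed
  show ?thesis
  proof (cases "D t \<ge> 0")
    case True then show ?thesis using near t by simp
  next
    case False
    then obtain T1 where T1: "T \<le> T1" "T1 \<le> t" "D T1 = 0"
      using IVT2[of D t 0 T] t D0 isCont_intros(1) by auto
    then have "(v t)\<^sup>2 \<le> (v T1)\<^sup>2"
      using v_antimono[OF lim _ _ order_refl, of T1 t] T by simp
    moreover have "cosh T1 \<le> cosh t" using T1 T by (simp add: cosh_real_nonneg_le_iff)
    ultimately have "(v t)\<^sup>2 / cosh t \<le> (v T1)\<^sup>2 / cosh T1" by (intro frac_le) auto
    with near[of T1] T1 show ?thesis by simp
  qed
qed

lemma bound_decaying:
  assumes lim: "(v \<longlongrightarrow> 0) at_top" and a: "a \<noteq> 0" and t: "t0 \<le> t"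
  shows "(v t)\<^sup>2 / cosh t \<le> 4320 * sqrt s"
proof -
  obtain T where T: "t0 \<le> T" "D1 T = - 2 * sqrt (D T) ^ 3"
    and pos: "\<And>t. t0 \<le> t \<Longrightarrow> t \<le> T \<Longrightarrow> D t > 0"
    and small: "\<And>t. t0 \<le> t \<Longrightarrow> t \<le> T \<Longrightarrow> (D1 t)\<^sup>2 \<le> 4 * D t ^ 3"
    using transition_point[OF a] by blast
  have s0: "sqrt s \<ge> 0" using s_ge by simp
  have energy: "((w T)\<^sup>2 + D T * (v T)\<^sup>2) / cosh T \<le> (120 * sqrt s) * D T"
    by (rule energy_weight_le[OF T(1) pos small])
  consider "t \<le> T" | "T \<le> t" "D T \<ge> 9" | "T \<le> t" "D T < 9" by linarith
  then show ?thesis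
  proof cases
    case 1
    have "(v t)\<^sup>2 / cosh t \<le> 120 * sqrt s"
      by (rule v_weight_le[OF t]) (use pos small 1 in auto)
    then show ?thesis using s0 by linarith
  next
    case 2
    have "(v t)\<^sup>2 / cosh t \<le> 27 * (120 * sqrt s)"
      by (rule sharp_turning_point[OF lim T 2(2) energy 2(1)])
    then show ?thesis using s0 by linarith
  next
    case 3
    have DT: "D T > 0" using pos T(1) by simp
    have "(v t)\<^sup>2 / cosh t \<le> 36 * (120 * sqrt s)"
      by (rule gentle_turning_point[OF lim a T(1) transition_beyond_zero[OF T DT 3(2)] DT 3(2) energy 3(1)])
    then show ?thesis by simp
  qed
qed

text \<open>In the angle \<theta> with |d\<theta>| = dt / cosh t, f = v / sqrt (cosh t) solves the
  trigonometric Jacobi equation f'' = - Q f. For a^2 <= 1/4 the part of Q singular at x = 1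
  increases with x, so Sonin's function is monotone up to that end; f^2 is F^2.\<close>

lemma bound_oscillating:
  assumes a: "a\<^sup>2 \<le> 1 / 4" and t: "t0 \<le> t"
    and edge': "N\<^sup>2 * ((1 + m)\<^sup>2 - r\<^sup>2) = b\<^sup>2"
  shows "(v t)\<^sup>2 / cosh t \<le> 4320 * sqrt s"
proof -
  \<comment> \<open>If b^2 < 1/4, the part of Q singular at x = -1 decreases. R has the same
    decreasing part, and lies between N^2 and 2 N^2 where this is needed.\<close>
  define \<gamma> where "\<gamma> = max 0 (1 / 4 - b\<^sup>2)"
  define f where "f t = v t / sqrt (cosh t)" for t
  define k where "k t = sqrt (cosh t) * (w t - v t * tanh t / 2)" for t
  define Q where "Q t = (D t + 1 / 4 + z t / 4) * (cosh t)\<^sup>2" for t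
  define Q1 where "Q1 t = (1 / 4 - a\<^sup>2) * (1 + tanh t) / (2 * (1 - tanh t))
    - (1 / 4 - b\<^sup>2) * (1 - tanh t) / (2 * (1 + tanh t))" for t
  define R where "R t = N\<^sup>2 + \<gamma> / (2 * (1 + tanh t))" for t
  define R1 where "R1 t = - \<gamma> * (1 - tanh t) / (2 * (1 + tanh t))" for t
  have x: "1 - tanh t > 0" "1 + tanh t > 0" for t :: real using tanh_real_bounds[of t] by auto
  have zf: "z t = (1 - tanh t) * (1 + tanh t)" for t by (simp add: z_def power2_eq_square algebra_simps)
  have DD: "D t = N\<^sup>2 * z t - a\<^sup>2 * (1 + tanh t) / 2 - b\<^sup>2 * (1 - tanh t) / 2" for t
    unfolding edge[symmetric] edge'[symmetric] D_def zf by (simp add: power2_eq_square field_simps)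
  have Q: "Q t = N\<^sup>2 + 1 / 4 + (1 / 4 - a\<^sup>2) / (2 * (1 - tanh t)) + (1 / 4 - b\<^sup>2) / (2 * (1 + tanh t))" for t
  proof -
    have "Q t = (D t + 1 / 4 + z t / 4) / z t" by (simp add: Q_def z_eq)
    also have "D t + 1 / 4 + z t / 4 = (N\<^sup>2 + 1 / 4) * z t
        + (1 / 4 - a\<^sup>2) * (1 + tanh t) / 2 + (1 / 4 - b\<^sup>2) * (1 - tanh t) / 2"
      unfolding DD by (simp add: field_simps)
    also have "(A * (p * q) + B * q / 2 + C * p / 2) / (p * q) = A + B / (2 * p) + C / (2 * q)"
      if "p > 0" "q > 0" for A B C p q :: real
      using that by (simp add: field_simps)
    note this[OF x[of t], folded zf]
    finally show ?thesis .
  qed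
  have dx: "((\<lambda>t. c / (2 * (1 - tanh t))) has_real_derivative c * (1 + tanh t) / (2 * (1 - tanh t))) (at t)"
    "((\<lambda>t. c / (2 * (1 + tanh t))) has_real_derivative - c * (1 - tanh t) / (2 * (1 + tanh t))) (at t)"
    for c t :: real
  proof -
    have *: "c * (2 * (p * q)) / ((2 * p) * (2 * p)) = c * q / (2 * p)" if "p > 0" for c p q :: real
      using that by (simp add: field_simps)
    show "((\<lambda>t. c / (2 * (1 - tanh t))) has_real_derivative c * (1 + tanh t) / (2 * (1 - tanh t))) (at t)"
      using *[OF x(1)[of t], of c "1 + tanh t"] zf[of t] x[of t]
      by (auto intro!: derivative_eq_intros simp: z_def power2_eq_square mult_ac)
    show "((\<lambda>t. c / (2 * (1 + tanh t))) has_real_derivative - c * (1 - tanh t) / (2 * (1 + tanh t))) (at t)"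
      using *[OF x(2)[of t], of "- c" "1 - tanh t"] zf[of t] x[of t]
      by (auto intro!: derivative_eq_intros simp: z_def power2_eq_square mult_ac)
  qed
  have dQ: "(Q has_real_derivative Q1 t) (at t)" for t
    using DERIV_add[OF DERIV_add[OF DERIV_const[of "N\<^sup>2 + 1 / 4"] dx(1)[of "1 / 4 - a\<^sup>2"]] dx(2)[of "1 / 4 - b\<^sup>2"]]
    unfolding Q[abs_def]
    by (rule DERIV_cong) (simp only: Q1_def mult_minus_left minus_divide_left add_0 diff_conv_add_uminus)
  have dR: "(R has_real_derivative R1 t) (at t)" for t
    using DERIV_add[OF DERIV_const[of "N\<^sup>2"] dx(2)[of \<gamma>]]
    unfolding R_def[abs_def] by (rule DERIV_cong) (simp add: R1_def)
  have dc: "((\<lambda>t. sqrt (cosh t)) has_real_derivative tanh t / 2 * sqrt (cosh t)) (at t)" for t :: real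
    using cosh_real_pos[of t] real_sqrt_mult_self[of "cosh t"]
    by (auto intro!: derivative_eq_intros simp: tanh_def field_simps simp del: real_sqrt_mult_self cosh_real_pos)
  have df: "(f has_real_derivative k t / cosh t) (at t)" for t
  proof -
    have "(f has_real_derivative (w t * sqrt (cosh t) - v t * (tanh t / 2 * sqrt (cosh t))) / (sqrt (cosh t) * sqrt (cosh t))) (at t)"
      unfolding f_def[abs_def] using cosh_real_pos[of t] by (intro DERIV_divide v dc) simp
    then show ?thesis by (rule DERIV_cong) (simp add: k_def algebra_simps)
  qed
  have dk: "(k has_real_derivative - (Q t / cosh t) * f t) (at t)" for t
  proof -
    have "((\<lambda>t. w t - v t * tanh t / 2) has_real_derivative - D t * v t - (w t * tanh t + v t * z t) / 2) (at t)"
      by (auto intro!: derivative_eq_intros v w' simp: z_def field_simps)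
    from DERIV_mult[OF dc this]
    have "(k has_real_derivative - sqrt (cosh t) * v t * (D t + 1 / 4 + z t / 4)) (at t)"
      unfolding k_def[abs_def] by (rule DERIV_cong) (simp add: z_def power2_eq_square field_simps)
    moreover have "- (Q t / cosh t) * f t = - ((cosh t / sqrt (cosh t)) * v t * (D t + 1 / 4 + z t / 4))"
      using cosh_real_pos[of t] by (simp add: Q_def f_def power2_eq_square)
    moreover have "cosh t / sqrt (cosh t) = sqrt (cosh t)" by (simp add: real_div_sqrt)
    ultimately show ?thesis by simp
  qed
  have Qpos: "Q t > 0" if "t0 \<le> t" for t
  proof -
    have "D t + 1 / 4 + z t / 4 > 0" using D_lower[OF that] a z_pos[of t] by linarith
    then show ?thesis by (simp add: Q_def)
  qed
  \<comment> \<open>The bounds on \<gamma> give R >= N^2 everywhere, and below R <= 2 N^2 at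
    \<open>t0\<close>, because N^2 (1 + m) >= (N r)^2 >= 36.\<close>
  have \<gamma>: "0 \<le> \<gamma>" "1 / 4 - b\<^sup>2 \<le> \<gamma>" "\<gamma> \<le> 1 / 4" by (simp_all add: \<gamma>_def max_def)
  have Rge: "R t \<ge> N\<^sup>2" for t using \<gamma> x[of t] by (simp add: R_def)
  have "((f t)\<^sup>2 + (k t)\<^sup>2 / Q t) * R t \<le> ((f t0)\<^sup>2 + (k t0)\<^sup>2 / Q t0) * R t0"
  proof (rule sonin_le[OF t df dk dQ dR])
    fix u
    show "R u \<ge> 0" using Rge[of u] by (meson order_trans zero_le_power2)
    show "R1 u \<le> 0" using \<gamma> x[of u] by (simp add: R1_def)
    have "(1 / 4 - b\<^sup>2) * (1 - tanh u) / (2 * (1 + tanh u)) \<le> \<gamma> * (1 - tanh u) / (2 * (1 + tanh u))"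
      using \<gamma> x[of u] by (intro divide_right_mono mult_right_mono) auto
    moreover have "(1 / 4 - a\<^sup>2) * (1 + tanh u) / (2 * (1 - tanh u)) \<ge> 0" using a x[of u] by simp
    ultimately show "R1 u \<le> Q1 u" by (simp add: R1_def Q1_def)
    assume u: "t0 \<le> u" "u \<le> t"
    show "Q u > 0" using Qpos u by simp
    show "R1 u = 0 \<or> R u \<le> Q u"
    proof (cases "1 / 4 - b\<^sup>2 \<ge> 0")
      case True
      then have "\<gamma> = 1 / 4 - b\<^sup>2" by (simp add: \<gamma>_def)
      moreover have "(1 / 4 - a\<^sup>2) / (2 * (1 - tanh u)) \<ge> 0" using a x[of u] by simp
      ultimately have "R u \<le> Q u" by (simp add: R_def Q)
      then show ?thesis ..
    qed (simp add: R1_def \<gamma>_def)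
  qed
  moreover have "(f t0)\<^sup>2 + (k t0)\<^sup>2 / Q t0 \<le> 240 * sqrt s"
  proof -
    have D0: "D t0 = (N * r)\<^sup>2" by (simp add: D_def tanh_t0 power_mult_distrib)
    then have D36: "D t0 \<ge> 36" using power_mono[OF Nr, of 2] by simp
    have E: "((w t0)\<^sup>2 + D t0 * (v t0)\<^sup>2) / cosh t0 \<le> 120 * sqrt s * D t0"
      by (rule energy_weight_le) (use D36 in \<open>auto simp: D1_def tanh_t0 antisym\<close>)
    have "(k t0)\<^sup>2 / Q t0 = (w t0 - v t0 * m / 2)\<^sup>2 / (D t0 + 1 / 4 + z t0 / 4) / cosh t0"
      by (simp add: k_def Q_def power_mult_distrib tanh_t0) (simp add: power2_eq_square)
    also have "\<dots> \<le> (2 * (w t0)\<^sup>2 + (v t0)\<^sup>2) / D t0 / cosh t0"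
    proof -
      have "m\<^sup>2 \<le> 1" using r_le r_pos by (simp add: abs_square_le_1)
      then have "(v t0)\<^sup>2 * m\<^sup>2 \<le> (v t0)\<^sup>2 * 1" by (intro mult_left_mono) auto
      moreover have "(w t0 - v t0 * m / 2)\<^sup>2 + (w t0 + v t0 * m / 2)\<^sup>2 = 2 * (w t0)\<^sup>2 + (v t0)\<^sup>2 * m\<^sup>2 / 2"
        by (simp add: power2_eq_square algebra_simps)
      ultimately have "(w t0 - v t0 * m / 2)\<^sup>2 \<le> 2 * (w t0)\<^sup>2 + (v t0)\<^sup>2"
        using zero_le_power2[of "w t0 + v t0 * m / 2"] zero_le_power2[of "v t0"] by argo
      then show ?thesis using D36 z_pos[of t0] by (intro divide_right_mono frac_le) auto
    qed
    finally have "(f t0)\<^sup>2 + (k t0)\<^sup>2 / Q t0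
        \<le> (v t0)\<^sup>2 / cosh t0 + (2 * (w t0)\<^sup>2 + (v t0)\<^sup>2) / D t0 / cosh t0"
      by (simp add: f_def power_divide)
    also have "\<dots> = ((D t0 + 1) * (v t0)\<^sup>2 + 2 * (w t0)\<^sup>2) / (D t0 * cosh t0)"
      using D36 by (simp add: field_simps)
    also have "\<dots> \<le> (2 * ((w t0)\<^sup>2 + D t0 * (v t0)\<^sup>2)) / (D t0 * cosh t0)"
    proof (rule divide_right_mono)
      have "1 * (v t0)\<^sup>2 \<le> D t0 * (v t0)\<^sup>2" using D36 by (intro mult_right_mono) auto
      then show "(D t0 + 1) * (v t0)\<^sup>2 + 2 * (w t0)\<^sup>2 \<le> 2 * ((w t0)\<^sup>2 + D t0 * (v t0)\<^sup>2)"
        by (simp add: algebra_simps)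
    qed (use D36 in simp)
    also have "\<dots> = 2 * (((w t0)\<^sup>2 + D t0 * (v t0)\<^sup>2) / cosh t0) / D t0" by simp
    also have "\<dots> \<le> 2 * (120 * sqrt s * D t0) / D t0"
      using E D36 by (intro divide_right_mono mult_left_mono) auto
    also have "\<dots> = 240 * sqrt s" using D36 by simp
    finally show ?thesis .
  qed
  moreover have "R t0 \<le> 2 * N\<^sup>2"
  proof -
    have m: "r \<le> 1 + m" using r_le by linarith
    have "6\<^sup>2 \<le> (N * r)\<^sup>2" using Nr by (intro power_mono) auto
    also have "\<dots> = N\<^sup>2 * r * r" by (simp add: power2_eq_square)
    also have "\<dots> \<le> N\<^sup>2 * (1 + m) * 1" using m r_le r_pos by (intro mult_mono) auto
    finally have "36 \<le> N\<^sup>2 * (1 + m)" by simp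
    moreover have "\<gamma> \<le> 1" using \<gamma> by simp
    ultimately have "\<gamma> \<le> N\<^sup>2 * (2 * (1 + m))" by linarith
    then show ?thesis using m r_pos by (simp add: R_def tanh_t0 divide_le_eq)
  qed
  ultimately have "((f t)\<^sup>2 + (k t)\<^sup>2 / Q t) * R t \<le> 240 * sqrt s * (2 * N\<^sup>2)"
    using Rge[of t0] s_ge by (smt (verit) mult_mono real_sqrt_ge_zero zero_le_power2 mult_nonneg_nonneg)
  moreover have "(f t)\<^sup>2 * N\<^sup>2 \<le> ((f t)\<^sup>2 + (k t)\<^sup>2 / Q t) * R t"
    using Rge[of t] Qpos[OF t] by (intro mult_mono) (auto intro: add_nonneg_nonneg)
  ultimately have "N\<^sup>2 * (f t)\<^sup>2 \<le> N\<^sup>2 * (480 * sqrt s)" by (simp add: mult_ac)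
  then have "(f t)\<^sup>2 \<le> 480 * sqrt s" using N_pos by (subst (asm) mult_le_cancel_left_pos) auto
  then have "(v t)\<^sup>2 / cosh t \<le> 480 * sqrt s" by (simp add: f_def power_divide)
  moreover have "sqrt s \<ge> 0" using s_ge by simp
  ultimately show ?thesis by linarith
qed

end

section \<open>Bounds for large degree\<close>

lemma powr_half_sq:
  fixes y c :: real
  assumes "y > 0"
  shows "(y powr (c / 2))\<^sup>2 = y powr c"
  using assms by (simp add: power2_eq_square flip: powr_add)

lemma jacobi_F_open_sq:
  assumes "-1 < x" "x < 1"
  shows "(jacobi_F_open \<alpha> \<beta> p x)\<^sup>2 = sqrt (1 - x\<^sup>2) * jacobi_weight \<alpha> \<beta> x * (poly p x)\<^sup>2"
proof -
  have "1 - x\<^sup>2 > 0" using assms by (simp add: abs_square_less_1)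
  then have "((1 - x\<^sup>2) powr (1 / 4))\<^sup>2 = sqrt (1 - x\<^sup>2)"
    using powr_half_sq[of "1 - x\<^sup>2" "1 / 2"] by (simp add: powr_half_sqrt)
  moreover have "(jacobi_weight \<alpha> \<beta> x powr (1 / 2))\<^sup>2 = jacobi_weight \<alpha> \<beta> x"
    using powr_half_sq[of "jacobi_weight \<alpha> \<beta> x" 1] assms by (simp add: jacobi_weight_def)
  ultimately show ?thesis by (simp add: jacobi_F_open_def power_mult_distrib)
qed

context jacobi_eigenpoly
begin

definition \<rho> where "\<rho> x = (1 - x) powr (\<alpha> / 2) * (1 + x) powr (\<beta> / 2)"

lemma \<rho>_sq: "-1 < x \<Longrightarrow> x < 1 \<Longrightarrow> (\<rho> x)\<^sup>2 = jacobi_weight \<alpha> \<beta> x"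
  by (simp add: \<rho>_def jacobi_weight_def power_mult_distrib powr_half_sq)

text \<open>\<rho> has logarithmic t-derivative (\<beta> - \<alpha> - (\<alpha> + \<beta>) x) / 2.
  Applied to p this gives v' through K, and applied to K it gives v''.\<close>

lemma deriv_\<rho>_poly:
  "((\<lambda>t. \<rho> (tanh t) * poly q (tanh t)) has_real_derivative \<rho> (tanh t) *
     ((1 - (tanh t)\<^sup>2) * poly (pderiv q) (tanh t) + (\<beta> - \<alpha> - (\<alpha> + \<beta>) * tanh t) / 2 * poly q (tanh t))) (at t)"
proof -
  have x: "1 - tanh t > 0" "1 + tanh t > 0" using tanh_real_bounds[of t] by auto
  have dtanh: "(tanh has_real_derivative 1 - (tanh t)\<^sup>2) (at t)"
    by (auto intro!: derivative_eq_intros)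
  have fz: "1 - (tanh t)\<^sup>2 = (1 - tanh t) * (1 + tanh t)" by (simp add: power2_eq_square algebra_simps)
  have "((\<lambda>t. (1 - tanh t) powr c) has_real_derivative - c * (1 + tanh t) * (1 - tanh t) powr c) (at t)" for c
  proof -
    have "((\<lambda>t. (1 - tanh t) powr c) has_real_derivative c * (1 - tanh t) powr (c - 1) * (0 - (1 - (tanh t)\<^sup>2))) (at t)"
      using DERIV_fun_powr[OF DERIV_diff[OF DERIV_const dtanh] x(1), of c] by simp
    then show ?thesis unfolding fz using x by (simp add: powr_diff mult_ac)
  qed
  note d1 = this[of "\<alpha> / 2"]
  have "((\<lambda>t. (1 + tanh t) powr c) has_real_derivative c * (1 - tanh t) * (1 + tanh t) powr c) (at t)" for c
  proof -
    have "((\<lambda>t. (1 + tanh t) powr c) has_real_derivative c * (1 + tanh t) powr (c - 1) * (0 + (1 - (tanh t)\<^sup>2))) (at t)"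
      using DERIV_fun_powr[OF DERIV_add[OF DERIV_const dtanh] x(2), of c] by simp
    then show ?thesis unfolding fz using x by (simp add: powr_diff mult_ac)
  qed
  note d2 = this[of "\<beta> / 2"]
  have "((\<lambda>t. poly q (tanh t)) has_real_derivative poly (pderiv q) (tanh t) * (1 - (tanh t)\<^sup>2)) (at t)"
    by (rule DERIV_chain2[OF poly_DERIV dtanh])
  from DERIV_mult[OF DERIV_mult[OF d1 d2] this] show ?thesis
    unfolding \<rho>_def by (rule DERIV_cong) (simp add: field_simps)
qed

text \<open>Reflection maps m to - m, so bounds to the right of m also serve on the left; for small
  degree it allows assuming \<alpha> <= \<beta>.\<close>

lemma reflected: "jacobi_eigenpoly \<beta> \<alpha> n (p \<circ>\<^sub>p [:0, -1:])"
proof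
  have "poly (jacobi_op \<beta> \<alpha> (p \<circ>\<^sub>p [:0, -1:])) x =
      poly (smult (- (n * (n + \<beta> + \<alpha> + 1))) (p \<circ>\<^sub>p [:0, -1:])) x" for x
    using eigen_poly[of "- x"]
    by (simp add: jacobi_op_def poly_jacobi_div pderiv_pcompose pderiv_mult pderiv_minus pderiv_pCons poly_pcompose algebra_simps)
  then show "jacobi_op \<beta> \<alpha> (p \<circ>\<^sub>p [:0, -1:]) = smult (- (n * (n + \<beta> + \<alpha> + 1))) (p \<circ>\<^sub>p [:0, -1:])"
    by (simp add: poly_eq_poly_eq_iff[symmetric] fun_eq_iff)
  have "((\<lambda>x. poly p x * poly p x * jacobi_weight \<alpha> \<beta> x) has_integral 1) {-1..1}"
    using jacobi_inner_has_integral[OF alpha_gt beta_gt, of p p] normalized by simp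
  then have "((\<lambda>x. poly p (- x) * poly p (- x) * jacobi_weight \<alpha> \<beta> (- x)) has_integral 1) {-1..1}"
    using has_integral_reflect_real[of "\<lambda>x. poly p x * poly p x * jacobi_weight \<alpha> \<beta> x" 1 1 "-1"] by simp
  moreover have "((\<lambda>x. poly p (- x) * poly p (- x) * jacobi_weight \<alpha> \<beta> (- x)) has_integral
      jacobi_inner \<beta> \<alpha> (p \<circ>\<^sub>p [:0, -1:]) (p \<circ>\<^sub>p [:0, -1:])) {-1..1}"
    using jacobi_inner_has_integral[OF beta_gt alpha_gt, of "p \<circ>\<^sub>p [:0, -1:]" "p \<circ>\<^sub>p [:0, -1:]"]
    by (simp add: poly_pcompose jacobi_weight_def mult_ac)
  ultimately show "jacobi_inner \<beta> \<alpha> (p \<circ>\<^sub>p [:0, -1:]) (p \<circ>\<^sub>p [:0, -1:]) = 1"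
    using has_integral_unique by blast
qed (use alpha_ge beta_ge in auto)

end

lemma jacobi_F_open_reflect: "jacobi_F_open \<beta> \<alpha> (p \<circ>\<^sub>p [:0, -1:]) (- x) = jacobi_F_open \<alpha> \<beta> p x"
  by (simp add: jacobi_F_open_def jacobi_weight_def poly_pcompose mult_ac)

context jacobi_eigenpoly_large
begin

lemma bound_right:
  assumes "m \<le> x" "x < 1"
  shows "(jacobi_F_open \<alpha> \<beta> p x)\<^sup>2 \<le> 4320 * sqrt s"
proof -
  have m1: "-1 < m" "m < 1" using r_le r_pos by auto
  obtain t0 where t0: "tanh t0 = m" using tanh_surj_on_unit[OF m1] by blast
  have x1: "-1 < x" using assms m1 by simp
  obtain t where t: "tanh t = x" using tanh_surj_on_unit[OF x1 assms(2)] by blast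
  define v where "v t = \<rho> (tanh t) * poly p (tanh t)" for t
  define w where "w t = \<rho> (tanh t) * poly K (tanh t)" for t
  interpret T: tanh_oscillator N r m s \<alpha> t0 v w
  proof
    show "\<bar>\<alpha>\<bar> \<le> 2 * s" using abs_le by linarith
    show "(v has_real_derivative w t) (at t)" for t
      using deriv_\<rho>_poly[of p t] unfolding v_def[abs_def] w_def poly_K .
    show "(w has_real_derivative - (N\<^sup>2 * (r\<^sup>2 - (tanh t - m)\<^sup>2)) * v t) (at t)" for t
      using deriv_\<rho>_poly[of K t] unfolding w_def[abs_def] v_def poly_pderiv_K D_eq
      by (simp add: mult_ac)
    show "(w t0)\<^sup>2 + (N * r)\<^sup>2 * (v t0)\<^sup>2 \<le> 4 * N\<^sup>2 * r"
      using energy_at_m by (simp add: v_def w_def t0 power_mult_distrib \<rho>_sq[OF m1] algebra_simps)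
  qed (use N_ge r_parameters s_ge t0 in auto)
  have tt: "t0 \<le> t" using assms t t0 by (metis tanh_real_le_iff)
  have "(v t)\<^sup>2 / cosh t \<le> 4320 * sqrt s"
  \<comment> \<open>Sonin's function requires \<alpha>^2 <= 1/4, and the decay argument requires
    that v tends to 0, which holds for positive \<alpha>.\<close>
  proof (cases "\<alpha> \<le> 1 / 2")
    case True
    then have "\<bar>\<alpha>\<bar>\<^sup>2 \<le> (1 / 2)\<^sup>2" using alpha_ge by (intro power_mono) auto
    then have "\<alpha>\<^sup>2 \<le> 1 / 4" by (simp add: power2_eq_square)
    moreover have "N\<^sup>2 * ((1 + m)\<^sup>2 - r\<^sup>2) = \<beta>\<^sup>2"
      using edge N2_m by (simp add: power2_eq_square algebra_simps)
    ultimately show ?thesis using T.bound_oscillating[OF _ tt] by blast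
  next
    case False
    have "((\<lambda>t. 1 - tanh t) \<longlongrightarrow> 1 - 1) (at_top :: real filter)"
      by (intro tendsto_intros tanh_real_at_top)
    then have "((\<lambda>t. (1 - tanh t) powr (\<alpha> / 2)) \<longlongrightarrow> 0) (at_top :: real filter)"
      using False tanh_real_lt_1 by (intro tendsto_zero_powrI[of _ _ _ "\<alpha> / 2"]) (auto simp: less_imp_le)
    moreover have "((\<lambda>t. (1 + tanh t) powr (\<beta> / 2) * poly p (tanh t)) \<longlongrightarrow> (1 + 1) powr (\<beta> / 2) * poly p 1) (at_top :: real filter)"
      by (intro tendsto_intros tanh_real_at_top) auto
    ultimately have "((\<lambda>t. (1 - tanh t) powr (\<alpha> / 2) * ((1 + tanh t) powr (\<beta> / 2) * poly p (tanh t)))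
        \<longlongrightarrow> 0 * ((1 + 1) powr (\<beta> / 2) * poly p 1)) (at_top :: real filter)"
      by (rule tendsto_mult)
    then have "(v \<longlongrightarrow> 0) at_top" by (simp add: v_def[abs_def] \<rho>_def mult.assoc)
    then show ?thesis by (rule T.bound_decaying[OF _ _ tt]) (use False in auto)
  qed
  also have "(v t)\<^sup>2 / cosh t = (jacobi_F_open \<alpha> \<beta> p x)\<^sup>2"
  proof -
    have "sqrt (1 - x\<^sup>2) = 1 / cosh t" using T.sqrt_z[of t] by (simp add: T.z_def t)
    then show ?thesis
      unfolding jacobi_F_open_sq[OF x1 assms(2)] by (simp add: v_def t power_mult_distrib \<rho>_sq[OF x1 assms(2)])
  qed
  finally show ?thesis .
qed

lemma reflected_large: "jacobi_eigenpoly_large \<beta> \<alpha> n (p \<circ>\<^sub>p [:0, -1:])"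
  using reflected n_ge by (simp add: jacobi_eigenpoly_large_def jacobi_eigenpoly_large_axioms_def)

lemma bound_large:
  assumes "-1 < x" "x < 1"
  shows "(jacobi_F_open \<alpha> \<beta> p x)\<^sup>2 \<le> 4320 * sqrt s"
proof (cases "m \<le> x")
  case True then show ?thesis using bound_right assms by simp
next
  case False
  interpret R: jacobi_eigenpoly_large \<beta> \<alpha> n "p \<circ>\<^sub>p [:0, -1:]" by (rule reflected_large)
  have "R.\<nu> = \<nu>" by (simp add: R.\<nu>_def \<nu>_def add.commute)
  then have "R.m = - m" by (simp add: R.m_def m_def minus_divide_left)
  then have "R.m \<le> - x" using False by simp
  moreover have "R.s = s" by (simp add: R.s_def s_def add.commute)
  ultimately show ?thesis using R.bound_right[of "- x"] assms by (simp add: jacobi_F_open_reflect)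
qed

end

section \<open>Bounds for small degree\<close>

definition log_weight :: "real \<Rightarrow> real \<Rightarrow> real \<Rightarrow> real" where
  "log_weight A B x = A * ln (1 - x) + B * ln (1 + x)"

text \<open>Concavity of the two logarithms in tangent form, from ln u <= u - 1.\<close>

lemma log_weight_tangent:
  assumes "A \<ge> 0" "B \<ge> 0" "-1 < x" "x < 1" "-1 < y" "y < 1"
  shows "log_weight A B x \<le> log_weight A B y + (x - y) * (B / (1 + y) - A / (1 - y))"
proof -
  have "ln (1 - x) - ln (1 - y) \<le> (1 - x) / (1 - y) - 1"
    using ln_le_minus_one[of "(1 - x) / (1 - y)"] assms by (simp add: ln_div)
  then have "A * (ln (1 - x) - ln (1 - y)) \<le> A * ((y - x) / (1 - y))"
    using assms by (intro mult_left_mono) (auto simp: field_simps)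
  moreover have "ln (1 + x) - ln (1 + y) \<le> (1 + x) / (1 + y) - 1"
    using ln_le_minus_one[of "(1 + x) / (1 + y)"] assms by (simp add: ln_div)
  then have "B * (ln (1 + x) - ln (1 + y)) \<le> B * ((x - y) / (1 + y))"
    using assms by (intro mult_left_mono) (auto simp: field_simps)
  ultimately show ?thesis
    by (simp add: log_weight_def algebra_simps diff_divide_distrib)
qed

lemma log_weight_quasiconcave:
  assumes "A \<ge> 0" "B \<ge> 0" "-1 < x" "x \<le> z" "z \<le> y" "y < 1"
  shows "min (log_weight A B x) (log_weight A B y) \<le> log_weight A B z"
proof (cases "B / (1 + z) - A / (1 - z) \<ge> 0")
  case True
  then have "(x - z) * (B / (1 + z) - A / (1 - z)) \<le> 0" using assms by (intro mult_nonpos_nonneg) auto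
  then show ?thesis using log_weight_tangent[of A B x z] assms by simp
next
  case False
  then have "(y - z) * (B / (1 + z) - A / (1 - z)) \<le> 0" using assms by (intro mult_nonneg_nonpos) auto
  then show ?thesis using log_weight_tangent[of A B y z] assms by simp
qed

text \<open>For \<open>A \<le> B\<close> the maximum of \<open>(1 - x)\<^sup>A (1 + x)\<^sup>B\<close> is essentially attained on an interval which has length
  of order \<open>(A + B)\<^sup>-\<^sup>1\<^sup>/\<^sup>2\<close> in the angle \<open>arccos x\<close>.\<close>

lemma log_weight_plateau:
  assumes A: "0 \<le> A" "A \<le> B" and s: "1 \<le> s" "A + B \<le> s"
  obtains y1 y2 c where "-1 < y1" "y1 < y2" "y2 < 1" "0 \<le> c" "exp c \<le> 64"
    "\<And>x y. -1 < x \<Longrightarrow> x < 1 \<Longrightarrow> y1 \<le> y \<Longrightarrow> y \<le> y2 \<Longrightarrow> log_weight A B x \<le> log_weight A B y + c"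
    "2 * sqrt (2 * (1 - y1)) / (y2 - y1) \<le> 7 * sqrt s"
proof -
  define S where "S = A + B"
  have e9: "exp 2 \<le> (64::real)"
  proof -
    have "exp (1 + 1) = exp 1 * exp (1::real)" by (simp only: exp_add)
    also have "\<dots> \<le> 3 * 3" using exp_le by (intro mult_mono) auto
    finally show ?thesis by simp
  qed
  have sS: "sqrt S \<le> sqrt s" using s by (simp add: S_def)
  consider "B < 2" | "B \<ge> 2" "A \<ge> 1 / 2" | "B \<ge> 2" "A < 1 / 2" by linarith
  then show thesis
  proof cases
    \<comment> \<open>Both exponents are below 2, so a fixed interval serves: the weight is at most
      2^4 everywhere and at least 2^(-2) on it, which gives c = 6 ln 2.\<close>
    case 1
    show thesis
    proof (rule that[of "- 1 / 2" 0 "6 * ln 2"])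
      have "exp (6 * ln 2) = (2 powr 6 :: real)" by (simp add: powr_def)
      then show "exp (6 * ln 2) \<le> (64::real)" by simp
      show "2 * sqrt (2 * (1 - - 1 / 2)) / (0 - - 1 / 2) \<le> 7 * sqrt s"
      proof -
        have "sqrt 3 \<le> 7 / 4" by (rule real_le_lsqrt) (simp_all add: power2_eq_square)
        moreover have "1 \<le> sqrt s" using s by simp
        ultimately have "4 * sqrt 3 \<le> 7 * sqrt s" by linarith
        then show ?thesis by simp
      qed
      fix x y :: real assume x: "-1 < x" "x < 1" and y: "- 1 / 2 \<le> y" "y \<le> 0"
      have "A * ln (1 - x) \<le> A * ln 2" "B * ln (1 + x) \<le> B * ln 2"
        using A x by (auto intro!: mult_left_mono)
      moreover have "(A + B) * ln 2 \<le> 4 * ln 2" using A 1 by (intro mult_right_mono) auto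
      ultimately have 1: "log_weight A B x \<le> 4 * ln 2" by (simp add: log_weight_def algebra_simps)
      have "A * ln (1 - y) \<ge> 0" using A y by simp
      moreover have "ln (1 / 2) \<le> ln (1 + y)" using y by (subst ln_le_cancel_iff) auto
      then have "B * (- ln 2) \<le> B * ln (1 + y)" using A by (intro mult_left_mono) (auto simp: ln_div)
      then have "- (B * ln 2) \<le> B * ln (1 + y)" by simp
      moreover have "B * ln 2 \<le> 2 * ln 2" using \<open>B < 2\<close> by (intro mult_right_mono) auto
      ultimately have "log_weight A B y \<ge> - (2 * ln 2)" unfolding log_weight_def by argo
      with 1 show "log_weight A B x \<le> log_weight A B y + 6 * ln 2" by simp
    qed auto
  next
    case 2
    \<comment> \<open>x0 is the critical point. With d as half-width scale, h = (x0 - y) S satisfies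
      h^2 <= 2 A, so that both second-order losses h^2 / (4 A) and h^2 / (2 B) are at most 1, while
      the first-order terms cancel.\<close>
    define x0 where "x0 = (B - A) / S"
    define d where "d = sqrt (2 * A) / S"
    have S: "S \<ge> 5 / 2" using 2 by (simp add: S_def)
    have x0: "1 - x0 = 2 * A / S" "1 + x0 = 2 * B / S" using S by (simp_all add: x0_def S_def field_simps)
    have x0_nonneg: "0 \<le> x0" using A S by (simp add: x0_def)
    have x01: "x0 < 1" using x0(1) 2 S by (smt (verit) divide_pos_pos)
    have dS: "d * S = sqrt (2 * A)" using S by (simp add: d_def)
    have d0: "d > 0" using 2 S by (simp add: d_def)
    have d2: "(d * S)\<^sup>2 = 2 * A" using 2 by (simp add: dS)
    have dS1: "1 \<le> d * S" using 2 by (simp add: dS)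
    have d1: "d < 1"
    proof (rule power_less_imp_less_base)
      have "d\<^sup>2 * S\<^sup>2 \<le> 1 * S" using d2 A by (simp add: power_mult_distrib S_def)
      also have "\<dots> < 1 * S\<^sup>2" using S by (simp add: power2_eq_square)
      finally show "d\<^sup>2 < 1\<^sup>2" using S by (simp only: mult_less_cancel_right) simp
    qed simp
    show thesis
    proof (rule that[of "x0 - d" x0 2])
      show "-1 < x0 - d" "x0 - d < x0" "x0 < 1" using x0_nonneg d1 d0 x01 by auto
      have "1 - x0 = S * d\<^sup>2" using d2 S by (simp add: x0(1) field_simps power2_eq_square)
      moreover have "d * 1 \<le> d * (d * S)" using dS1 d0 by (intro mult_left_mono) auto
      ultimately have "2 * (1 - (x0 - d)) \<le> (2 * d)\<^sup>2 * S" by (simp add: power2_eq_square algebra_simps)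
      then have "sqrt (2 * (1 - (x0 - d))) \<le> sqrt ((2 * d)\<^sup>2 * S)" by (rule real_sqrt_le_mono)
      also have "\<dots> = 2 * d * sqrt S" using d0 by (simp add: real_sqrt_mult)
      finally have "2 * sqrt (2 * (1 - (x0 - d))) / d \<le> 2 * (2 * d * sqrt S) / d"
        using d0 by (intro divide_right_mono) auto
      also have "\<dots> = 4 * sqrt S" using d0 by simp
      also have "\<dots> \<le> 7 * sqrt s" using sS real_sqrt_ge_zero[of S] S by linarith
      finally show "2 * sqrt (2 * (1 - (x0 - d))) / (x0 - (x0 - d)) \<le> 7 * sqrt s" by simp
      fix x y :: real assume x: "-1 < x" "x < 1" and y: "x0 - d \<le> y" "y \<le> x0"
      have "B / (1 + x0) - A / (1 - x0) = 0" using 2 S unfolding x0 by simp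
      then have Lx: "log_weight A B x \<le> log_weight A B x0"
        using log_weight_tangent[of A B x x0] A x x0_nonneg x01 by simp
      define h where "h = (x0 - y) * S"
      have h: "0 \<le> h" "h \<le> d * S" using y S by (auto simp: h_def mult_right_mono)
      have h2: "h\<^sup>2 \<le> 2 * A" using power_mono[OF h(2,1), of 2] d2 by simp
      have Apos: "A > 0" "B > 0" using 2 by auto
      have "h / S = x0 - y" using S by (simp add: h_def)
      moreover have "2 * A / S * (1 + h / (2 * A)) = 2 * A / S + h / S"
        "2 * B / S * (1 - h / (2 * B)) = 2 * B / S - h / S"
        using Apos S by (simp_all add: field_simps)
      ultimately have y12: "1 - y = (1 - x0) * (1 + h / (2 * A))" "1 + y = (1 + x0) * (1 - h / (2 * B))"
        unfolding x0(1)[symmetric] x0(2)[symmetric] by simp_all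
      have hA: "h / (2 * A) \<le> 1"
      proof -
        have "h\<^sup>2 \<le> (2 * A)\<^sup>2" 
        proof -
          have "2 * A * 1 \<le> 2 * A * (2 * A)" using 2 by (intro mult_left_mono) auto
          with h2 show ?thesis by (simp add: power2_eq_square)
        qed
        then have "h \<le> 2 * A" by (rule power2_le_imp_le) (use Apos in simp)
        then show ?thesis using Apos by simp
      qed
      have hB: "h / (2 * B) \<le> 1 / 2"
      proof -
        have "h\<^sup>2 \<le> B\<^sup>2" 
        proof -
          have "2 * B \<le> B * B" using 2 by (intro mult_right_mono) auto
          with h2 A show ?thesis by (simp add: power2_eq_square)
        qed
        then have "h \<le> B" by (rule power2_le_imp_le) (use Apos in simp)
        then show ?thesis using Apos by simp
      qed
      have hA0: "0 \<le> h / (2 * A)" using h Apos by simp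
      have "ln (1 - y) = ln (1 - x0) + ln (1 + h / (2 * A))"
        unfolding y12(1) by (rule ln_mult_pos) (use x01 hA0 in linarith)+
      moreover have "ln (1 + y) = ln (1 + x0) + ln (1 - h / (2 * B))"
        unfolding y12(2) by (rule ln_mult_pos) (use x0_nonneg hB in linarith)+
      ultimately have L: "log_weight A B y = log_weight A B x0 + A * ln (1 + h / (2 * A)) + B * ln (1 - h / (2 * B))"
        by (simp add: log_weight_def distrib_left)
      have "A * (h / (2 * A) - (h / (2 * A))\<^sup>2) \<le> A * ln (1 + h / (2 * A))"
        using h hA Apos by (intro mult_left_mono ln_one_plus_pos_lower_bound) auto
      moreover have "B * (- (h / (2 * B)) - 2 * (h / (2 * B))\<^sup>2) \<le> B * ln (1 - h / (2 * B))"
        using h hB Apos by (intro mult_left_mono ln_one_minus_pos_lower_bound) auto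
      moreover have "A * (h / (2 * A) - (h / (2 * A))\<^sup>2) = h / 2 - h\<^sup>2 / (4 * A)"
        "B * (- (h / (2 * B)) - 2 * (h / (2 * B))\<^sup>2) = - (h / 2) - h\<^sup>2 / (2 * B)"
        using Apos by (simp_all add: power2_eq_square field_simps)
      moreover have "h\<^sup>2 / (4 * A) \<le> 1" using h2 Apos by (simp add: divide_le_eq)
      moreover have "h\<^sup>2 / (2 * B) \<le> 1" using h2 Apos A by (simp add: divide_le_eq)
      ultimately have "log_weight A B y \<ge> log_weight A B x0 - 2" unfolding L by linarith
      with Lx show "log_weight A B x \<le> log_weight A B y + 2" by simp
    qed (use e9 in auto)
  next
    \<comment> \<open>The critical point is closer than 1 / S to the end 1, or at the end if A = 0.
      The interval is therefore placed at distance between 1 / S and 2 / S from 1; \<open>?M\<close>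
      bounds the logarithm near 1 directly and elsewhere by the tangent at 1 - 1 / S.\<close>
    case 3
    have S: "S \<ge> 2" using 3 A by (simp add: S_def)
    let ?M = "A * ln (1 / S) + B * ln 2"
    show thesis
    proof (rule that[of "1 - 2 / S" "1 - 1 / S" 2])
      show "-1 < 1 - 2 / S" "1 - 2 / S < 1 - 1 / S" "1 - 1 / S < 1" using S by (auto simp: field_simps)
      have "2 * sqrt (2 * (1 - (1 - 2 / S))) / (1 - 1 / S - (1 - 2 / S)) = 4 * (S / sqrt S)"
        using S by (simp add: real_sqrt_divide field_simps)
      also have "S / sqrt S = sqrt S" using S by (simp add: real_div_sqrt)
      also have "4 * sqrt S \<le> 7 * sqrt s" using sS real_sqrt_ge_zero[of S] S by linarith
      finally show "2 * sqrt (2 * (1 - (1 - 2 / S))) / (1 - 1 / S - (1 - 2 / S)) \<le> 7 * sqrt s" .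
      fix x y :: real assume x: "-1 < x" "x < 1" and y: "1 - 2 / S \<le> y" "y \<le> 1 - 1 / S"
      have upper: "log_weight A B x \<le> ?M" if "1 - 1 / S \<le> x" "x < 1" for x
      proof -
        have "1 + x > 0" using that S by (smt (verit) divide_le_eq_1)
        then have "ln (1 - x) \<le> ln (1 / S)" "ln (1 + x) \<le> ln 2"
          using that S by (auto simp del: ln_div)
        then show ?thesis using A by (auto simp: log_weight_def intro!: add_mono mult_left_mono)
      qed
      have Lx: "log_weight A B x \<le> ?M"
      proof (cases "1 - 1 / S \<le> x")
        case False
        let ?z = "1 - 1 / S"
        have "A / (1 - ?z) \<le> S / 2" using 3 S mult_right_mono[of A "1 / 2" S] by simp
        moreover have "S / 2 \<le> B / (1 + ?z)"
        proof -
          have "S * (1 + ?z) = 2 * S - 1" using S by (simp add: field_simps)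
          also have "\<dots> \<le> 2 * B" using 3 by (simp add: S_def)
          finally show ?thesis using S by (simp add: field_simps)
        qed
        ultimately have "0 \<le> B / (1 + ?z) - A / (1 - ?z)" by linarith
        then have "(x - ?z) * (B / (1 + ?z) - A / (1 - ?z)) \<le> 0"
          using False mult_nonpos_nonneg[of "x - ?z"] by simp
        then have "log_weight A B x \<le> log_weight A B ?z"
          using log_weight_tangent[of A B x ?z] A x S by (smt (verit) divide_pos_pos divide_le_eq_1)
        with upper[of ?z] S show ?thesis by simp
      qed (use upper x in auto)
      define h where "h = (1 - y) / 2"
      have h: "1 / (2 * S) \<le> h" "h \<le> 1 / S" using y S by (auto simp: h_def field_simps)
      have h0: "0 < h" "h \<le> 1 / 2"
        using h S by (smt (verit) divide_pos_pos, smt (verit) frac_le)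
      have "0 < 1 / S" "1 / S \<le> 1 - y" using y S by auto
      then have "ln (1 / S) \<le> ln (1 - y)" by (subst ln_le_cancel_iff) linarith+
      then have "A * ln (1 / S) \<le> A * ln (1 - y)" using A by (intro mult_left_mono)
      moreover have "ln (1 + y) = ln 2 + ln (1 - h)"
      proof -
        have "1 + y = 2 * (1 - h)" by (simp add: h_def field_simps)
        then show ?thesis using h0 by (simp only: ln_mult) (simp add: ln_mult)
      qed
      moreover have "B * (- h - 2 * h\<^sup>2) \<le> B * ln (1 - h)"
        using h0 A by (intro mult_left_mono ln_one_minus_pos_lower_bound) auto
      moreover have "B * (h + 2 * h\<^sup>2) \<le> 2"
      proof -
        have "h + 2 * h\<^sup>2 \<le> 2 * h" using h0 by (simp add: power2_eq_square)
        then have "B * (h + 2 * h\<^sup>2) \<le> S * (2 * (1 / S))"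
          using h A h0 S by (intro mult_mono) (auto simp: S_def)
        then show ?thesis using S by simp
      qed
      ultimately have "log_weight A B y \<ge> ?M - 2" by (simp add: log_weight_def algebra_simps)
      with Lx show "log_weight A B x \<le> log_weight A B y + 2" by simp
    qed (use e9 in auto)
  qed
qed

section \<open>Small degree: pointwise control by the Dirichlet integral\<close>

context jacobi_eigenpoly
begin

definition U where "U x = exp (log_weight (\<alpha> + 1 / 2) (\<beta> + 1 / 2) x)"

lemma U_eq:
  assumes "-1 < x" "x < 1"
  shows "U x = sqrt (1 - x\<^sup>2) * jacobi_weight \<alpha> \<beta> x"
proof -
  have "sqrt (1 - x\<^sup>2) = (1 - x) powr (1 / 2) * (1 + x) powr (1 / 2)"
    using assms by (simp add: powr_half_sqrt real_sqrt_mult[symmetric] power2_eq_square algebra_simps)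
  then show ?thesis
    using assms by (simp add: U_def log_weight_def jacobi_weight_def powr_def exp_add[symmetric] algebra_simps)
qed

lemma U_pos: "U x > 0" by (simp add: U_def)

text \<open>By averaging, U p^2 is moderate at some point y of the plateau. The change of p^2 from y
  to x is the integral of 2 p p', and the two known integrals of p^2 w and (1 - x^2) p'^2 w control
  it.\<close>

lemma bound_small_aux:
  assumes AB: "\<alpha> \<le> \<beta>" and n6: "n \<le> 6" and x: "-1 < x" "x < 1"
  shows "(jacobi_F_open \<alpha> \<beta> p x)\<^sup>2 \<le> 4320 * sqrt s"
proof -
  let ?w = "jacobi_weight \<alpha> \<beta>"
  let ?L = "log_weight (\<alpha> + 1 / 2) (\<beta> + 1 / 2)"
  have s: "1 \<le> s" "(\<alpha> + 1 / 2) + (\<beta> + 1 / 2) \<le> s" by (auto simp: s_def)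
  obtain y1 y2 c where y12: "-1 < y1" "y1 < y2" "y2 < 1" and c: "0 \<le> c" "exp c \<le> 64"
    and plateau: "\<And>x y. -1 < x \<Longrightarrow> x < 1 \<Longrightarrow> y1 \<le> y \<Longrightarrow> y \<le> y2 \<Longrightarrow> ?L x \<le> ?L y + c"
    and len: "2 * sqrt (2 * (1 - y1)) / (y2 - y1) \<le> 7 * sqrt s"
    by (rule log_weight_plateau[of "\<alpha> + 1 / 2" "\<beta> + 1 / 2" s]) (use AB alpha_ge s in auto)
  \<comment> \<open>The parameter of the arithmetic-geometric inequality for 2 |p p'|, large enough
    for the eigenvalue: 6 (6 + s) <= 42 s <= \<kappa>^2.\<close>
  define \<kappa> where "\<kappa> = 7 * sqrt s"
  have \<kappa>: "\<kappa> > 0" "\<kappa>\<^sup>2 = 49 * s" using s by (auto simp: \<kappa>_def power_mult_distrib)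
  define \<mu> where "\<mu> = n * (n + \<alpha> + \<beta> + 1)"
  have \<mu>: "\<mu> \<le> \<kappa>\<^sup>2"
  proof -
    have "\<mu> \<le> 6 * (6 + s)"
      unfolding \<mu>_def using n6 s alpha_ge beta_ge by (intro mult_mono) auto
    then show ?thesis using s \<kappa> by simp
  qed
  let ?G = "\<lambda>z. (1 / \<kappa>) * ((1 - z\<^sup>2) * (poly (pderiv p) z)\<^sup>2 * ?w z) + \<kappa> * ((poly p z)\<^sup>2 * ?w z)"
  have G: "(?G has_integral (1 / \<kappa>) * \<mu> + \<kappa> * 1) {-1..1}"
    unfolding \<mu>_def
    by (intro has_integral_add has_integral_mult_right deriv_has_integral norm_has_integral)
  have G0: "?G z \<ge> 0" if "z \<in> {-1..1}" for z
  proof -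
    have "1 - z\<^sup>2 \<ge> 0" using that by (auto simp: abs_square_le_1)
    then show ?thesis using \<kappa> jacobi_weight_nonneg[of z]
      by (intro add_nonneg_nonneg mult_nonneg_nonneg) auto
  qed
  have Gtot: "(1 / \<kappa>) * \<mu> + \<kappa> * 1 \<le> 14 * sqrt s"
  proof -
    have "\<mu> / \<kappa> \<le> \<kappa>" using \<mu> \<kappa> by (simp add: divide_le_eq power2_eq_square)
    then show ?thesis by (simp add: \<kappa>_def)
  qed
  have pair: "U x * (2 * \<bar>poly p z * poly (pderiv p) z\<bar>) \<le> exp c * ?G z"
    if y: "y1 \<le> y" "y \<le> y2" and z: "min x y \<le> z" "z \<le> max x y" for y z
  proof -
    have z1: "-1 < z" "z < 1" using x y y12 z by (auto simp: min_def max_def split: if_splits)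
    \<comment> \<open>Every z between x and y carries at least the smaller of the weights at x and
      y, and y lies on the plateau. So the factor U x may be moved inside the integral at the cost
      of exp c.\<close>
    have "min (?L x) (?L y) \<le> ?L z"
    proof (cases "x \<le> y")
      case True
      then show ?thesis using log_weight_quasiconcave[of "\<alpha> + 1/2" "\<beta> + 1/2" x z y] x y y12 z alpha_ge beta_ge by auto
    next
      case False
      then show ?thesis using log_weight_quasiconcave[of "\<alpha> + 1/2" "\<beta> + 1/2" y z x] x y y12 z alpha_ge beta_ge
        by (auto simp: min.commute)
    qed
    then have "?L x \<le> ?L z + c" using plateau[OF x y] c by auto
    then have "U x \<le> U z * exp c" unfolding U_def by (simp flip: exp_add)
    then have "U x * (2 * \<bar>poly p z * poly (pderiv p) z\<bar>) \<le> U z * exp c * (2 * \<bar>poly p z * poly (pderiv p) z\<bar>)"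
      by (intro mult_right_mono) auto
    also have "\<dots> = exp c * (?w z * (2 * \<bar>poly p z\<bar> * (sqrt (1 - z\<^sup>2) * \<bar>poly (pderiv p) z\<bar>)))"
      by (simp add: U_eq[OF z1] abs_mult)
    also have "\<dots> \<le> exp c * (?w z * (\<kappa> * (poly p z)\<^sup>2 + (1 / \<kappa>) * ((1 - z\<^sup>2) * (poly (pderiv p) z)\<^sup>2)))"
    proof (intro mult_left_mono)
      let ?a = "\<bar>poly p z\<bar>" and ?b = "sqrt (1 - z\<^sup>2) * \<bar>poly (pderiv p) z\<bar>"
      have "1 - z\<^sup>2 \<ge> 0" using z1 by (simp add: abs_square_le_1)
      then have b2: "?b\<^sup>2 = (1 - z\<^sup>2) * (poly (pderiv p) z)\<^sup>2" by (simp add: power_mult_distrib)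
      have "0 \<le> (\<kappa> * ?a - ?b)\<^sup>2 / \<kappa>" using \<kappa> by simp
      also have "\<dots> = \<kappa> * ?a\<^sup>2 + (1 / \<kappa>) * ?b\<^sup>2 - 2 * ?a * ?b"
        using \<kappa>(1) by (simp add: power2_diff power_mult_distrib field_simps) (simp add: power2_eq_square)
      finally show "2 * ?a * ?b \<le> \<kappa> * (poly p z)\<^sup>2 + (1 / \<kappa>) * ((1 - z\<^sup>2) * (poly (pderiv p) z)\<^sup>2)"
        unfolding b2 by simp
    qed (use jacobi_weight_nonneg in auto)
    finally show ?thesis by (simp add: algebra_simps)
  qed
  have step: "U x * (poly p x)\<^sup>2 \<le> exp c * (U y * (poly p y)\<^sup>2 + 14 * sqrt s)" if y: "y1 \<le> y" "y \<le> y2" for y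
  proof -
    define l where "l = min x y"
    define u where "u = max x y"
    have lu: "l \<le> u" "{l..u} \<subseteq> {-1..1}" using x y y12 by (auto simp: l_def u_def)
    have ftc: "((\<lambda>z. 2 * (poly p z * poly (pderiv p) z)) has_integral (poly p u)\<^sup>2 - (poly p l)\<^sup>2) {l..u}"
      by (rule fundamental_theorem_of_calculus[OF lu(1)])
        (auto intro!: derivative_eq_intros simp flip: has_real_derivative_iff_has_vector_derivative)
    have Gi: "?G integrable_on {l..u}"
      by (rule integrable_on_subinterval[OF has_integral_integrable[OF G] lu(2)])
    have Gle: "integral {l..u} ?G \<le> 14 * sqrt s"
    proof -
      have "integral {l..u} ?G \<le> integral {-1..1} ?G"
        by (rule integral_subset_le[OF lu(2) Gi has_integral_integrable[OF G]]) (use G0 in auto)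
      then show ?thesis using integral_unique[OF G] Gtot by simp
    qed
    have bnd: "U x * (2 * \<bar>poly p z * poly (pderiv p) z\<bar>) \<le> exp c * ?G z" if "z \<in> {l..u}" for z
      using pair[OF y, of z] that by (simp add: l_def u_def)
    have "U x * ((poly p u)\<^sup>2 - (poly p l)\<^sup>2) \<le> exp c * integral {l..u} ?G"
    proof (rule has_integral_le[OF has_integral_mult_right[OF ftc] has_integral_mult_right[OF integrable_integral[OF Gi]]])
      fix z assume z: "z \<in> {l..u}"
      have "U x * (2 * (poly p z * poly (pderiv p) z)) \<le> U x * (2 * \<bar>poly p z * poly (pderiv p) z\<bar>)"
        using U_pos[of x] by (intro mult_left_mono) auto
      with bnd[OF z] show "U x * (2 * (poly p z * poly (pderiv p) z)) \<le> exp c * ?G z" by linarith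
    qed
    moreover have "- U x * ((poly p u)\<^sup>2 - (poly p l)\<^sup>2) \<le> exp c * integral {l..u} ?G"
    proof (rule has_integral_le[OF has_integral_mult_right[OF ftc] has_integral_mult_right[OF integrable_integral[OF Gi]]])
      fix z assume z: "z \<in> {l..u}"
      have "U x * (2 * (- (poly p z * poly (pderiv p) z))) \<le> U x * (2 * \<bar>poly p z * poly (pderiv p) z\<bar>)"
        using U_pos[of x] by (intro mult_left_mono) auto
      moreover have "- U x * (2 * (poly p z * poly (pderiv p) z)) = U x * (2 * (- (poly p z * poly (pderiv p) z)))"
        by simp
      ultimately show "- U x * (2 * (poly p z * poly (pderiv p) z)) \<le> exp c * ?G z"
        using bnd[OF z] by linarith
    qed
    ultimately have "U x * ((poly p x)\<^sup>2 - (poly p y)\<^sup>2) \<le> exp c * integral {l..u} ?G"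
      by (cases "x \<le> y") (simp_all add: l_def u_def min_def max_def algebra_simps)
    also have "\<dots> \<le> exp c * (14 * sqrt s)" using Gle by (intro mult_left_mono) auto
    finally have "U x * (poly p x)\<^sup>2 \<le> U x * (poly p y)\<^sup>2 + exp c * (14 * sqrt s)" by (simp add: algebra_simps)
    moreover have "U x \<le> exp c * U y" using plateau[OF x y] unfolding U_def by (simp flip: exp_add add: add.commute)
    then have "U x * (poly p y)\<^sup>2 \<le> exp c * U y * (poly p y)\<^sup>2" by (intro mult_right_mono) auto
    ultimately show ?thesis by (simp add: algebra_simps)
  qed
  \<comment> \<open>Since sqrt (1 - z^2) <= sqrt (2 (1 - y1)) on the plateau, its angular length is
    at least 2 / M. Were U p^2 above M throughout, the integral of p^2 w = U p^2 / sqrt (1 - z^2)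
    would be at least 2 instead of at most 1.\<close>
  define M where "M = 2 * sqrt (2 * (1 - y1)) / (y2 - y1)"
  have "\<exists>y. y1 \<le> y \<and> y \<le> y2 \<and> U y * (poly p y)\<^sup>2 \<le> M"
  proof (rule ccontr)
    assume no: "\<not> (\<exists>y. y1 \<le> y \<and> y \<le> y2 \<and> U y * (poly p y)\<^sup>2 \<le> M)"
    let ?k = "M / sqrt (2 * (1 - y1))"
    let ?f = "\<lambda>z. (poly p z)\<^sup>2 * ?w z"
    have sub: "{y1..y2} \<subseteq> {-1..1}" using y12 by auto
    have fi: "?f integrable_on {y1..y2}"
      by (rule integrable_on_subinterval[OF has_integral_integrable[OF norm_has_integral] sub])
    have "(y2 - y1) * ?k \<le> integral {y1..y2} ?f"
    proof (rule has_integral_le[OF _ integrable_integral[OF fi]])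
      show "((\<lambda>z. ?k) has_integral (y2 - y1) * ?k) {y1..y2}"
        using has_integral_const_real[of ?k y1 y2] y12 by simp
      fix z assume z: "z \<in> {y1..y2}"
      then have z1: "-1 < z" "z < 1" using y12 by auto
      have M: "M < U z * (poly p z)\<^sup>2" using no z by force
      have sq: "0 < 1 - z\<^sup>2" using z1 by (simp add: abs_square_less_1)
      have "1 - z\<^sup>2 = (1 - z) * (1 + z)" by (simp add: power2_eq_square algebra_simps)
      also have "\<dots> \<le> (1 - y1) * 2" using z z1 by (intro mult_mono) auto
      finally have le: "sqrt (1 - z\<^sup>2) \<le> sqrt (2 * (1 - y1))" by simp
      have "M \<ge> 0" using y12 by (simp add: M_def)
      then have "?k \<le> M / sqrt (1 - z\<^sup>2)" using le sq y12 by (intro divide_left_mono) auto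
      also have "\<dots> \<le> U z * (poly p z)\<^sup>2 / sqrt (1 - z\<^sup>2)" using M sq by (intro divide_right_mono) auto
      also have "\<dots> = ?f z" using sq by (simp add: U_eq[OF z1])
      finally show "?k \<le> ?f z" .
    qed
    also have "\<dots> \<le> integral {-1..1} ?f"
      by (rule integral_subset_le[OF sub fi has_integral_integrable[OF norm_has_integral]])
        (use jacobi_weight_nonneg in auto)
    also have "\<dots> = 1" using norm_has_integral by (rule integral_unique)
    also have "?k = 2 / (y2 - y1)" using y12 by (simp add: M_def)
    also have "(y2 - y1) * (2 / (y2 - y1)) = 2" using y12 by (simp add: field_simps)
    finally show False by simp
  qed
  then obtain y where y: "y1 \<le> y" "y \<le> y2" "U y * (poly p y)\<^sup>2 \<le> M" by blast
  have "U x * (poly p x)\<^sup>2 \<le> exp c * (U y * (poly p y)\<^sup>2 + 14 * sqrt s)" by (rule step[OF y(1,2)])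
  also have "\<dots> \<le> 64 * (21 * sqrt s)"
    using y(3) len c s U_pos[of y] unfolding M_def[symmetric]
    by (intro mult_mono) (auto intro!: add_nonneg_nonneg mult_nonneg_nonneg simp: less_imp_le)
  also have "\<dots> \<le> 4320 * sqrt s" using s by simp
  finally show ?thesis by (simp add: jacobi_F_open_sq[OF x] U_eq[OF x])
qed

lemma bound_small:
  assumes "n \<le> 6" "-1 < x" "x < 1"
  shows "(jacobi_F_open \<alpha> \<beta> p x)\<^sup>2 \<le> 4320 * sqrt s"
proof (cases "\<alpha> \<le> \<beta>")
  case True then show ?thesis using bound_small_aux assms by simp
next
  case False
  interpret R: jacobi_eigenpoly \<beta> \<alpha> n "p \<circ>\<^sub>p [:0, -1:]" by (rule reflected)
  have "R.s = s" by (simp add: R.s_def s_def add.commute)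
  then show ?thesis using R.bound_small_aux[of "- x"] assms False by (simp add: jacobi_F_open_reflect)
qed

lemma jacobi_F_open_sq_le:
  assumes "-1 < x" "x < 1"
  shows "(jacobi_F_open \<alpha> \<beta> p x)\<^sup>2 \<le> 4320 * sqrt (max 1 (\<alpha> + \<beta> + 1))"
proof (cases "n \<le> 6")
  case True
  then show ?thesis using bound_small[OF _ assms] by (simp add: s_def)
next
  case False
  then interpret jacobi_eigenpoly_large \<alpha> \<beta> n p by unfold_locales simp
  show ?thesis using bound_large[OF assms] by (simp add: s_def)
qed

end

section \<open>From the eigenvalue equation to the conjecture: ends of the interval, maximum, and
  the factor M\<close>

lemma orthonormal_jacobi_eigenpoly:
  assumes "\<alpha> \<ge> -1/2" "\<beta> \<ge> -1/2" "orthonormal_jacobi \<alpha> \<beta> p"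
  shows "jacobi_eigenpoly \<alpha> \<beta> n (p n)"
proof
  show "jacobi_op \<alpha> \<beta> (p n) = smult (- (n * (n + \<alpha> + \<beta> + 1))) (p n)"
    by (rule orthonormal_jacobi_ode) (use assms in auto)
qed (use assms in \<open>auto simp: orthonormal_jacobi_def\<close>)

text \<open>At the two ends both inequalities pass to the one-sided limits. Nonnegativity is what
  allows squaring the bound afterwards.\<close>

lemma jacobi_F_nonneg_le:
  assumes ab: "\<alpha> \<ge> -1/2" "\<beta> \<ge> -1/2" and p: "orthonormal_jacobi \<alpha> \<beta> p" and x: "x \<in> {-1..1}"
  shows "0 \<le> jacobi_F \<alpha> \<beta> (p n) x" "jacobi_F \<alpha> \<beta> (p n) x \<le> 1.2 * 10 ^ 5 * jacobi_M \<alpha> \<beta>"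
proof -
  interpret jacobi_eigenpoly \<alpha> \<beta> n "p n" by (rule orthonormal_jacobi_eigenpoly[OF assms(1-3)])
  let ?F = "jacobi_F_open \<alpha> \<beta> (p n)"
  have M1: "jacobi_M \<alpha> \<beta> \<ge> 1" by (simp add: jacobi_M_def)
  have sM: "sqrt (max 1 (\<alpha> + \<beta> + 1)) \<le> (jacobi_M \<alpha> \<beta>)\<^sup>2"
  proof (cases "\<alpha> + \<beta> + 1 \<le> 1")
    case True
    then have "sqrt (max 1 (\<alpha> + \<beta> + 1)) = 1\<^sup>2" by (simp add: max_def)
    also have "\<dots> \<le> (jacobi_M \<alpha> \<beta>)\<^sup>2" using M1 by (intro power_mono) auto
    finally show ?thesis .
  next
    case False
    then have "sqrt (max 1 (\<alpha> + \<beta> + 1)) = ((\<alpha> + \<beta> + 1) powr (1 / 4))\<^sup>2"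
      using powr_half_sq[of "\<alpha> + \<beta> + 1" "1 / 2"] by (simp add: powr_half_sqrt max_def)
    also have "\<dots> \<le> (jacobi_M \<alpha> \<beta>)\<^sup>2" by (intro power_mono) (auto simp: jacobi_M_def)
    finally show ?thesis .
  qed
  have le: "?F y \<le> 1.2 * 10 ^ 5 * jacobi_M \<alpha> \<beta>" and ge: "0 \<le> ?F y" if "-1 < y" "y < 1" for y
  proof -
    show "0 \<le> ?F y" by (simp add: jacobi_F_open_def)
    show "?F y \<le> 1.2 * 10 ^ 5 * jacobi_M \<alpha> \<beta>"
    proof (rule power2_le_imp_le)
      have "(?F y)\<^sup>2 \<le> 4320 * (jacobi_M \<alpha> \<beta>)\<^sup>2" using jacobi_F_open_sq_le[OF that] sM by linarith
      also have "\<dots> \<le> (1.2 * 10 ^ 5)\<^sup>2 * (jacobi_M \<alpha> \<beta>)\<^sup>2"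
        by (intro mult_right_mono) (auto simp: power2_eq_square)
      finally show "(?F y)\<^sup>2 \<le> (1.2 * 10 ^ 5 * jacobi_M \<alpha> \<beta>)\<^sup>2" by (simp only: power_mult_distrib)
    qed (use M1 in simp)
  qed
  have ev: "eventually (\<lambda>y::real. -1 < y \<and> y < 1) (at_left 1)" "eventually (\<lambda>y::real. -1 < y \<and> y < 1) (at_right (-1))"
    using eventually_at_left_real[of "-1" "1::real"] eventually_at_right_real[of "-1" "1::real"] by simp_all
  consider "x = 1" | "x = -1" | "-1 < x" "x < 1" using x by fastforce
  then have "0 \<le> jacobi_F \<alpha> \<beta> (p n) x \<and> jacobi_F \<alpha> \<beta> (p n) x \<le> 1.2 * 10 ^ 5 * jacobi_M \<alpha> \<beta>"
  proof cases
    case 1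
    have "0 \<le> jacobi_F \<alpha> \<beta> (p n) 1"
      by (rule tendsto_lowerbound[OF jacobi_F_tendsto(1)[OF ab] eventually_mono[OF ev(1)]]) (use ge in auto)
    moreover have "jacobi_F \<alpha> \<beta> (p n) 1 \<le> 1.2 * 10 ^ 5 * jacobi_M \<alpha> \<beta>"
      by (rule tendsto_upperbound[OF jacobi_F_tendsto(1)[OF ab] eventually_mono[OF ev(1)]]) (use le in auto)
    ultimately show ?thesis using 1 by simp
  next
    case 2
    have "0 \<le> jacobi_F \<alpha> \<beta> (p n) (-1)"
      by (rule tendsto_lowerbound[OF jacobi_F_tendsto(2)[OF ab] eventually_mono[OF ev(2)]]) (use ge in auto)
    moreover have "jacobi_F \<alpha> \<beta> (p n) (-1) \<le> 1.2 * 10 ^ 5 * jacobi_M \<alpha> \<beta>"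
      by (rule tendsto_upperbound[OF jacobi_F_tendsto(2)[OF ab] eventually_mono[OF ev(2)]]) (use le in auto)
    ultimately show ?thesis using 2 by simp
  next
    case 3
    then show ?thesis using le ge by (simp add: jacobi_F_def)
  qed
  then show "0 \<le> jacobi_F \<alpha> \<beta> (p n) x" "jacobi_F \<alpha> \<beta> (p n) x \<le> 1.2 * 10 ^ 5 * jacobi_M \<alpha> \<beta>" by auto
qed

text \<open>Supplies the existence of the maximum that the conjecture speaks of.\<close>

lemma continuous_on_jacobi_F:
  assumes "\<alpha> \<ge> -1/2" "\<beta> \<ge> -1/2"
  shows "continuous_on {-1..1} (jacobi_F \<alpha> \<beta> q)"
proof (rule continuous_on_IccI)
  have eq: "\<forall>\<^sub>F y in at_left 1. jacobi_F_open \<alpha> \<beta> q y = jacobi_F \<alpha> \<beta> q y"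
    "\<forall>\<^sub>F y in at_right (-1). jacobi_F_open \<alpha> \<beta> q y = jacobi_F \<alpha> \<beta> q y"
    using eventually_at_left_real[of "-1" "1::real"] eventually_at_right_real[of "-1" "1::real"]
    by (auto elim!: eventually_mono simp: jacobi_F_def)
  show "(jacobi_F \<alpha> \<beta> q \<longlongrightarrow> jacobi_F \<alpha> \<beta> q 1) (at_left 1)"
    "(jacobi_F \<alpha> \<beta> q \<longlongrightarrow> jacobi_F \<alpha> \<beta> q (-1)) (at_right (-1))"
    using Lim_transform_eventually[OF jacobi_F_tendsto(1)[OF assms] eq(1)]
      Lim_transform_eventually[OF jacobi_F_tendsto(2)[OF assms] eq(2)] by auto
  fix x :: real assume x: "-1 < x" "x < 1"
  have "continuous (at x) (\<lambda>x. (1 - x) powr (\<alpha>/2 + 1/4) * (1 + x) powr (\<beta>/2 + 1/4) * \<bar>poly q x\<bar>)"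
    using x by (intro continuous_intros) auto
  then have "((\<lambda>x. (1 - x) powr (\<alpha>/2 + 1/4) * (1 + x) powr (\<beta>/2 + 1/4) * \<bar>poly q x\<bar>) \<longlongrightarrow> jacobi_F_open \<alpha> \<beta> q x) (at x)"
    using x by (simp add: continuous_at jacobi_F_open_eq)
  moreover have "eventually (\<lambda>y. y \<in> {-1<..<1}) (at x)"
    using x by (intro eventually_at_in_open') auto
  then have "\<forall>\<^sub>F y in at x. (1 - y) powr (\<alpha>/2 + 1/4) * (1 + y) powr (\<beta>/2 + 1/4) * \<bar>poly q y\<bar> = jacobi_F \<alpha> \<beta> q y"
    by eventually_elim (auto simp: jacobi_F_def jacobi_F_open_eq)
  ultimately have "(jacobi_F \<alpha> \<beta> q \<longlongrightarrow> jacobi_F_open \<alpha> \<beta> q x) (at x)"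
    by (rule Lim_transform_eventually)
  moreover have "jacobi_F_open \<alpha> \<beta> q x = jacobi_F \<alpha> \<beta> q x" using x by (simp add: jacobi_F_def)
  ultimately show "(jacobi_F \<alpha> \<beta> q \<longlongrightarrow> jacobi_F \<alpha> \<beta> q x) (at x)" by simp
qed simp

lemma jacobi_M_sq_le:
  assumes "\<alpha> \<ge> -1/2" "\<beta> \<ge> -1/2"
  shows "(jacobi_M \<alpha> \<beta>)\<^sup>2 \<le> 3 * max 1 ((\<alpha>\<^sup>2 + \<beta>\<^sup>2) powr (1/4))"
proof (cases "\<alpha> + \<beta> + 1 \<le> 1")
  case True
  then have "(\<alpha> + \<beta> + 1) powr (1/4) \<le> 1" using assms by (intro powr_le1) auto
  then have "jacobi_M \<alpha> \<beta> = 1" by (simp add: jacobi_M_def)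
  then show ?thesis by simp
next
  case False
  define q where "q = max 1 (\<alpha>\<^sup>2 + \<beta>\<^sup>2)"
  have q: "q \<ge> 1" "\<alpha>\<^sup>2 + \<beta>\<^sup>2 \<le> q" by (auto simp: q_def)
  have "jacobi_M \<alpha> \<beta> = (\<alpha> + \<beta> + 1) powr (1/4)"
    using False ge_one_powr_ge_zero[of "\<alpha> + \<beta> + 1" "1/4"] by (simp add: jacobi_M_def)
  then have "(jacobi_M \<alpha> \<beta>)\<^sup>2 = sqrt (\<alpha> + \<beta> + 1)"
    using powr_half_sq[of "\<alpha> + \<beta> + 1" "1 / 2"] False by (simp add: powr_half_sqrt)
  \<comment> \<open>(\<alpha> + \<beta> + 1)^2 <= 3 (\<alpha>^2 + \<beta>^2 + 1) <= 6 q by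
    Cauchy-Schwarz; 6 is rounded up to 81 = 3^4 so that its fourth root is an integer.\<close>
  also have "\<dots> \<le> sqrt (9 * sqrt q)"
  proof (rule real_sqrt_le_mono)
    have "0 \<le> (\<alpha> - \<beta>)\<^sup>2 + (\<alpha> - 1)\<^sup>2 + (\<beta> - 1)\<^sup>2" by simp
    then have "(\<alpha> + \<beta> + 1)\<^sup>2 \<le> 3 * (\<alpha>\<^sup>2 + \<beta>\<^sup>2 + 1)" by (simp add: power2_eq_square algebra_simps)
    also have "\<dots> \<le> 9\<^sup>2 * q" using q by simp
    finally have "\<alpha> + \<beta> + 1 \<le> sqrt (9\<^sup>2 * q)" by (rule real_le_rsqrt)
    then show "\<alpha> + \<beta> + 1 \<le> 9 * sqrt q" by (simp add: real_sqrt_mult)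
  qed
  also have "\<dots> = 3 * sqrt (sqrt q)" using real_sqrt_mult[of "3\<^sup>2" "sqrt q"] by simp
  also have "sqrt (sqrt q) = q powr (1/4)" using q by (simp add: powr_half_sqrt[symmetric] powr_powr)
  also have "q powr (1/4) = max 1 ((\<alpha>\<^sup>2 + \<beta>\<^sup>2) powr (1/4))"
  proof (cases "\<alpha>\<^sup>2 + \<beta>\<^sup>2 \<le> 1")
    case True
    then have "(\<alpha>\<^sup>2 + \<beta>\<^sup>2) powr (1/4) \<le> 1" by (intro powr_le1) auto
    then show ?thesis using True by (simp add: q_def max_def)
  next
    case False
    then show ?thesis using ge_one_powr_ge_zero[of "\<alpha>\<^sup>2 + \<beta>\<^sup>2" "1/4"] by (simp add: q_def max_def)
  qed
  finally show ?thesis .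
qed

theorem corollary1p2:
  shows "(\<forall>(n::nat) (\<alpha>::real) (\<beta>::real) p x.
            \<alpha> \<ge> -1/2 \<and> \<beta> \<ge> -1/2 \<and> orthonormal_jacobi \<alpha> \<beta> p \<and> x \<in> {-1..1} \<longrightarrow>
            jacobi_F \<alpha> \<beta> (p n) x \<le> 1.2 * 10 ^ 5 * jacobi_M \<alpha> \<beta>) \<and>
         (\<exists>C::real. \<forall>(n::nat) (\<alpha>::real) (\<beta>::real) p.
            \<alpha> \<ge> -1/2 \<and> \<beta> \<ge> -1/2 \<and> orthonormal_jacobi \<alpha> \<beta> p \<longrightarrow>
            (\<exists>y\<in>{-1..1}. (\<forall>x\<in>{-1..1}. (jacobi_F \<alpha> \<beta> (p n) x)\<^sup>2 \<le> (jacobi_F \<alpha> \<beta> (p n) y)\<^sup>2) \<and>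
               (jacobi_F \<alpha> \<beta> (p n) y)\<^sup>2 \<le> C * max 1 ((\<alpha>\<^sup>2 + \<beta>\<^sup>2) powr (1/4))))"
proof (intro conjI exI allI impI)
  fix n :: nat and \<alpha> \<beta> x :: real and p
  assume "\<alpha> \<ge> -1/2 \<and> \<beta> \<ge> -1/2 \<and> orthonormal_jacobi \<alpha> \<beta> p \<and> x \<in> {-1..1}"
  then show "jacobi_F \<alpha> \<beta> (p n) x \<le> 1.2 * 10 ^ 5 * jacobi_M \<alpha> \<beta>" using jacobi_F_nonneg_le(2) by blast
next
  fix n :: nat and \<alpha> \<beta> :: real and p
  assume "\<alpha> \<ge> -1/2 \<and> \<beta> \<ge> -1/2 \<and> orthonormal_jacobi \<alpha> \<beta> p"
  then have ab: "\<alpha> \<ge> -1/2" "\<beta> \<ge> -1/2" and p: "orthonormal_jacobi \<alpha> \<beta> p" by auto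
  let ?F = "jacobi_F \<alpha> \<beta> (p n)"
  have "\<exists>y\<in>{-1..1}. \<forall>x\<in>{-1..1}. (?F x)\<^sup>2 \<le> (?F y)\<^sup>2"
    by (rule continuous_attains_sup) (auto intro!: continuous_intros continuous_on_jacobi_F ab)
  then obtain y where y: "y \<in> {-1..1}" "\<forall>x\<in>{-1..1}. (?F x)\<^sup>2 \<le> (?F y)\<^sup>2" by blast
  have "(?F y)\<^sup>2 \<le> (1.2 * 10 ^ 5 * jacobi_M \<alpha> \<beta>)\<^sup>2"
    using jacobi_F_nonneg_le[OF ab p y(1)] by (intro power_mono) auto
  also have "\<dots> = (1.2 * 10 ^ 5)\<^sup>2 * (jacobi_M \<alpha> \<beta>)\<^sup>2" by (simp only: power_mult_distrib)
  also have "\<dots> \<le> (1.2 * 10 ^ 5)\<^sup>2 * (3 * max 1 ((\<alpha>\<^sup>2 + \<beta>\<^sup>2) powr (1/4)))"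
    by (intro mult_left_mono jacobi_M_sq_le ab) auto
  finally show "\<exists>y\<in>{-1..1}. (\<forall>x\<in>{-1..1}. (?F x)\<^sup>2 \<le> (?F y)\<^sup>2) \<and>
      (?F y)\<^sup>2 \<le> ((1.2 * 10 ^ 5)\<^sup>2 * 3) * max 1 ((\<alpha>\<^sup>2 + \<beta>\<^sup>2) powr (1/4))"
    using y by (auto simp only: mult.assoc)
qed

end
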